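(* Let $(Y_n)_{n\ge1}$ and $(W_n)_{n\ge1}$ be two sequences of nonnegative i.i.d. random variables, independent of each other, such that the $Y_i$ are regularly varying with index $\alpha\in(0,1)$ and $0<1/\nu=\mathbb{E}W_i<\infty$. Let $V_n=Y_1+\cdots+Y_n$ ($V_0=0$), let $$\sigma(t)=\sup\{k:\ W_1+\cdots+W_k\le t\},\qquad \sup\emptyset=0,$$ and let $(a_n)$ be a sequence with $a_n\to\infty$ and $n\,\mathbb{P}(Y_1>a_n)\to1$, with $a_t=a_{\lfloor t\rfloor}$ for real $t\ge1$. Then, as $t\to\infty$, $$\frac{V_{\sigma(t\,\cdot)}}{a_{\nu t}}\ \stackrel{d}{\longrightarrow}\ G_\alpha(\cdot)$$ in the space $D[0,\infty)$ endowed with Skorohod's $J_1$ topology, where $(G_\alpha(s))_{s\ge0}$ is an $\alpha$-stable subordinator.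
   Context: A nonnegative random variable $Z$ is regularly varying with index $\alpha>0$ if $\mathbb{P}(Z>x)=x^{-\alpha}\ell(x)$ with $\ell$ slowly varying at infinity. $D[0,\infty)$ is the space of real càdlàg functions on $[0,\infty)$; $V_{\sigma(t\,\cdot)}$ denotes the process $s\mapsto V_{\sigma(ts)}$, $s\ge0$. An $\alpha$-stable subordinator is a (non-degenerate) nondecreasing $\alpha$-stable Lévy process. *)

theory Defs
  imports "HOL-Probability.Probability"
begin

text \<open>
  Functions on \<open>[0,\<infinity>)\<close> are total functions on the reals that are \<^const>\<open>extensional\<close> on
  \<^term>\<open>{0::real..}\<close>, so that equality in the space means equality on \<open>[0,\<infinity>)\<close>.
\<close>

definition cadlag_space :: "(real \<Rightarrow> real) set" where
  "cadlag_space = {x \<in> extensional {0..}.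
     (\<forall>t\<ge>0. continuous (at_right t) x) \<and> (\<forall>t>0. \<exists>l. (x \<longlongrightarrow> l) (at_left t))}"

text \<open>
  Increasing bijections of \<open>[0,\<infinity>)\<close> onto itself; they automatically fix \<open>0\<close> and are
  homeomorphisms.
\<close>

definition time_changes :: "(real \<Rightarrow> real) set" where
  "time_changes = {\<theta>. strict_mono_on {0..} \<theta> \<and> \<theta> ` {0..} = {0..}}"

definition J1_nbhd :: "real \<Rightarrow> real \<Rightarrow> (real \<Rightarrow> real) \<Rightarrow> (real \<Rightarrow> real) set" where
  "J1_nbhd N \<epsilon> x = {y \<in> cadlag_space. \<exists>\<theta>\<in>time_changes.
     \<forall>s\<in>{0..N}. \<bar>\<theta> s - s\<bar> < \<epsilon> \<and> \<bar>y (\<theta> s) - x s\<bar> < \<epsilon>}"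

text \<open>
  Skorohod's \<open>J\<^sub>1\<close> topology on \<open>D[0,\<infinity>)\<close>, given by its neighbourhood filters. The lemma
  \<open>limitin_J1_iff\<close> below shows that its convergent sequences are the usual ones: there are time
  changes \<open>\<theta>\<^sub>n\<close> with \<open>\<theta>\<^sub>n \<rightarrow> id\<close> and \<open>x\<^sub>n \<circ> \<theta>\<^sub>n \<rightarrow> x\<close> uniformly on every \<open>[0,N]\<close>.
\<close>

definition J1_topology :: "(real \<Rightarrow> real) topology" where
  "J1_topology = topology (\<lambda>U. U \<subseteq> cadlag_space \<and>
     (\<forall>x\<in>U. \<exists>N. \<exists>\<epsilon>>0. J1_nbhd N \<epsilon> x \<subseteq> U))"

lemma J1_nbhd_mono: "N \<le> N' \<Longrightarrow> \<epsilon>' \<le> \<epsilon> \<Longrightarrow> J1_nbhd N' \<epsilon>' x \<subseteq> J1_nbhd N \<epsilon> x"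
proof
  fix y assume "N \<le> N'" "\<epsilon>' \<le> \<epsilon>" and y: "y \<in> J1_nbhd N' \<epsilon>' x"
  then obtain \<theta> where l: "\<theta> \<in> time_changes" "y \<in> cadlag_space"
    and 1: "\<forall>s\<in>{0..N'}. \<bar>\<theta> s - s\<bar> < \<epsilon>' \<and> \<bar>y (\<theta> s) - x s\<bar> < \<epsilon>'"
    unfolding J1_nbhd_def by blast
  have "\<bar>\<theta> s - s\<bar> < \<epsilon> \<and> \<bar>y (\<theta> s) - x s\<bar> < \<epsilon>" if s: "s \<in> {0..N}" for s
  proof -
    have "s \<in> {0..N'}" using s \<open>N \<le> N'\<close> by simp
    then show ?thesis using 1 \<open>\<epsilon>' \<le> \<epsilon>\<close> by (meson less_le_trans)
  qed
  then show "y \<in> J1_nbhd N \<epsilon> x" using l unfolding J1_nbhd_def by blast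
qed

lemma openin_J1:
  "openin J1_topology U \<longleftrightarrow> U \<subseteq> cadlag_space \<and> (\<forall>x\<in>U. \<exists>N. \<exists>\<epsilon>>0. J1_nbhd N \<epsilon> x \<subseteq> U)"
proof -
  have "istopology (\<lambda>U. U \<subseteq> cadlag_space \<and> (\<forall>x\<in>U. \<exists>N. \<exists>\<epsilon>>0. J1_nbhd N \<epsilon> x \<subseteq> U))"
    unfolding istopology_def
  proof (intro conjI allI impI ballI)
    fix S T x
    assume S: "S \<subseteq> cadlag_space \<and> (\<forall>x\<in>S. \<exists>N. \<exists>\<epsilon>>0. J1_nbhd N \<epsilon> x \<subseteq> S)"
      and T: "T \<subseteq> cadlag_space \<and> (\<forall>x\<in>T. \<exists>N. \<exists>\<epsilon>>0. J1_nbhd N \<epsilon> x \<subseteq> T)"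
      and x: "x \<in> S \<inter> T"
    obtain N \<epsilon> where 1: "\<epsilon> > 0" "J1_nbhd N \<epsilon> x \<subseteq> S" using S x by blast
    obtain N' \<epsilon>' where 2: "\<epsilon>' > 0" "J1_nbhd N' \<epsilon>' x \<subseteq> T" using T x by blast
    have "J1_nbhd (max N N') (min \<epsilon> \<epsilon>') x \<subseteq> S \<inter> T"
      using 1 2 J1_nbhd_mono[of N "max N N'" "min \<epsilon> \<epsilon>'" \<epsilon> x]
        J1_nbhd_mono[of N' "max N N'" "min \<epsilon> \<epsilon>'" \<epsilon>' x] by auto
    then show "\<exists>N. \<exists>\<epsilon>>0. J1_nbhd N \<epsilon> x \<subseteq> S \<inter> T"
      using 1 2 by (intro exI[of _ "max N N'"] exI[of _ "min \<epsilon> \<epsilon>'"]) auto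
  next
    fix K x
    assume K: "\<forall>S\<in>K. S \<subseteq> cadlag_space \<and> (\<forall>x\<in>S. \<exists>N. \<exists>\<epsilon>>0. J1_nbhd N \<epsilon> x \<subseteq> S)"
      and x: "x \<in> \<Union>K"
    then obtain S where S: "S \<in> K" "x \<in> S" by blast
    then obtain N \<epsilon> where "\<epsilon> > 0" "J1_nbhd N \<epsilon> x \<subseteq> S" using K by blast
    with S show "\<exists>N. \<exists>\<epsilon>>0. J1_nbhd N \<epsilon> x \<subseteq> \<Union>K" by blast
  qed blast+
  then show ?thesis unfolding J1_topology_def by (simp add: topology_inverse')
qed

lemma topspace_J1 [simp]: "topspace J1_topology = cadlag_space"
proof (rule antisym)
  show "topspace J1_topology \<subseteq> cadlag_space" using openin_J1 openin_topspace by blast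
  have "openin J1_topology cadlag_space"
    unfolding openin_J1 by (auto simp: J1_nbhd_def intro: exI[of _ 1])
  then show "cadlag_space \<subseteq> topspace J1_topology" by (rule openin_subset)
qed

lemma id_time_change: "id \<in> time_changes"
  by (auto simp: time_changes_def strict_mono_on_def)

lemma time_changes_comp:
  assumes "\<theta> \<in> time_changes" "\<mu> \<in> time_changes"
  shows "\<mu> \<circ> \<theta> \<in> time_changes"
proof -
  have im: "\<theta> ` {0..} = {0..}" "\<mu> ` {0..} = {0..}"
    and sm: "strict_mono_on {0..} \<theta>" "strict_mono_on {0..} \<mu>"
    using assms by (auto simp only: time_changes_def mem_Collect_eq)
  have "(\<mu> \<circ> \<theta>) ` {0..} = {0..}" by (simp only: image_comp [symmetric] im)
  moreover have "(\<mu> \<circ> \<theta>) r < (\<mu> \<circ> \<theta>) s" if "r \<in> {0..}" "s \<in> {0..}" "r < s" for r s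
  proof -
    have "\<theta> r \<in> {0..}" "\<theta> s \<in> {0..}" using im(1) that by blast+
    then show ?thesis
      using strict_mono_onD[OF sm(1) that] strict_mono_onD[OF sm(2)] by (simp only: comp_apply)
  qed
  ultimately show ?thesis unfolding time_changes_def strict_mono_on_def by blast
qed

lemma J1_nbhd_refl: "x \<in> cadlag_space \<Longrightarrow> \<epsilon> > 0 \<Longrightarrow> x \<in> J1_nbhd N \<epsilon> x"
  unfolding J1_nbhd_def by (simp, rule bexI[OF _ id_time_change]) simp

lemma J1_nbhd_trans:
  assumes "y \<in> J1_nbhd N \<epsilon> x" "z \<in> J1_nbhd (N + \<epsilon>) \<epsilon> y"
  shows "z \<in> J1_nbhd N (2 * \<epsilon>) x"
proof -
  obtain \<theta> where l: "\<theta> \<in> time_changes"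
    and 1: "\<And>s. s \<in> {0..N} \<Longrightarrow> \<bar>\<theta> s - s\<bar> < \<epsilon> \<and> \<bar>y (\<theta> s) - x s\<bar> < \<epsilon>"
    using assms(1) unfolding J1_nbhd_def by blast
  obtain \<mu> where m: "\<mu> \<in> time_changes"
    and 2: "\<And>s. s \<in> {0..N + \<epsilon>} \<Longrightarrow> \<bar>\<mu> s - s\<bar> < \<epsilon> \<and> \<bar>z (\<mu> s) - y s\<bar> < \<epsilon>"
    using assms(2) unfolding J1_nbhd_def by blast
  have "\<bar>\<mu> (\<theta> s) - s\<bar> < 2 * \<epsilon> \<and> \<bar>z (\<mu> (\<theta> s)) - x s\<bar> < 2 * \<epsilon>" if s: "s \<in> {0..N}" for s
  proof -
    have "\<theta> ` {0..} = {0..}" using l by (simp add: time_changes_def)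
    moreover have "\<theta> s \<in> \<theta> ` {0..}" using s by (intro imageI) simp
    ultimately have "\<theta> s \<in> {0..}" by simp
    then have "\<theta> s \<in> {0..N + \<epsilon>}" using 1[OF s] s by auto
    then show ?thesis using 1[OF s] 2[of "\<theta> s"] by linarith
  qed
  moreover have "z \<in> cadlag_space" using assms(2) by (simp add: J1_nbhd_def)
  ultimately show ?thesis
    using time_changes_comp[OF l m] unfolding J1_nbhd_def
    by (simp, intro bexI[of _ "\<mu> \<circ> \<theta>"]) simp_all
qed

lemma J1_nbhd_contains_open:
  assumes x: "x \<in> cadlag_space" and e: "\<epsilon> > 0"
  shows "\<exists>U. openin J1_topology U \<and> x \<in> U \<and> U \<subseteq> J1_nbhd N \<epsilon> x"
proof (intro exI conjI)
  let ?U = "{y \<in> cadlag_space. \<exists>M. \<exists>\<delta>>0. J1_nbhd M \<delta> y \<subseteq> J1_nbhd N \<epsilon> x}"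
  show "openin J1_topology ?U"
    unfolding openin_J1
  proof (intro conjI ballI)
    fix y assume "y \<in> ?U"
    then obtain M \<delta> where d: "\<delta> > 0" "J1_nbhd M \<delta> y \<subseteq> J1_nbhd N \<epsilon> x" by blast
    have "J1_nbhd M (\<delta>/2) y \<subseteq> ?U"
    proof
      fix z assume z: "z \<in> J1_nbhd M (\<delta>/2) y"
      have "J1_nbhd (M + \<delta>/2) (\<delta>/2) z \<subseteq> J1_nbhd N \<epsilon> x"
        using J1_nbhd_trans[OF z] d by auto
      moreover have "z \<in> cadlag_space" using z by (simp add: J1_nbhd_def)
      ultimately show "z \<in> ?U" using d(1) half_gt_zero by blast
    qed
    then show "\<exists>N. \<exists>\<epsilon>>0. J1_nbhd N \<epsilon> y \<subseteq> ?U" using d(1) half_gt_zero by blast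
  qed blast
  show "x \<in> ?U" using x e by blast
  show "?U \<subseteq> J1_nbhd N \<epsilon> x" using J1_nbhd_refl by blast
qed

lemma limitin_J1_iff_nbhd:
  "limitin J1_topology X x F \<longleftrightarrow>
     x \<in> cadlag_space \<and> (\<forall>N. \<forall>\<epsilon>>0. \<forall>\<^sub>F n in F. X n \<in> J1_nbhd N \<epsilon> x)"
proof
  assume L: "limitin J1_topology X x F"
  then have x: "x \<in> cadlag_space" by (simp add: limitin_def)
  moreover have "\<forall>\<^sub>F n in F. X n \<in> J1_nbhd N \<epsilon> x" if e: "\<epsilon> > 0" for N \<epsilon>
  proof -
    obtain U where U: "openin J1_topology U" "x \<in> U" "U \<subseteq> J1_nbhd N \<epsilon> x"
      using J1_nbhd_contains_open[OF x e] by blast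
    then have "\<forall>\<^sub>F n in F. X n \<in> U" using L by (simp add: limitin_def)
    then show ?thesis by (rule eventually_mono) (use U in blast)
  qed
  ultimately show "x \<in> cadlag_space \<and> (\<forall>N. \<forall>\<epsilon>>0. \<forall>\<^sub>F n in F. X n \<in> J1_nbhd N \<epsilon> x)" by blast
next
  assume R: "x \<in> cadlag_space \<and> (\<forall>N. \<forall>\<epsilon>>0. \<forall>\<^sub>F n in F. X n \<in> J1_nbhd N \<epsilon> x)"
  have "\<forall>\<^sub>F n in F. X n \<in> U" if "openin J1_topology U" "x \<in> U" for U
  proof -
    obtain N \<epsilon> where "\<epsilon> > 0" and sub: "J1_nbhd N \<epsilon> x \<subseteq> U"
      using \<open>openin J1_topology U\<close> \<open>x \<in> U\<close> unfolding openin_J1 by blast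
    then have "\<forall>\<^sub>F n in F. X n \<in> J1_nbhd N \<epsilon> x" using R by blast
    then show ?thesis by (rule eventually_mono) (use sub in blast)
  qed
  then show "limitin J1_topology X x F" using R by (simp add: limitin_def)
qed

lemma limitin_J1_iff:
  "limitin J1_topology X x sequentially \<longleftrightarrow>
     x \<in> cadlag_space \<and> (\<forall>\<^sub>F n in sequentially. X n \<in> cadlag_space) \<and>
     (\<exists>\<theta>. (\<forall>n. \<theta> n \<in> time_changes) \<and>
        (\<forall>N. uniform_limit {0..N} \<theta> (\<lambda>s. s) sequentially \<and>
             uniform_limit {0..N} (\<lambda>n s. X n (\<theta> n s)) x sequentially))"
  (is "?L \<longleftrightarrow> ?R")
proof
  assume R: ?R
  then obtain \<theta> where l: "\<And>n. \<theta> n \<in> time_changes"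
    and u: "\<And>N. uniform_limit {0..N} \<theta> (\<lambda>s. s) sequentially"
           "\<And>N. uniform_limit {0..N} (\<lambda>n s. X n (\<theta> n s)) x sequentially" by blast
  have "\<forall>\<^sub>F n in sequentially. X n \<in> J1_nbhd N \<epsilon> x" if "\<epsilon> > 0" for N \<epsilon>
  proof -
    have "\<forall>\<^sub>F n in sequentially. X n \<in> cadlag_space" using R by blast
    moreover have "\<forall>\<^sub>F n in sequentially. \<forall>s\<in>{0..N}. dist (\<theta> n s) s < \<epsilon>"
      using u(1)[of N] \<open>\<epsilon> > 0\<close> by (simp add: uniform_limit_iff)
    moreover have "\<forall>\<^sub>F n in sequentially. \<forall>s\<in>{0..N}. dist (X n (\<theta> n s)) (x s) < \<epsilon>"
      using u(2)[of N] \<open>\<epsilon> > 0\<close> by (simp add: uniform_limit_iff)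
    ultimately show ?thesis
      
    proof eventually_elim
      case (elim n)
      then show ?case using l[of n] unfolding J1_nbhd_def dist_real_def by blast
    qed
  qed
  then show ?L using R limitin_J1_iff_nbhd by blast
next
  assume L: ?L
  let ?B = "\<lambda>k::nat. J1_nbhd (real k) (1 / real (Suc k)) x"
  have x: "x \<in> cadlag_space"
    and ev: "\<And>N \<epsilon>. \<epsilon> > 0 \<Longrightarrow> \<forall>\<^sub>F n in sequentially. X n \<in> J1_nbhd N \<epsilon> x"
    using L limitin_J1_iff_nbhd by blast+
  have evD: "\<forall>\<^sub>F n in sequentially. X n \<in> cadlag_space"
    using ev[of 1 0] by (rule eventually_mono) (auto simp: J1_nbhd_def)
  have mono: "?B k \<subseteq> ?B j" if "j \<le> k" for j k
    using that by (intro J1_nbhd_mono) (auto simp: field_simps)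
  define good where "good n k \<theta> \<longleftrightarrow> \<theta> \<in> time_changes \<and> (\<forall>s\<in>{0..real k}.
    \<bar>\<theta> s - s\<bar> < 1 / real (Suc k) \<and> \<bar>X n (\<theta> s) - x s\<bar> < 1 / real (Suc k))" for n k \<theta>
  define K where "K n = {k. k \<le> n \<and> X n \<in> ?B k}" for n
  have "\<exists>\<theta>\<in>time_changes. K n \<noteq> {} \<longrightarrow> good n (Max (K n)) \<theta>" for n
  proof (cases "K n = {}")
    case True then show ?thesis using id_time_change by blast
  next
    case False
    have "finite (K n)" unfolding K_def by simp
    then have "Max (K n) \<in> K n" using False by (rule Max_in)
    then have "X n \<in> ?B (Max (K n))" unfolding K_def by blast
    then show ?thesis unfolding J1_nbhd_def good_def by blast
  qed
  then obtain \<theta> where l: "\<And>n. \<theta> n \<in> time_changes"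
    and g: "\<And>n. K n \<noteq> {} \<Longrightarrow> good n (Max (K n)) (\<theta> n)" by metis
  have main: "\<forall>\<^sub>F n in sequentially. \<forall>s\<in>{0..N}. \<bar>\<theta> n s - s\<bar> < \<epsilon> \<and> \<bar>X n (\<theta> n s) - x s\<bar> < \<epsilon>"
    if e: "\<epsilon> > 0" for N \<epsilon>
  proof -
    obtain k1 where k1: "1 / real (Suc k1) < \<epsilon>" using e by (meson nat_approx_posE)
    obtain k2 where k2: "N \<le> real k2" using real_arch_simple by blast
    define k where "k = max k1 k2"
    have "\<forall>\<^sub>F n in sequentially. X n \<in> ?B k" by (rule ev) simp
    then show ?thesis
      using eventually_ge_at_top[of k]
    proof eventually_elim
      case (elim n)
      then have "k \<in> K n" unfolding K_def by simp
      moreover have "finite (K n)" unfolding K_def by simp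
      ultimately have m: "k \<le> Max (K n)" and "K n \<noteq> {}" by auto
      then have G: "good n (Max (K n)) (\<theta> n)" using g by blast
      have "1 / real (Suc (Max (K n))) \<le> 1 / real (Suc k1)"
        using m unfolding k_def by (simp add: field_simps)
      moreover have "N \<le> real (Max (K n))" using m k2 unfolding k_def by linarith
      ultimately show ?case using G k1 unfolding good_def
        by (meson atLeastAtMost_iff order.trans order.strict_trans1 order.strict_trans)
    qed
  qed
  have "uniform_limit {0..N} \<theta> (\<lambda>s. s) sequentially" for N
    unfolding uniform_limit_iff dist_real_def
    using main by (blast intro: eventually_mono)
  moreover have "uniform_limit {0..N} (\<lambda>n s. X n (\<theta> n s)) x sequentially" for N
    unfolding uniform_limit_iff dist_real_def
    using main by (blast intro: eventually_mono)
  ultimately show ?R using x evD l by blast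
qed

definition borel_of :: "'a topology \<Rightarrow> 'a measure" where
  "borel_of T = sigma (topspace T) {U. openin T U}"

text \<open>
  Convergence in distribution of \<open>T\<close>-valued random elements \<open>X\<^sub>i\<close>, defined on the probability space
  \<open>M\<close>, to \<open>Z\<close>, defined on \<open>N\<close>. The \<open>X\<^sub>i\<close> need be random elements only up to almost sure
  equality: a path may leave the space on a null event (for instance where the partial sums of a
  renewal process stay bounded), and a version \<open>X'\<^sub>i\<close> is used there.
\<close>

definition converges_in_distribution ::
  "'b topology \<Rightarrow> 'a measure \<Rightarrow> ('i \<Rightarrow> 'a \<Rightarrow> 'b) \<Rightarrow> 'c measure \<Rightarrow> ('c \<Rightarrow> 'b) \<Rightarrow> 'i filter \<Rightarrow> bool"
where
  "converges_in_distribution T M X N Z F \<longleftrightarrow>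
     Z \<in> measurable N (borel_of T) \<and>
     (\<exists>X'. (\<forall>\<^sub>F i in F. X' i \<in> measurable M (borel_of T) \<and> (AE \<omega> in M. X i \<omega> = X' i \<omega>)) \<and>
        (\<forall>H. continuous_map T euclideanreal H \<and> bounded (H ` topspace T) \<longrightarrow>
           ((\<lambda>i. \<integral>\<omega>. H (X' i \<omega>) \<partial>M) \<longlongrightarrow> (\<integral>\<omega>. H (Z \<omega>) \<partial>N)) F))"

definition slowly_varying :: "(real \<Rightarrow> real) \<Rightarrow> bool" where
  "slowly_varying l \<longleftrightarrow> l \<in> borel_measurable borel \<and> (\<forall>\<^sub>F x in at_top. l x > 0) \<and>
     (\<forall>c>0. ((\<lambda>x. l (c * x) / l x) \<longlongrightarrow> 1) at_top)"

definition regularly_varying_rv :: "'a measure \<Rightarrow> ('a \<Rightarrow> real) \<Rightarrow> real \<Rightarrow> bool" where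
  "regularly_varying_rv M Z \<alpha> \<longleftrightarrow> (\<exists>l. slowly_varying l \<and>
     (\<forall>x>0. measure M {\<omega> \<in> space M. Z \<omega> > x} = x powr (-\<alpha>) * l x))"

text \<open>Sequences are indexed from 1; the value at index 0 is irrelevant.\<close>

definition iid :: "'a measure \<Rightarrow> (nat \<Rightarrow> 'a \<Rightarrow> real) \<Rightarrow> bool" where
  "iid M X \<longleftrightarrow> prob_space.indep_vars M (\<lambda>_. borel) X {1..} \<and>
     (\<forall>i\<ge>1. distr M borel (X i) = distr M borel (X 1))"

definition independent_sequences ::
  "'a measure \<Rightarrow> (nat \<Rightarrow> 'a \<Rightarrow> real) \<Rightarrow> (nat \<Rightarrow> 'a \<Rightarrow> real) \<Rightarrow> bool" where
  "independent_sequences M X Y \<longleftrightarrow> prob_space.indep_var M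
     (\<Pi>\<^sub>M i\<in>{1..}. borel) (\<lambda>\<omega>. \<lambda>i\<in>{1..}. X i \<omega>) (\<Pi>\<^sub>M i\<in>{1..}. borel) (\<lambda>\<omega>. \<lambda>i\<in>{1..}. Y i \<omega>)"

definition partial_sum :: "(nat \<Rightarrow> 'a \<Rightarrow> real) \<Rightarrow> nat \<Rightarrow> 'a \<Rightarrow> real" where
  "partial_sum X n \<omega> = (\<Sum>i=1..n. X i \<omega>)"

text \<open>
  On the natural numbers \<^prop>\<open>Sup ({} :: nat set) = 0\<close>. If the set is infinite, \<^const>\<open>Sup\<close> is a junk
  value; for i.i.d. nonnegative \<open>W\<close> with positive mean this happens only on a null event.
\<close>

definition renewal_count :: "(nat \<Rightarrow> 'a \<Rightarrow> real) \<Rightarrow> real \<Rightarrow> 'a \<Rightarrow> nat" where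
  "renewal_count W t \<omega> = Sup {k. 1 \<le> k \<and> partial_sum W k \<omega> \<le> t}"

definition sample_path :: "(real \<Rightarrow> 'a \<Rightarrow> real) \<Rightarrow> 'a \<Rightarrow> real \<Rightarrow> real" where
  "sample_path X \<omega> = (\<lambda>s\<in>{0..}. X s \<omega>)"

definition levy_process :: "'a measure \<Rightarrow> (real \<Rightarrow> 'a \<Rightarrow> real) \<Rightarrow> bool" where
  "levy_process N G \<longleftrightarrow> prob_space N \<and>
     (\<forall>t\<ge>0. G t \<in> borel_measurable N) \<and>
     (\<forall>\<omega>\<in>space N. sample_path G \<omega> \<in> cadlag_space) \<and>
     (AE \<omega> in N. G 0 \<omega> = 0) \<and>
     (\<forall>n. \<forall>t :: nat \<Rightarrow> real. 0 \<le> t 0 \<and> mono t \<longrightarrow>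
        prob_space.indep_vars N (\<lambda>_. borel) (\<lambda>i \<omega>. G (t (Suc i)) \<omega> - G (t i) \<omega>) {..<n}) \<and>
     (\<forall>s\<ge>0. \<forall>t\<ge>0. distr N borel (\<lambda>\<omega>. G (s + t) \<omega> - G s \<omega>) = distr N borel (G t))"

text \<open>
  The scaling condition says that the law of \<open>G\<^sub>1\<close> is strictly \<open>\<alpha>\<close>-stable: the law of \<open>G\<^sub>k\<close> is the
  \<open>k\<close>-th convolution power of the law of \<open>G\<^sub>1\<close>. It excludes a drift when \<open>\<alpha> < 1\<close>, as is usual
  for stable subordinators.
\<close>

definition stable_levy_process :: "'a measure \<Rightarrow> real \<Rightarrow> (real \<Rightarrow> 'a \<Rightarrow> real) \<Rightarrow> bool" where
  "stable_levy_process N \<alpha> G \<longleftrightarrow> levy_process N G \<and>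
     (\<forall>k>0. distr N borel (G k) = distr N borel (\<lambda>\<omega>. k powr (1 / \<alpha>) * G 1 \<omega>))"

definition stable_subordinator :: "'a measure \<Rightarrow> real \<Rightarrow> (real \<Rightarrow> 'a \<Rightarrow> real) \<Rightarrow> bool" where
  "stable_subordinator N \<alpha> G \<longleftrightarrow> stable_levy_process N \<alpha> G \<and>
     (AE \<omega> in N. mono_on {0..} (\<lambda>s. G s \<omega>)) \<and>
     \<not> (\<exists>c. AE \<omega> in N. G 1 \<omega> = c)"

end

theory Submission
  imports Defs
begin

text \<open>
  The theorem is proved by a coupling: for each \<open>t\<close> a copy of the rewards \<open>Y\<close> is built from the
  increments of the limit process itself, so that convergence in distribution turns into
  convergence in probability on one space.

  Let \<open>G\<close> be the stable subordinator normalised by \<open>P(G\<^sub>1 > x) \<sim> x\<^sup>-\<^sup>\<alpha>\<close>. Its increments over the grid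
  of mesh \<open>1/n\<close> are independent, and multiplied by \<open>n\<^sup>1\<^sup>/\<^sup>\<alpha>\<close> they have the law of \<open>G\<^sub>1\<close>. That law has no
  atoms, so there is a nondecreasing function \<open>match\<close> that carries it to the law of \<open>Y\<^sub>1\<close>; applied to
  the rescaled increments, \<open>match\<close> yields an exact copy of the sequence \<open>Y\<close>. The two laws have
  regularly varying tails of the same index, hence \<open>match (n\<^sup>1\<^sup>/\<^sup>\<alpha> x) / a\<^sub>n \<rightarrow> x\<close> for every \<open>x > 0\<close>: a
  reward divided by \<open>a\<^sub>n\<close> is nearly the increment that produced it. Since \<open>\<alpha> < 1\<close>, the rewards and
  increments below a small level \<open>\<epsilon>\<close> contribute only \<open>O(\<epsilon>\<^sup>1\<^sup>-\<^sup>\<alpha>)\<close> in mean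
  (\<open>truncated_mean_bound\<close>). Together these facts show that the sum of all errors over the first
  \<open>n N\<close> indices tends to \<open>0\<close> in probability (\<open>coupling_error\<close>, \<open>jump_error_expectation\<close>).

  The waiting times \<open>W\<close> live on an independent factor. By the law of large numbers the clock
  \<open>\<sigma>(ts) / (\<nu>t)\<close> tends to \<open>s\<close>, locally uniformly by monotonicity (\<open>renewal_count_uniform\<close>). The coupled
  process is therefore uniformly close to \<open>G \<circ> \<tau>\<close> for a step function \<open>\<tau>\<close> near the identity, and every
  such path is close to \<open>G\<close> in the \<open>J\<^sub>1\<close> topology (\<open>J1_nbhd_of_time_deformation\<close>). Almost sure
  convergence along subsequences and dominated convergence give the limit of the expectations of
  bounded continuous functionals.

  It remains to construct \<open>G\<close>. Normalised sums of Pareto variables are tight, and their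
  characteristic functions converge to \<open>exp \<psi>\<close> with \<open>\<psi>(c\<^sup>1\<^sup>/\<^sup>\<alpha> \<theta>) = c \<psi>(\<theta>)\<close>; a limit law is thus stable.
  Its tail follows from the fact that a large sum is caused by a single large summand. Laws of the
  increments over dyadic grids are consistent by stability; Kolmogorov's extension theorem yields a
  process on the dyadic numbers, nondecreasing almost surely, whose right limits form \<open>G\<close>.
\<close>

section \<open>Skorohod neighbourhoods of deformed paths\<close>

lemma piecewise_time_change:
  fixes c d e :: real
  assumes "0 \<le> c" "0 < d" "0 < e"
  defines "\<kappa> \<equiv> \<lambda>p. if p \<le> c then p else if p \<le> c + d then c + (p - c) * (e / d) else p - d + e"
  shows "\<kappa> \<in> time_changes"
proof -
  have mono: "\<kappa> p < \<kappa> q" if "p < q" for p q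
  proof -
    have 1: "(p - c) * (e / d) < (q - c) * (e / d)" using that assms by (intro mult_strict_right_mono) auto
    have 2: "(q - c) * (e / d) > 0" if "q > c" using that assms by simp
    have 3: "(p - c) * (e / d) \<le> e" if "p \<le> c + d"
    proof -
      have "(p - c) * (e / d) \<le> d * (e / d)" using that assms by (intro mult_right_mono) auto
      then show ?thesis using assms by simp
    qed
    have \<kappa>: "\<kappa> p = (if p \<le> c then p else if p \<le> c + d then c + (p - c) * (e / d) else p - d + e)" for p
      by (simp add: \<kappa>_def)
    show ?thesis using that 1 2 3 assms(1-3) unfolding \<kappa> by (smt (verit))
  qed
  have \<kappa>: "\<kappa> p = (if p \<le> c then p else if p \<le> c + d then c + (p - c) * (e / d) else p - d + e)" for p
    by (simp add: \<kappa>_def)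
  have nonneg: "\<kappa> p \<ge> 0" if "p \<ge> 0" for p
    using mono[of 0 p] that assms(1-3) by (cases "p = 0") (auto simp: \<kappa>)
  have "\<exists>p\<ge>0. q = \<kappa> p" if q: "q \<ge> 0" for q
  proof -
    consider "q \<le> c" | "c < q" "q \<le> c + e" | "q > c + e" by linarith
    then show ?thesis
    proof cases
      case 1 then show ?thesis using q by (intro exI[of _ q]) (simp add: \<kappa>)
    next
      case 2
      define p where "p = (q - c) * (d / e)"
      have "p \<le> e * (d / e)" unfolding p_def using 2 assms(2,3) by (intro mult_right_mono) auto
      then have "p \<le> d" using assms(3) by simp
      moreover have "p > 0" unfolding p_def using 2 assms(2,3) by (intro mult_pos_pos) auto
      moreover have "p * (e / d) = q - c" unfolding p_def using assms(2,3) by simp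
      ultimately show ?thesis using assms(1) by (intro exI[of _ "c + p"]) (simp add: \<kappa>)
    next
      case 3 then show ?thesis using assms(1-3) by (intro exI[of _ "q + d - e"]) (simp add: \<kappa>)
    qed
  qed
  then show ?thesis using mono nonneg unfolding time_changes_def strict_mono_on_def by (auto simp: image_iff)
qed

text \<open>
  Between consecutive points the time change is affine, so \<open>\<theta> s - s\<close> interpolates the differences
  \<open>v i - u i\<close>. The induction composes with a map that bends only behind the last point reached; the
  clause about a unit slope behind \<open>u r\<close> is what makes the next bend explicit.
\<close>

lemma time_change_through_points:
  fixes u v :: "nat \<Rightarrow> real"
  assumes "u 0 = 0" "v 0 = 0"
    and "\<And>i. i < r \<Longrightarrow> u i < u (Suc i)" "\<And>i. i < r \<Longrightarrow> v i < v (Suc i)"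
    and "\<And>i. i \<le> r \<Longrightarrow> \<bar>v i - u i\<bar> \<le> \<eta>"
  shows "\<exists>\<theta>\<in>time_changes. (\<forall>i\<le>r. \<theta> (u i) = v i) \<and> (\<forall>s\<ge>0. \<bar>\<theta> s - s\<bar> \<le> \<eta>) \<and>
    (\<forall>s\<ge>u r. \<theta> s = s - u r + v r)"
  using assms(3-)
proof (induction r)
  case 0
  then show ?case using assms(1,2) id_time_change by (intro bexI[of _ id]) auto
next
  case (Suc r)
  obtain \<theta> where \<theta>: "\<theta> \<in> time_changes" "\<And>i. i \<le> r \<Longrightarrow> \<theta> (u i) = v i"
      "\<And>s. s \<ge> 0 \<Longrightarrow> \<bar>\<theta> s - s\<bar> \<le> \<eta>" "\<And>s. s \<ge> u r \<Longrightarrow> \<theta> s = s - u r + v r"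
    using Suc.IH Suc.prems by (metis le_SucI less_SucI)
  have mono: "strict_mono_on {0..} \<theta>" using \<theta>(1) by (simp add: time_changes_def)
  have u_mono: "u i \<le> u j \<and> v i \<le> v j" if "i \<le> j" "j \<le> r" for i j
    using that(1,2)
  proof (induction j rule: dec_induct)
    case (step j)
    then show ?case using Suc.prems(1)[of j] Suc.prems(2)[of j] by simp
  qed simp
  have ur: "u r \<ge> 0" "v r \<ge> 0" using u_mono[of 0 r] assms by auto
  define d where "d = u (Suc r) - u r"
  define e where "e = v (Suc r) - v r"
  have de: "d > 0" "e > 0" using Suc.prems unfolding d_def e_def by auto
  define \<kappa> where "\<kappa> = (\<lambda>p. if p \<le> v r then p
    else if p \<le> v r + d then v r + (p - v r) * (e / d) else p - d + e)"
  have \<kappa>: "\<kappa> \<in> time_changes" using piecewise_time_change[OF ur(2) de] unfolding \<kappa>_def .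
  have le: "\<theta> s \<le> v r" if "0 \<le> s" "s \<le> u r" for s
    using strict_mono_onD[OF mono, of s "u r"] that \<theta>(2)[of r] by (cases "s = u r") auto
  have 1: "(\<kappa> \<circ> \<theta>) (u i) = v i" if "i \<le> Suc r" for i
  proof (cases "i = Suc r")
    case True
    have "\<theta> (u (Suc r)) = d + v r" using \<theta>(4)[of "u (Suc r)"] de by (simp add: d_def)
    then show ?thesis using True de by (simp add: \<kappa>_def e_def)
  next
    case False
    then have i: "i \<le> r" using that by simp
    have "v i \<le> v r" using u_mono[of i r] i by simp
    then show ?thesis using \<theta>(2)[OF i] by (simp add: \<kappa>_def)
  qed
  have 2: "\<bar>(\<kappa> \<circ> \<theta>) s - s\<bar> \<le> \<eta>" if s: "s \<ge> 0" for s
  proof -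
    consider "s \<le> u r" | "u r < s" "s \<le> u (Suc r)" | "s > u (Suc r)" by linarith
    then show ?thesis
    proof cases
      case 1
      then show ?thesis using le[OF s 1] \<theta>(3)[OF s] by (simp add: \<kappa>_def)
    next
      case 2
      define l where "l = (s - u r) / d"
      have l: "0 \<le> l" "l \<le> 1" "s = u r + l * d" using 2 de by (auto simp: l_def d_def)
      have th: "\<theta> s = v r + l * d" using \<theta>(4)[of s] 2 l by simp
      have ld: "l * d \<le> d" using l de by (simp add: mult_le_cancel_right1)
      have pos: "l * d > 0" using 2 l by linarith
      have "(\<kappa> \<circ> \<theta>) s = \<kappa> (v r + l * d)" using th by simp
      also have eq: "\<dots> = v r + l * e" using ld pos de by (simp add: \<kappa>_def)
      finally have eq: "(\<kappa> \<circ> \<theta>) s = v r + l * e" .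
      have "(\<kappa> \<circ> \<theta>) s - s = (1 - l) * (v r - u r) + l * (v (Suc r) - u (Suc r))"
      proof -
        have "v r + l * e - (u r + l * d) = (1 - l) * (v r - u r) + l * (v (Suc r) - u (Suc r))"
          unfolding d_def e_def by (simp add: algebra_simps)
        then show ?thesis using eq l(3) by linarith
      qed
      also have "\<bar>\<dots>\<bar> \<le> (1 - l) * \<bar>v r - u r\<bar> + l * \<bar>v (Suc r) - u (Suc r)\<bar>"
        using l by (intro order.trans[OF abs_triangle_ineq]) (simp add: abs_mult)
      also have "\<dots> \<le> (1 - l) * \<eta> + l * \<eta>"
        using l Suc.prems(3)[of r] Suc.prems(3)[of "Suc r"]
        by (intro add_mono mult_left_mono) auto
      finally show ?thesis by (simp add: algebra_simps)
    next
      case 3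
      then have "\<theta> s = s - u r + v r" using \<theta>(4)[of s] de d_def by simp
      then show ?thesis using 3 de Suc.prems(3)[of "Suc r"] by (auto simp: \<kappa>_def d_def e_def)
    qed
  qed
  have 3: "(\<kappa> \<circ> \<theta>) s = s - u (Suc r) + v (Suc r)" if s: "s \<ge> u (Suc r)" for s
  proof (cases "s = u (Suc r)")
    case True then show ?thesis using 1[of "Suc r"] by simp
  next
    case False
    then have "\<theta> s = s - u r + v r" using \<theta>(4)[of s] s de d_def by simp
    then show ?thesis using s False de by (simp add: \<kappa>_def d_def e_def)
  qed
  show ?case using time_changes_comp[OF \<theta>(1) \<kappa>] 1 2 3 by blast
qed

text \<open>
  The intervals are closed on the left and open on the right, because a cadlag path may jump at
  each division point.
\<close>

definition oscillation_partition :: "(real \<Rightarrow> real) \<Rightarrow> real \<Rightarrow> real \<Rightarrow> real \<Rightarrow> bool" where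
  "oscillation_partition x \<epsilon> a b \<longleftrightarrow> (\<exists>r (u :: nat \<Rightarrow> real). u 0 = a \<and> u r = b \<and>
     (\<forall>i<r. u i < u (Suc i) \<and> (\<forall>s\<in>{u i..<u (Suc i)}. \<forall>s'\<in>{u i..<u (Suc i)}. \<bar>x s - x s'\<bar> < \<epsilon>)))"

lemma oscillation_partition_single:
  assumes "a \<le> b" "\<And>s s'. s \<in> {a..<b} \<Longrightarrow> s' \<in> {a..<b} \<Longrightarrow> \<bar>x s - x s'\<bar> < \<epsilon>"
  shows "oscillation_partition x \<epsilon> a b"
proof (cases "a = b")
  case True
  then show ?thesis unfolding oscillation_partition_def by (intro exI[of _ 0] exI[of _ "\<lambda>_. a"]) auto
next
  case False
  then show ?thesis using assms unfolding oscillation_partition_def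
    by (intro exI[of _ 1] exI[of _ "\<lambda>i. if i = 0 then a else b"]) auto
qed

lemma oscillation_partition_trans:
  assumes "oscillation_partition x \<epsilon> a b" "oscillation_partition x \<epsilon> b c"
  shows "oscillation_partition x \<epsilon> a c"
proof -
  obtain r u where u: "u 0 = a" "u r = b" "\<And>i. i < r \<Longrightarrow> u i < u (Suc i) \<and>
    (\<forall>s\<in>{u i..<u (Suc i)}. \<forall>s'\<in>{u i..<u (Suc i)}. \<bar>x s - x s'\<bar> < \<epsilon>)"
    using assms(1) unfolding oscillation_partition_def by blast
  obtain q w where w: "w 0 = b" "w q = c" "\<And>i. i < q \<Longrightarrow> w i < w (Suc i) \<and>
    (\<forall>s\<in>{w i..<w (Suc i)}. \<forall>s'\<in>{w i..<w (Suc i)}. \<bar>x s - x s'\<bar> < \<epsilon>)"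
    using assms(2) unfolding oscillation_partition_def by blast
  define z where "z i = (if i \<le> r then u i else w (i - r))" for i
  have "z i < z (Suc i) \<and> (\<forall>s\<in>{z i..<z (Suc i)}. \<forall>s'\<in>{z i..<z (Suc i)}. \<bar>x s - x s'\<bar> < \<epsilon>)"
    if i: "i < r + q" for i
  proof (cases "i < r")
    case True then show ?thesis using u(3)[of i] by (simp add: z_def)
  next
    case False
    have "z i = w (i - r)" using False u(2) w(1) by (auto simp: z_def)
    moreover have "z (Suc i) = w (Suc (i - r))" using False by (simp add: z_def Suc_diff_le)
    ultimately show ?thesis using w(3)[of "i - r"] False i by simp
  qed
  moreover have "z 0 = a" "z (r + q) = c" using u w by (auto simp: z_def)
  ultimately show ?thesis unfolding oscillation_partition_def by blast
qed

text \<open>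
  Around each point the right limit and the left limit give one interval on either side on which the
  path oscillates little; Bolzano's bisection principle joins them to a partition of \<open>[0,T]\<close>.
\<close>

lemma cadlag_oscillation_partition:
  assumes x: "x \<in> cadlag_space" and "\<epsilon> > 0" "T \<ge> 0"
  shows "oscillation_partition x \<epsilon> 0 T"
proof -
  define P where "P a b = (0 \<le> a \<longrightarrow> a \<le> b \<longrightarrow> oscillation_partition x \<epsilon> a b)" for a b
  have "P 0 T"
  proof (rule Bolzano[of 0 T P])
    show "0 \<le> T" by fact
    show "P a c" if "P a b" "P b c" "a \<le> b" "b \<le> c" for a b c
      using that oscillation_partition_trans unfolding P_def by auto
    fix t assume t: "0 \<le> t" "t \<le> T"
    have "continuous (at_right t) x" using x t by (simp add: cadlag_space_def)
    then have "\<forall>\<^sub>F s in at_right t. dist (x s) (x t) < \<epsilon>/2"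
      using \<open>\<epsilon> > 0\<close> unfolding continuous_within by (intro tendstoD) auto
    then obtain b where b: "b > t" "\<And>s. t < s \<Longrightarrow> s < b \<Longrightarrow> dist (x s) (x t) < \<epsilon>/2"
      using eventually_at_right[of t "t+1"] by auto
    have R: "\<bar>x s - x s'\<bar> < \<epsilon>" if "s \<in> {t..<b}" "s' \<in> {t..<b}" for s s'
    proof -
      have "dist (x s) (x t) < \<epsilon>/2" "dist (x s') (x t) < \<epsilon>/2"
        using b(2)[of s] b(2)[of s'] that \<open>\<epsilon> > 0\<close> by (cases "s = t"; cases "s' = t"; auto)+
      then show ?thesis unfolding dist_real_def by linarith
    qed
    obtain a where a: "a < t" "\<And>s s'. s \<in> {max a 0..<t} \<Longrightarrow> s' \<in> {max a 0..<t} \<Longrightarrow> \<bar>x s - x s'\<bar> < \<epsilon>"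
    proof (cases "t = 0")
      case True then show ?thesis by (intro that[of "-1"]) auto
    next
      case False
      then have "t > 0" using t by simp
      then have "\<exists>l. (x \<longlongrightarrow> l) (at_left t)" using x unfolding cadlag_space_def by blast
      then obtain l where "(x \<longlongrightarrow> l) (at_left t)" ..
      then have "\<forall>\<^sub>F s in at_left t. dist (x s) l < \<epsilon>/2" using \<open>\<epsilon> > 0\<close> by (intro tendstoD) auto
      then obtain a where a: "a < t" "\<And>s. a < s \<Longrightarrow> s < t \<Longrightarrow> dist (x s) l < \<epsilon>/2"
        using eventually_at_left[of "t-1" t] by auto
      show ?thesis
      proof (rule that[of "(a+t)/2"])
        fix s s' assume s: "s \<in> {max ((a+t)/2) 0..<t}" "s' \<in> {max ((a+t)/2) 0..<t}"
        then have "a < s" "a < s'" "s < t" "s' < t" using a(1) by (auto simp: field_simps)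
        then have "dist (x s) l < \<epsilon>/2" "dist (x s') l < \<epsilon>/2" using a(2) by auto
        then show "\<bar>x s - x s'\<bar> < \<epsilon>" unfolding dist_real_def by linarith
      qed (use a in auto)
    qed
    show "\<exists>d>0. \<forall>a b. a \<le> t \<and> t \<le> b \<and> b - a < d \<longrightarrow> P a b"
    proof (intro exI[of _ "min (b - t) (t - a)"] conjI allI impI)
      show "min (b - t) (t - a) > 0" using a b by simp
      fix p q assume pq: "p \<le> t \<and> t \<le> q \<and> q - p < min (b - t) (t - a)"
      show "P p q" unfolding P_def
      proof (intro impI)
        assume p: "0 \<le> p" "p \<le> q"
        have "oscillation_partition x \<epsilon> p t"
          by (rule oscillation_partition_single) (use pq p in \<open>auto intro!: a(2)\<close>)
        moreover have "oscillation_partition x \<epsilon> t q"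
          by (rule oscillation_partition_single) (use pq p R in auto)
        ultimately show "oscillation_partition x \<epsilon> p q" by (rule oscillation_partition_trans)
      qed
    qed
  qed
  then show ?thesis using assms by (simp add: P_def)
qed

text \<open>
  The deformation \<open>\<tau>\<close> may be a step function and skip values, so it is no time change itself. The
  assumption that each set \<open>{s. u \<le> \<tau> s}\<close> is a half-line \<open>[v,\<infinity>)\<close> makes \<open>v\<close> the time at which \<open>\<tau>\<close>
  passes \<open>u\<close>. A time change that sends the points \<open>u i\<close> of an oscillation partition of \<open>x\<close> to these
  times maps each partition interval to times where \<open>\<tau>\<close> lies in the same interval, and there \<open>x\<close>
  hardly varies.
\<close>

lemma J1_nbhd_of_time_deformation:
  assumes x: "x \<in> cadlag_space" and \<epsilon>: "\<epsilon> > 0"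
  shows "\<exists>\<delta>>0. \<exists>T. \<forall>\<tau> y. y \<in> cadlag_space \<longrightarrow>
    (\<forall>u\<in>{0..T}. \<exists>v\<ge>0. \<forall>s\<ge>0. u \<le> \<tau> s \<longleftrightarrow> v \<le> s) \<longrightarrow>
    (\<forall>s\<in>{0..T}. 0 \<le> \<tau> s \<and> \<bar>\<tau> s - s\<bar> < \<delta> \<and> \<bar>y s - x (\<tau> s)\<bar> < \<delta>) \<longrightarrow> y \<in> J1_nbhd N \<epsilon> x"
proof -
  define T where "T = \<bar>N\<bar> + 1"
  have T: "T > 0" "T > N" by (auto simp: T_def)
  obtain r u where u: "u 0 = 0" "u r = T" "\<And>i. i < r \<Longrightarrow> u i < u (Suc i)"
    and osc: "\<And>i s s'. i < r \<Longrightarrow> s \<in> {u i..<u (Suc i)} \<Longrightarrow> s' \<in> {u i..<u (Suc i)} \<Longrightarrow> \<bar>x s - x s'\<bar> < \<epsilon>/2"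
    using cadlag_oscillation_partition[OF x, of "\<epsilon>/2" T] \<epsilon> T unfolding oscillation_partition_def by auto
  define D where "D = Min (insert 1 ((\<lambda>i. u (Suc i) - u i) ` {..<r}))"
  have D: "D > 0" "D \<le> 1" "\<And>i. i < r \<Longrightarrow> D \<le> u (Suc i) - u i"
    unfolding D_def using u(3) by (auto intro!: Min_le)
  \<comment> \<open>The passage times move by at most \<open>\<delta>\<close>; with \<open>2\<delta> < D\<close> they keep their order.\<close>
  define \<delta> where "\<delta> = min (\<epsilon>/3) (D/3)"
  have \<delta>: "\<delta> > 0" "\<delta> < \<epsilon>" "\<delta> \<le> \<epsilon>/2" "2 * \<delta> < D" "\<delta> \<le> 1" using \<epsilon> D by (auto simp: \<delta>_def)
  show ?thesis
  proof (rule exI[of _ \<delta>], rule conjI, rule \<delta>(1), rule exI[of _ "T + 1"], intro allI impI)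
    fix \<tau> y
    assume y: "y \<in> cadlag_space"
      and g: "\<forall>u\<in>{0..T+1}. \<exists>v\<ge>0. \<forall>s\<ge>0. u \<le> \<tau> s \<longleftrightarrow> v \<le> s"
      and b: "\<forall>s\<in>{0..T+1}. 0 \<le> \<tau> s \<and> \<bar>\<tau> s - s\<bar> < \<delta> \<and> \<bar>y s - x (\<tau> s)\<bar> < \<delta>"
    have u_mono: "u i \<le> u j" if "i \<le> j" "j \<le> r" for i j
      using that
    proof (induction j rule: dec_induct)
      case (step j) then show ?case using u(3)[of j] by simp
    qed simp
    have ur: "u i \<in> {0..T}" if "i \<le> r" for i using u_mono[of 0 i] u_mono[of i r] that u by auto
    have "\<forall>i. \<exists>v. i \<le> r \<longrightarrow> v \<ge> 0 \<and> (\<forall>s\<ge>0. u i \<le> \<tau> s \<longleftrightarrow> v \<le> s)"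
    proof
      fix i show "\<exists>v. i \<le> r \<longrightarrow> v \<ge> 0 \<and> (\<forall>s\<ge>0. u i \<le> \<tau> s \<longleftrightarrow> v \<le> s)"
        using g[THEN bspec, of "u i"] ur[of i] by (cases "i \<le> r") force+
    qed
    then obtain v where v: "\<And>i. i \<le> r \<Longrightarrow> v i \<ge> 0"
      "\<And>i s. i \<le> r \<Longrightarrow> s \<ge> 0 \<Longrightarrow> u i \<le> \<tau> s \<longleftrightarrow> v i \<le> s" by metis
    have v0: "v 0 = 0" using v(1)[of 0] v(2)[of 0 0] b T u(1) by auto
    have close: "\<bar>v i - u i\<bar> \<le> \<delta>" if i: "i \<le> r" for i
    proof -
      have "u i + \<delta> \<in> {0..T+1}" using ur[OF i] \<delta> by auto
      then have "u i \<le> \<tau> (u i + \<delta>)" using b by force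
      then have 1: "v i \<le> u i + \<delta>" using v(2)[OF i, of "u i + \<delta>"] ur[OF i] \<delta> by auto
      then have "v i \<in> {0..T+1}" using v(1)[OF i] ur[OF i] \<delta> by auto
      then have "\<tau> (v i) < v i + \<delta>" using b by force
      moreover have "u i \<le> \<tau> (v i)" using v(2)[OF i v(1)[OF i]] by simp
      ultimately show ?thesis using 1 by linarith
    qed
    have vs: "v i < v (Suc i)" if "i < r" for i
      using close[of i] close[of "Suc i"] D(3)[OF that] \<delta>(4) that by auto
    obtain \<theta> where \<theta>: "\<theta> \<in> time_changes" "\<And>i. i \<le> r \<Longrightarrow> \<theta> (u i) = v i" "\<And>s. s \<ge> 0 \<Longrightarrow> \<bar>\<theta> s - s\<bar> \<le> \<delta>"
      using time_change_through_points[OF u(1) v0 u(3) vs close] by blast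
    have mono: "strict_mono_on {0..} \<theta>" and surj: "\<theta> ` {0..} = {0..}"
      using \<theta>(1) by (auto simp: time_changes_def)
    show "y \<in> J1_nbhd N \<epsilon> x" unfolding J1_nbhd_def
    proof (intro CollectI conjI bexI[of _ \<theta>] ballI)
      fix s assume s: "s \<in> {0..N}"
      then show "\<bar>\<theta> s - s\<bar> < \<epsilon>" using \<theta>(3)[of s] \<delta> by auto
      define i where "i = Max {i. i \<le> r \<and> u i \<le> s}"
      have fin: "finite {i. i \<le> r \<and> u i \<le> s}" and ne: "{i. i \<le> r \<and> u i \<le> s} \<noteq> {}"
        using s u(1) by auto
      have i: "i \<le> r" "u i \<le> s" using Max_in[OF fin ne] unfolding i_def by auto
      have "i \<noteq> r" using i s T u(2) by auto
      then have ir: "i < r" using i by simp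
      have "s < u (Suc i)"
      proof (rule ccontr)
        assume "\<not> s < u (Suc i)"
        then have "Suc i \<le> i" using fin ir unfolding i_def by (intro Max_ge) auto
        then show False by simp
      qed
      have 0: "u i \<ge> 0" "u (Suc i) \<ge> 0" using ur[of i] ur[of "Suc i"] ir by auto
      have \<theta>s: "\<theta> s \<ge> 0" using surj s by (metis atLeastAtMost_iff atLeast_iff imageI)
      have "v i \<le> \<theta> s" using strict_mono_onD[OF mono, of "u i" s] i \<theta>(2)[of i] s 0
        by (cases "u i = s") auto
      moreover have "\<theta> s < v (Suc i)"
        using strict_mono_onD[OF mono, of s "u (Suc i)"] \<open>s < u (Suc i)\<close> \<theta>(2)[of "Suc i"] ir s 0 by auto
      ultimately have "u i \<le> \<tau> (\<theta> s)" "\<tau> (\<theta> s) < u (Suc i)"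
        using v(2)[of i "\<theta> s"] v(2)[of "Suc i" "\<theta> s"] ir \<theta>s by auto
      then have "\<bar>x (\<tau> (\<theta> s)) - x s\<bar> < \<epsilon>/2" using osc[OF ir] i \<open>s < u (Suc i)\<close> by auto
      moreover have "\<theta> s \<in> {0..T+1}" using \<theta>(3)[of s] s T \<delta> \<theta>s by auto
      then have "\<bar>y (\<theta> s) - x (\<tau> (\<theta> s))\<bar> < \<delta>" using b by blast
      ultimately show "\<bar>y (\<theta> s) - x s\<bar> < \<epsilon>" using \<delta> by linarith
    qed (use y \<theta> in auto)
  qed
qed


text \<open>
  To the left of a point, \<open>\<kappa>\<close> is nondecreasing, integer-valued and bounded by its value at the point,
  so it is eventually constant.
\<close>

lemma step_path_cadlag:
  fixes \<kappa> :: "real \<Rightarrow> nat" and f :: "nat \<Rightarrow> real"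
  assumes mono: "\<And>r s. 0 \<le> r \<Longrightarrow> r \<le> s \<Longrightarrow> \<kappa> r \<le> \<kappa> s"
    and right: "\<And>s. 0 \<le> s \<Longrightarrow> \<exists>e>s. \<forall>r\<in>{s..<e}. \<kappa> r = \<kappa> s"
  shows "(\<lambda>s\<in>{0..}. f (\<kappa> s)) \<in> cadlag_space"
proof -
  let ?x = "\<lambda>s\<in>{0..}. f (\<kappa> s)"
  have "continuous (at_right s) ?x" if s: "s \<ge> 0" for s
  proof -
    obtain e where e: "e > s" "\<And>r. r \<in> {s..<e} \<Longrightarrow> \<kappa> r = \<kappa> s" using right[OF s] by blast
    have "\<forall>\<^sub>F r in at_right s. ?x r = ?x s"
      unfolding eventually_at_right[OF e(1)]
    proof (intro exI[of _ e] conjI allI impI)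
      fix r assume "s < r" "r < e"
      then have "\<kappa> r = \<kappa> s" "r \<ge> 0" using s by (intro e(2), auto)
      then show "?x r = ?x s" using s by simp
    qed (rule e(1))
    then show ?thesis unfolding continuous_within by (rule tendsto_eventually)
  qed
  moreover have "\<exists>l. (?x \<longlongrightarrow> l) (at_left s)" if s: "s > 0" for s
  proof -
    define K where "K = \<kappa> ` {0..<s}"
    have "K \<subseteq> {..\<kappa> s}" unfolding K_def using mono by auto
    then have "finite K" by (rule finite_subset) simp
    moreover have "K \<noteq> {}" unfolding K_def using s by simp
    ultimately have K: "Max K \<in> K" "\<And>k. k \<in> K \<Longrightarrow> k \<le> Max K" by auto
    then obtain r0 where r0: "r0 \<in> {0..<s}" "Max K = \<kappa> r0" unfolding K_def by blast
    have "?x r = f (Max K)" if "r0 < r" "r < s" for r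
    proof -
      have "\<kappa> r \<in> K" "\<kappa> r0 \<le> \<kappa> r" using that r0 mono[of r0 r] unfolding K_def by auto
      then have "\<kappa> r = Max K" using K r0 by force
      then show ?thesis using that r0 by simp
    qed
    then have "\<forall>\<^sub>F r in at_left s. ?x r = f (Max K)"
      unfolding eventually_at_left[OF s] using r0 by (intro exI[of _ r0]) (auto simp: eventually_at_left[of r0 s])
    then show ?thesis by (blast intro: tendsto_eventually)
  qed
  ultimately show ?thesis unfolding cadlag_space_def by auto
qed

lemma time_change_inverse:
  assumes "\<theta> \<in> time_changes"
  shows "inv_into {0..} \<theta> \<in> time_changes"
proof -
  have mono: "strict_mono_on {0..} \<theta>" and surj: "\<theta> ` {0..} = {0..}"
    using assms by (auto simp: time_changes_def)
  have inj: "inj_on \<theta> {0..}" by (rule strict_mono_on_imp_inj_on[OF mono])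
  have "inv_into {0..} \<theta> ` {0..} = {0..}"
    using inv_into_image_cancel[OF inj, of "{0..}"] surj by simp
  moreover have "inv_into {0..} \<theta> r < inv_into {0..} \<theta> s" if "0 \<le> r" "r < s" for r s
  proof (rule ccontr)
    assume "\<not> ?thesis"
    moreover have "inv_into {0..} \<theta> r \<in> {0..}" "inv_into {0..} \<theta> s \<in> {0..}"
      using that surj inv_into_into[of _ \<theta> "{0..}"] by (metis atLeast_iff less_imp_le order.trans)+
    moreover have "\<theta> (inv_into {0..} \<theta> r) = r" "\<theta> (inv_into {0..} \<theta> s) = s"
      using that surj by (auto intro!: f_inv_into_f)
    ultimately have "s \<le> r" using strict_mono_on_leD[OF mono, of "inv_into {0..} \<theta> s" "inv_into {0..} \<theta> r"] by simp
    then show False using that by simp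
  qed
  ultimately show ?thesis unfolding time_changes_def strict_mono_on_def by auto
qed

lemma J1_nbhd_sym:
  assumes x: "x \<in> cadlag_space" and y: "y \<in> J1_nbhd (N + \<epsilon>) \<epsilon> x" and "\<epsilon> > 0"
  shows "x \<in> J1_nbhd N \<epsilon> y"
proof -
  obtain \<theta> where \<theta>: "\<theta> \<in> time_changes" "\<And>s. s \<in> {0..N+\<epsilon>} \<Longrightarrow> \<bar>\<theta> s - s\<bar> < \<epsilon> \<and> \<bar>y (\<theta> s) - x s\<bar> < \<epsilon>"
    using y unfolding J1_nbhd_def by blast
  have mono: "strict_mono_on {0..} \<theta>" and surj: "\<theta> ` {0..} = {0..}"
    using \<theta>(1) by (auto simp: time_changes_def)
  have "\<bar>inv_into {0..} \<theta> s - s\<bar> < \<epsilon> \<and> \<bar>x (inv_into {0..} \<theta> s) - y s\<bar> < \<epsilon>" if s: "s \<in> {0..N}" for s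
  proof -
    define r where "r = inv_into {0..} \<theta> s"
    have r: "r \<ge> 0" "\<theta> r = s"
      using s surj inv_into_into[of s \<theta> "{0..}"] f_inv_into_f[of s \<theta> "{0..}"] unfolding r_def by auto
    have "r \<le> N + \<epsilon>"
    proof (rule ccontr)
      assume "\<not> ?thesis"
      then have "\<theta> (N + \<epsilon>) < s" using strict_mono_onD[OF mono, of "N + \<epsilon>" r] r s \<open>\<epsilon> > 0\<close> by auto
      moreover have "\<theta> (N + \<epsilon>) > N" using \<theta>(2)[of "N + \<epsilon>"] s \<open>\<epsilon> > 0\<close> by auto
      ultimately show False using s by auto
    qed
    then show ?thesis using \<theta>(2)[of r] r unfolding r_def[symmetric] by auto
  qed
  then show ?thesis using x time_change_inverse[OF \<theta>(1)] unfolding J1_nbhd_def by blast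
qed

section \<open>Measurability of path-valued maps\<close>

text \<open>
  Paths are discretised by sampling at multiples of \<open>1 / Suc n\<close> up to time \<open>Suc n\<close> and rounding the
  values to multiples of \<open>1 / Suc n\<close>. Only countably many codes occur, so events about a discretised
  path are countable unions of events about single codes, whatever the topology.
\<close>

definition grid_index :: "nat \<Rightarrow> real \<Rightarrow> nat" where
  "grid_index n s = min (nat \<lfloor>real (Suc n) * s\<rfloor>) (Suc n * Suc n)"

definition rounded_path :: "nat \<Rightarrow> (nat \<Rightarrow> int) \<Rightarrow> real \<Rightarrow> real" where
  "rounded_path n c = (\<lambda>s\<in>{0..}. real_of_int (c (grid_index n s)) / real (Suc n))"

definition grid_code :: "nat \<Rightarrow> (real \<Rightarrow> real) \<Rightarrow> nat \<Rightarrow> int" where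
  "grid_code n x = (\<lambda>k\<in>{..Suc n * Suc n}. \<lfloor>real (Suc n) * x (real k / real (Suc n))\<rfloor>)"

lemma grid_index_right_constant:
  assumes "0 \<le> s"
  shows "\<exists>e>s. \<forall>r\<in>{s..<e}. grid_index n r = grid_index n s"
proof (intro exI[of _ "(real_of_int \<lfloor>real (Suc n) * s\<rfloor> + 1) / real (Suc n)"] conjI ballI)
  let ?e = "(real_of_int \<lfloor>real (Suc n) * s\<rfloor> + 1) / real (Suc n)"
  show "s < ?e" by (subst pos_less_divide_eq) (simp_all add: mult.commute[of s] floor_correct del: of_nat_Suc)
  fix r assume r: "r \<in> {s..<?e}"
  then have 1: "real (Suc n) * r < real_of_int \<lfloor>real (Suc n) * s\<rfloor> + 1"
    by (simp add: pos_less_divide_eq mult.commute del: of_nat_Suc)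
  have "real (Suc n) * s \<le> real (Suc n) * r" using r by (intro mult_left_mono) auto
  with 1 have "\<lfloor>real (Suc n) * r\<rfloor> = \<lfloor>real (Suc n) * s\<rfloor>" by linarith
  then show "grid_index n r = grid_index n s" by (simp add: grid_index_def)
qed

lemma rounded_path_cadlag: "rounded_path n c \<in> cadlag_space"
  unfolding rounded_path_def
proof (rule step_path_cadlag)
  show "grid_index n r \<le> grid_index n s" if "0 \<le> r" "r \<le> s" for r s
    unfolding grid_index_def using that by (intro min.mono nat_mono floor_mono mult_left_mono) auto
qed (rule grid_index_right_constant)

lemma rounding_error:
  fixes m :: nat
  assumes "m > 0"
  shows "\<bar>real_of_int \<lfloor>real m * s\<rfloor> / real m - s\<bar> \<le> 1 / real m"
proof -
  have "real_of_int \<lfloor>real m * s\<rfloor> / real m - s = (real_of_int \<lfloor>real m * s\<rfloor> - real m * s) / real m"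
    using assms by (simp add: diff_divide_distrib)
  also have "\<bar>\<dots>\<bar> = \<bar>real_of_int \<lfloor>real m * s\<rfloor> - real m * s\<bar> / real m" using assms by simp
  also have "\<dots> \<le> 1 / real m" by (intro divide_right_mono) linarith+
  finally show ?thesis .
qed

lemma rounded_path_tendsto:
  assumes x: "x \<in> cadlag_space" and "\<epsilon> > 0"
  shows "\<forall>\<^sub>F n in sequentially. rounded_path n (grid_code n x) \<in> J1_nbhd N \<epsilon> x"
proof -
  obtain \<delta> T where \<delta>: "\<delta> > 0" and T: "\<And>\<tau> y. y \<in> cadlag_space \<Longrightarrow>
    (\<forall>u\<in>{0..T}. \<exists>v\<ge>0. \<forall>s\<ge>0. u \<le> \<tau> s \<longleftrightarrow> v \<le> s) \<Longrightarrow>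
    (\<forall>s\<in>{0..T}. 0 \<le> \<tau> s \<and> \<bar>\<tau> s - s\<bar> < \<delta> \<and> \<bar>y s - x (\<tau> s)\<bar> < \<delta>) \<Longrightarrow> y \<in> J1_nbhd N \<epsilon> x"
    using J1_nbhd_of_time_deformation[OF assms, of N] by metis
  obtain n0 where n0: "1 / real (Suc n0) < \<delta>" using \<delta> by (meson nat_approx_posE)
  show ?thesis
  proof (rule eventually_sequentiallyI)
    fix n assume n: "max n0 (nat \<lceil>T\<rceil>) \<le> n"
    define m where "m = Suc n"
    have m: "m > 0" "real m \<ge> T" "1 / real m < \<delta>"
    proof -
      show "real m \<ge> T" using n unfolding m_def by linarith
      have "1 / real m \<le> 1 / real (Suc n0)" using n unfolding m_def by (simp add: field_simps)
      then show "1 / real m < \<delta>" using n0 by simp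
    qed (simp add: m_def)
    define \<tau> where "\<tau> s = real (grid_index n s) / real m" for s
    have gi: "grid_index n s = nat \<lfloor>real m * s\<rfloor>" if "s \<in> {0..T}" for s
    proof -
      have "real m * s \<le> real m * real m" using that m by (intro mult_left_mono) auto
      then have "nat \<lfloor>real m * s\<rfloor> \<le> m * m" using of_nat_mult[of m m, where 'a=real] by linarith
      then show ?thesis unfolding grid_index_def m_def by simp
    qed
    show "rounded_path n (grid_code n x) \<in> J1_nbhd N \<epsilon> x"
    proof (rule T[of _ \<tau>])
      show "\<forall>u\<in>{0..T}. \<exists>v\<ge>0. \<forall>s\<ge>0. u \<le> \<tau> s \<longleftrightarrow> v \<le> s"
      proof
        fix u assume u: "u \<in> {0..T}"
        have "u \<le> \<tau> s \<longleftrightarrow> real (nat \<lceil>real m * u\<rceil>) / real m \<le> s" if s: "s \<ge> 0" for s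
        proof -
          have "real m * u \<le> real m * real m" using u m by (intro mult_left_mono) auto
          then have "real m * u \<le> real_of_int (int (m * m))" by simp
          then have b: "\<lceil>real m * u\<rceil> \<le> int (m * m)" by (simp only: ceiling_le_iff)
          have "u \<le> \<tau> s \<longleftrightarrow> real m * u \<le> real (grid_index n s)"
            unfolding \<tau>_def using m by (simp add: field_simps)
          also have "\<dots> \<longleftrightarrow> \<lceil>real m * u\<rceil> \<le> int (grid_index n s)" by linarith
          also have "\<dots> \<longleftrightarrow> \<lceil>real m * u\<rceil> \<le> \<lfloor>real m * s\<rfloor>"
          proof -
            have "0 \<le> \<lfloor>real m * s\<rfloor>" using s by simp
            then have "int (grid_index n s) = min \<lfloor>real m * s\<rfloor> (int (m * m))"
              unfolding grid_index_def m_def[symmetric] of_nat_min by simp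
            then show ?thesis using b by simp
          qed
          also have "\<dots> \<longleftrightarrow> real_of_int \<lceil>real m * u\<rceil> \<le> real m * s" by linarith
          also have "real_of_int \<lceil>real m * u\<rceil> = real (nat \<lceil>real m * u\<rceil>)" using u m by simp
          also have "(\<dots> \<le> real m * s) \<longleftrightarrow> \<dots> / real m \<le> s" using m by (simp add: field_simps)
          finally show ?thesis .
        qed
        then show "\<exists>v\<ge>0. \<forall>s\<ge>0. u \<le> \<tau> s \<longleftrightarrow> v \<le> s" by (intro exI[of _ "real (nat \<lceil>real m * u\<rceil>) / real m"]) auto
      qed
      show "\<forall>s\<in>{0..T}. 0 \<le> \<tau> s \<and> \<bar>\<tau> s - s\<bar> < \<delta> \<and> \<bar>rounded_path n (grid_code n x) s - x (\<tau> s)\<bar> < \<delta>"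
      proof
        fix s assume s: "s \<in> {0..T}"
        have "\<tau> s = real_of_int \<lfloor>real m * s\<rfloor> / real m" unfolding \<tau>_def gi[OF s] using s m by simp
        then have 1: "\<bar>\<tau> s - s\<bar> < \<delta>" using m rounding_error[OF m(1), of s] by simp
        have "rounded_path n (grid_code n x) s = real_of_int \<lfloor>real m * x (\<tau> s)\<rfloor> / real m"
          using s by (simp add: rounded_path_def grid_code_def \<tau>_def m_def grid_index_def)
        then have "\<bar>rounded_path n (grid_code n x) s - x (\<tau> s)\<bar> < \<delta>"
          using m rounding_error[OF m(1), of "x (\<tau> s)"] by simp
        then show "0 \<le> \<tau> s \<and> \<bar>\<tau> s - s\<bar> < \<delta> \<and> \<bar>rounded_path n (grid_code n x) s - x (\<tau> s)\<bar> < \<delta>"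
          using 1 m by (simp add: \<tau>_def)
      qed
    qed (rule rounded_path_cadlag)
  qed
qed

text \<open>
  For \<open>U\<close> open, a path lies in \<open>U\<close> iff for some \<open>m\<close> almost all of its discretisations have their
  \<open>m\<close>-th basic neighbourhood inside \<open>U\<close>: the neighbourhood relation is symmetric up to a shift of the
  horizon, so a neighbourhood of a close discretisation contains the path. This writes the event
  with countably many events about finitely many rounded coordinates.
\<close>

lemma measurable_J1:
  assumes X: "\<And>\<omega>. \<omega> \<in> space M \<Longrightarrow> X \<omega> \<in> cadlag_space"
    and coord: "\<And>s. s \<ge> 0 \<Longrightarrow> (\<lambda>\<omega>. X \<omega> s) \<in> borel_measurable M"
  shows "X \<in> measurable M (borel_of J1_topology)"
  unfolding borel_of_def topspace_J1
proof (rule measurable_measure_of)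
  show "{U. openin J1_topology U} \<subseteq> Pow cadlag_space" using openin_J1 by blast
  show "X \<in> space M \<rightarrow> cadlag_space" using X by blast
  fix U assume "U \<in> {U. openin J1_topology U}"
  then have U: "\<And>x. x \<in> U \<Longrightarrow> \<exists>N. \<exists>\<epsilon>>0. J1_nbhd N \<epsilon> x \<subseteq> U" using openin_J1 by blast
  define V where "V m = {c. J1_nbhd (real m) (1 / real (Suc m)) c \<subseteq> U}" for m
  define A where "A n m = {\<omega> \<in> space M. rounded_path n (grid_code n (X \<omega>)) \<in> V m}" for n m
  have "A n m \<in> sets M" for n m
  proof -
    let ?I = "{..Suc n * Suc n}"
    define C where "C = {c \<in> PiE ?I (\<lambda>_. UNIV :: int set). rounded_path n c \<in> V m}"
    have "countable (PiE ?I (\<lambda>_. UNIV :: int set))" by (rule countable_PiE) auto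
    then have C: "countable C" unfolding C_def by (rule countable_subset[rotated]) auto
    have "grid_code n x \<in> PiE ?I (\<lambda>_. UNIV)" for x by (auto simp: grid_code_def)
    then have "A n m = (\<Union>c\<in>C. {\<omega> \<in> space M. grid_code n (X \<omega>) = c})"
      unfolding A_def C_def by blast
    moreover have "{\<omega> \<in> space M. grid_code n (X \<omega>) = c} \<in> sets M" if "c \<in> C" for c
    proof -
      have "grid_code n (X \<omega>) = c \<longleftrightarrow>
        (\<forall>k\<in>?I. \<lfloor>real (Suc n) * X \<omega> (real k / real (Suc n))\<rfloor> = c k)" for \<omega>
        using that unfolding C_def grid_code_def
        by (auto simp: PiE_def extensional_def fun_eq_iff)
      moreover have "{\<omega> \<in> space M. \<forall>k\<in>?I. \<lfloor>real (Suc n) * X \<omega> (real k / real (Suc n))\<rfloor> = c k} \<in> sets M"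
      proof (rule sets.sets_Collect_finite_All)
        fix k
        have [measurable]: "(\<lambda>\<omega>. X \<omega> (real k / real (Suc n))) \<in> borel_measurable M" by (rule coord) simp
        show "{\<omega> \<in> space M. \<lfloor>real (Suc n) * X \<omega> (real k / real (Suc n))\<rfloor> = c k} \<in> sets M" by measurable
      qed simp
      ultimately show ?thesis by simp
    qed
    ultimately show ?thesis using C by (auto intro!: sets.countable_UN'')
  qed
  then have "(\<Union>m. \<Union>k. \<Inter>n\<in>{k..}. A n m) \<in> sets M" by (intro sets.countable_UN sets.countable_INT) auto
  also have "(\<Union>m. \<Union>k. \<Inter>n\<in>{k..}. A n m) = X -` U \<inter> space M"
  proof (intro equalityI subsetI)
    fix \<omega> assume "\<omega> \<in> (\<Union>m. \<Union>k. \<Inter>n\<in>{k..}. A n m)"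
    then obtain m k where k: "\<And>n. n \<ge> k \<Longrightarrow> \<omega> \<in> A n m" by auto
    then have \<omega>: "\<omega> \<in> space M" unfolding A_def by blast
    let ?e = "1 / real (Suc m)"
    obtain n1 where n1: "\<And>n. n \<ge> n1 \<Longrightarrow> rounded_path n (grid_code n (X \<omega>)) \<in> J1_nbhd (real m + ?e) ?e (X \<omega>)"
      using rounded_path_tendsto[OF X[OF \<omega>], of ?e "real m + ?e"] unfolding eventually_sequentially by auto
    define n where "n = max n1 k"
    have "X \<omega> \<in> J1_nbhd (real m) ?e (rounded_path n (grid_code n (X \<omega>)))"
      by (rule J1_nbhd_sym[OF X[OF \<omega>] n1]) (auto simp: n_def)
    moreover have "rounded_path n (grid_code n (X \<omega>)) \<in> V m" using k[of n] unfolding A_def n_def by simp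
    ultimately show "\<omega> \<in> X -` U \<inter> space M" using \<omega> unfolding V_def by blast
  next
    fix \<omega> assume "\<omega> \<in> X -` U \<inter> space M"
    then have \<omega>: "\<omega> \<in> space M" "X \<omega> \<in> U" by auto
    obtain N \<epsilon> where e: "\<epsilon> > 0" "J1_nbhd N \<epsilon> (X \<omega>) \<subseteq> U" using U[OF \<omega>(2)] by blast
    obtain m1 where m1: "1 / real (Suc m1) < \<epsilon>/2" using e by (meson nat_approx_posE half_gt_zero)
    define m where "m = max m1 (nat \<lceil>N + \<epsilon>/2\<rceil>)"
    have m: "real m \<ge> N + \<epsilon>/2" "1 / real (Suc m) \<le> \<epsilon>/2"
    proof -
      show "real m \<ge> N + \<epsilon>/2" unfolding m_def by linarith
      have "1 / real (Suc m) \<le> 1 / real (Suc m1)" unfolding m_def by (simp add: field_simps)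
      then show "1 / real (Suc m) \<le> \<epsilon>/2" using m1 by simp
    qed
    obtain n1 where n1: "\<And>n. n \<ge> n1 \<Longrightarrow> rounded_path n (grid_code n (X \<omega>)) \<in> J1_nbhd N (\<epsilon>/2) (X \<omega>)"
      using rounded_path_tendsto[OF X[OF \<omega>(1)], of "\<epsilon>/2" N] e unfolding eventually_sequentially by auto
    have "\<omega> \<in> A n m" if "n \<ge> n1" for n
    proof -
      have "J1_nbhd (real m) (1 / real (Suc m)) (rounded_path n (grid_code n (X \<omega>))) \<subseteq> J1_nbhd N \<epsilon> (X \<omega>)"
        using J1_nbhd_trans[OF n1[OF that]] J1_nbhd_mono[OF m] by fastforce
      then show ?thesis unfolding A_def V_def using e \<omega> by blast
    qed
    then show "\<omega> \<in> (\<Union>m. \<Union>k. \<Inter>n\<in>{k..}. A n m)" by auto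
  qed
  finally show "X -` U \<inter> space M \<in> sets M" .
qed

lemma monotone_path_cadlag:
  fixes f :: "real \<Rightarrow> real"
  assumes mono: "\<And>r s. 0 \<le> r \<Longrightarrow> r \<le> s \<Longrightarrow> f r \<le> f s"
    and right: "\<And>s e. 0 \<le> s \<Longrightarrow> e > 0 \<Longrightarrow> \<exists>r>s. f r < f s + e"
  shows "(\<lambda>s\<in>{0..}. f s) \<in> cadlag_space"
proof -
  let ?x = "\<lambda>s\<in>{0..}. f s"
  have "continuous (at_right s) ?x" if s: "s \<ge> 0" for s
    unfolding continuous_within
  proof (rule tendstoI)
    fix e :: real assume "e > 0"
    then obtain r where r: "r > s" "f r < f s + e" using right[OF s] by blast
    show "\<forall>\<^sub>F q in at_right s. dist (?x q) (?x s) < e"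
      unfolding eventually_at_right[OF r(1)]
    proof (intro exI[of _ r] conjI allI impI)
      fix q assume q: "s < q" "q < r"
      then show "dist (?x q) (?x s) < e"
        using mono[of s q] mono[of q r] s r by (simp add: dist_real_def)
    qed (rule r)
  qed
  moreover have "\<exists>l. (?x \<longlongrightarrow> l) (at_left s)" if s: "s > 0" for s
  proof
    define l where "l = (SUP r\<in>{0..<s}. f r)"
    have bdd: "bdd_above (f ` {0..<s})" using mono by (intro bdd_aboveI[of _ "f s"]) auto
    show "(?x \<longlongrightarrow> l) (at_left s)"
    proof (rule tendstoI)
      fix e :: real assume "e > 0"
      then have "l - e < l" by simp
      then obtain r where r: "r \<in> {0..<s}" "l - e < f r"
        unfolding l_def using less_cSUP_iff[OF _ bdd, of "l - e"] s by (auto simp: l_def)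
      have "dist (?x q) l < e" if "r < q" "q < s" for q
      proof -
        have "f q \<le> l" unfolding l_def using that r by (intro cSUP_upper bdd) auto
        moreover have "f r \<le> f q" using mono that r by auto
        ultimately show ?thesis using r that by (simp add: dist_real_def)
      qed
      then show "\<forall>\<^sub>F q in at_left s. dist (?x q) l < e"
        using r eventually_at_left[of r s] by (auto intro!: exI[of _ r])
    qed
  qed
  ultimately show ?thesis unfolding cadlag_space_def by auto
qed

section \<open>Truncated means and the principle of one big jump\<close>

text \<open>
  A part of Karamata's theorem. Write \<open>L z\<close> for the truncated mean and \<open>T z\<close> for the tail. Doubling
  gives \<open>L (2z) \<le> L z + z T z\<close>, while \<open>T (2z) \<ge> \<beta> T z\<close> for large \<open>z\<close> with some \<open>\<beta> > 1/2\<close>, which is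
  where \<open>\<alpha> < 1\<close> enters. So the ratio \<open>R = L z / (z T z)\<close> satisfies \<open>R (2z) \<le> (R z + 1) / (2\<beta>)\<close> and
  stays bounded.
\<close>

lemma truncated_mean_bound:
  fixes M :: "real measure" and \<alpha> :: real
  assumes "real_distribution M" and nonneg: "AE x in M. 0 \<le> x" and "0 < \<alpha>" "\<alpha> < 1"
    and ratio: "((\<lambda>z. measure M {2 * z<..} / measure M {z<..}) \<longlongrightarrow> 2 powr (-\<alpha>)) at_top"
  shows "\<exists>C>0. \<exists>z0>0. \<forall>z\<ge>z0. (\<integral>x. min x z \<partial>M) \<le> C * (z * measure M {z<..})"
proof -
  interpret real_distribution M by fact
  define T where "T z = measure M {z<..}" for z
  define L where "L z = (\<integral>x. min x z \<partial>M)" for z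
  have T_anti: "T y \<le> T z" if "z \<le> y" for y z
    unfolding T_def using that by (intro finite_measure_mono) auto
  have T0: "T z \<ge> 0" for z by (simp add: T_def)
  have int: "integrable M (\<lambda>x. min x z)" if "z > 0" for z
    by (rule integrable_const_bound[of _ z]) (use nonneg that in \<open>auto elim!: eventually_mono\<close>)
  have L_le: "L z \<le> z" if "z > 0" for z
  proof -
    have "L z \<le> (\<integral>x. z \<partial>M)" unfolding L_def using int[OF that] by (intro integral_mono) auto
    then show ?thesis using prob_space by simp
  qed
  have L_double: "L (2 * z) \<le> L z + z * T z" if z: "z > 0" for z
  proof -
    have "L (2 * z) \<le> (\<integral>x. min x z + z * indicator {z<..} x \<partial>M)" unfolding L_def
      by (intro integral_mono Bochner_Integration.integrable_add int integrable_mult_right integrable_real_indicator)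
        (use z in \<open>auto simp: indicator_def emeasure_eq_measure\<close>)
    also have "\<dots> = L z + z * T z" unfolding L_def T_def
      using int[OF z] by (subst Bochner_Integration.integral_add) (auto simp: emeasure_eq_measure)
    finally show ?thesis .
  qed
  have "(1::real) / 2 = 2 powr (-1)" by (simp add: powr_minus)
  also have "\<dots> < 2 powr (-\<alpha>)" using \<open>\<alpha> < 1\<close> by (intro powr_less_mono) auto
  finally have half: "1/2 < 2 powr (-\<alpha>)" .
  define \<beta> where "\<beta> = (1/2 + 2 powr (-\<alpha>)) / 2"
  have \<beta>: "1 < 2 * \<beta>" "\<beta> < 2 powr (-\<alpha>)" using half by (auto simp: \<beta>_def)
  have "\<forall>\<^sub>F z in at_top. \<beta> < T (2 * z) / T z"
    using order_tendstoD(1)[OF ratio \<beta>(2)] by (simp add: T_def)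
  then obtain z' where z': "\<And>z. z \<ge> z' \<Longrightarrow> \<beta> < T (2 * z) / T z"
    unfolding eventually_at_top_linorder by blast
  define z1 where "z1 = max z' 1"
  have z1: "z1 > 0" by (simp add: z1_def)
  have T_pos: "T z > 0" if "z \<ge> z1" for z
  proof -
    have "T (2 * z) / T z > 0" using z'[of z] that \<beta> by (auto simp: z1_def)
    then show ?thesis using T0[of z] by (cases "T z = 0") auto
  qed
  have T_double: "\<beta> * T z \<le> T (2 * z)" if "z \<ge> z1" for z
    using z'[of z] T_pos[OF that] that by (auto simp: z1_def field_simps)
  \<comment> \<open>The first entry bounds the ratio on \<open>[z1, 2 z1]\<close>; the second makes the bound invariant under doubling.\<close>
  define C where "C = max (1 / T (2 * z1)) (1 / (2 * \<beta> - 1))"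
  have C: "C > 0" "C \<ge> 1 / T (2 * z1)" "C \<ge> 1 / (2 * \<beta> - 1)"
    unfolding C_def using \<beta> by (auto simp: less_max_iff_disj)
  have C1: "C + 1 \<le> 2 * \<beta> * C" using C(3) \<beta> by (simp add: field_simps)
  have main: "\<forall>z. z1 \<le> z \<and> z \<le> 2 ^ Suc n * z1 \<longrightarrow> L z \<le> C * (z * T z)" for n
  proof (induction n)
    case 0
    show ?case
    proof (intro allI impI)
      fix z assume z: "z1 \<le> z \<and> z \<le> 2 ^ Suc 0 * z1"
      have "1 \<le> C * T (2 * z1)" using C(2) T_pos[of "2 * z1"] z1 by (simp add: field_simps)
      also have "\<dots> \<le> C * T z" using z C by (intro mult_left_mono T_anti) auto
      finally have "z * 1 \<le> z * (C * T z)" using z z1 by (intro mult_left_mono) auto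
      then have "L z \<le> z * (C * T z)" using L_le[of z] z z1 by linarith
      then show "L z \<le> C * (z * T z)" by (simp only: mult.left_commute)
    qed
  next
    case (Suc n)
    show ?case
    proof (intro allI impI)
      fix z assume z: "z1 \<le> z \<and> z \<le> 2 ^ Suc (Suc n) * z1"
      show "L z \<le> C * (z * T z)"
      proof (cases "z \<le> 2 ^ Suc n * z1")
        case True then show ?thesis using Suc z by blast
      next
        case False
        define w where "w = z / 2"
        have "1 * z1 \<le> 2 ^ n * z1" using z1 by (intro mult_right_mono) auto
        moreover have "2 * (2 ^ n * z1) < z" using False by simp
        ultimately have "2 * z1 < z" by linarith
        then have w: "z1 \<le> w" "w \<le> 2 ^ Suc n * z1" "z = 2 * w" "w > 0" using z z1 by (auto simp: w_def)
        have "L z \<le> L w + w * T w" using L_double[of w] w by simp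
        also have "\<dots> \<le> C * (w * T w) + w * T w" using Suc w by auto
        also have "\<dots> = (C + 1) * (w * T w)" by (simp add: algebra_simps)
        also have "\<dots> \<le> 2 * \<beta> * C * (w * T w)" using C1 w T0 by (intro mult_right_mono) auto
        also have "\<dots> = 2 * C * w * (\<beta> * T w)" by simp
        also have "\<dots> \<le> 2 * C * w * T z" using T_double[OF w(1)] w C by (intro mult_left_mono) auto
        finally show ?thesis using w by simp
      qed
    qed
  qed
  have "L z \<le> C * (z * T z)" if "z \<ge> z1" for z
  proof -
    obtain n where "z / z1 < 2 ^ n" using real_arch_pow[of 2 "z / z1"] by auto
    then have "z < 2 ^ n * z1" using z1 by (simp add: field_simps)
    also have "\<dots> \<le> 2 ^ Suc n * z1" using z1 by simp
    finally show ?thesis using main[of n] that by auto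
  qed
  then show ?thesis using C z1 unfolding L_def T_def by blast
qed

context prob_space
begin

text \<open>
  If no summand exceeds \<open>(1-\<delta>)z\<close> and at most one exceeds \<open>\<epsilon>z\<close>, a sum above \<open>z\<close> forces the truncated
  summands to add up to \<open>\<delta>z\<close>. The three terms bound the three exceptional events, the last one by
  Markov's inequality.
\<close>

lemma sum_tail_upper:
  fixes X :: "nat \<Rightarrow> 'a \<Rightarrow> real" and \<mu> :: "real measure"
  assumes ind: "indep_vars (\<lambda>_. borel) X {..<n}" and law: "\<And>i. i < n \<Longrightarrow> distr M borel (X i) = \<mu>"
    and nonneg: "AE x in \<mu>. 0 \<le> x" and pos: "0 < z" "0 < \<delta>" "0 < \<epsilon>"
  shows "prob {\<omega> \<in> space M. (\<Sum>i<n. X i \<omega>) > z} \<le> real n * measure \<mu> {(1 - \<delta>) * z<..} +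
    (real n * measure \<mu> {\<epsilon> * z<..})\<^sup>2 + real n * (\<integral>x. min x (\<epsilon> * z) \<partial>\<mu>) / (\<delta> * z)"
proof -
  have rv [measurable]: "X i \<in> borel_measurable M" if "i < n" for i
    using ind that by (auto simp: indep_vars_def2)
  define T where "T y = measure \<mu> {y<..}" for y
  define E where "E y i = X i -` {y<..} \<inter> space M" for y i
  have E [measurable]: "E y i \<in> events" if "i < n" for y i
    unfolding E_def using that by (auto intro!: measurable_sets[OF rv])
  have probE: "prob (E y i) = T y" if "i < n" for y i
    using law[OF that] rv[OF that] unfolding E_def T_def by (auto simp: measure_distr)
  have nn: "AE \<omega> in M. \<forall>i\<in>{..<n}. 0 \<le> X i \<omega>"
  proof (rule AE_finite_allI)
    fix i assume i: "i \<in> {..<n}"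
    then have "AE x in distr M borel (X i). 0 \<le> x" using nonneg by (subst law) auto
    then show "AE \<omega> in M. 0 \<le> X i \<omega>" using i by (subst (asm) AE_distr_iff) auto
  qed simp
  define A where "A = (\<Union>i\<in>{..<n}. E ((1 - \<delta>) * z) i)"
  define P where "P = {p \<in> {..<n} \<times> {..<n}. fst p \<noteq> snd p}"
  define B where "B = (\<Union>p\<in>P. E (\<epsilon> * z) (fst p) \<inter> E (\<epsilon> * z) (snd p))"
  define Sm where "Sm \<omega> = (\<Sum>i<n. min (X i \<omega>) (\<epsilon> * z))" for \<omega>
  have [measurable]: "Sm \<in> borel_measurable M" unfolding Sm_def by measurable
  define C where "C = {\<omega> \<in> space M. Sm \<omega> \<ge> \<delta> * z}"
  have finP: "finite P" unfolding P_def by simp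
  have meas: "A \<in> events" "B \<in> events" "C \<in> events"
    unfolding A_def B_def C_def using finP by (auto simp: P_def intro!: E)
  have ez: "\<epsilon> * z > 0" using pos by simp
  have "prob {\<omega> \<in> space M. (\<Sum>i<n. X i \<omega>) > z} \<le> prob (A \<union> B \<union> C)"
  proof (rule finite_measure_mono_AE)
    show "AE \<omega> in M. \<omega> \<in> {\<omega> \<in> space M. z < (\<Sum>i<n. X i \<omega>)} \<longrightarrow> \<omega> \<in> A \<union> B \<union> C"
      using nn AE_space
    proof eventually_elim
      case (elim \<omega>)
      show ?case
      proof (intro impI)
        assume S: "\<omega> \<in> {\<omega> \<in> space M. z < (\<Sum>i<n. X i \<omega>)}"
        show "\<omega> \<in> A \<union> B \<union> C"
        proof (rule ccontr)
          assume neg: "\<omega> \<notin> A \<union> B \<union> C"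
          have nA: "X i \<omega> \<le> (1 - \<delta>) * z" if "i < n" for i
            using neg that elim unfolding A_def E_def by force
          have nB: "X i \<omega> \<le> \<epsilon> * z \<or> X j \<omega> \<le> \<epsilon> * z" if "i < n" "j < n" "i \<noteq> j" for i j
            using neg that elim unfolding B_def E_def P_def by force
          have nC: "Sm \<omega> < \<delta> * z" using neg elim unfolding C_def by auto
          show False
          proof (cases "\<exists>i<n. X i \<omega> > \<epsilon> * z")
            case True
            then obtain i where i: "i < n" "X i \<omega> > \<epsilon> * z" by blast
            have "(\<Sum>j<n. X j \<omega>) = X i \<omega> + (\<Sum>j\<in>{..<n}-{i}. X j \<omega>)"
              using i by (subst sum.remove[of _ i]) auto
            also have "(\<Sum>j\<in>{..<n}-{i}. X j \<omega>) = (\<Sum>j\<in>{..<n}-{i}. min (X j \<omega>) (\<epsilon> * z))"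
              using nB[of i] i by (intro sum.cong) force+
            also have "\<dots> \<le> Sm \<omega>" unfolding Sm_def
              using elim ez by (intro sum_mono2) auto
            finally have "(\<Sum>j<n. X j \<omega>) \<le> (1 - \<delta>) * z + Sm \<omega>" using nA[OF i(1)] by simp
            then show False using S nC by (simp add: algebra_simps)
          next
            case False
            then have "(\<Sum>j<n. X j \<omega>) = Sm \<omega>" unfolding Sm_def by (intro sum.cong) force+
            then have d: "z < \<delta> * z" using S nC by simp
            then have "n > 0" using S pos by (cases n) auto
            then have "X 0 \<omega> \<le> (1 - \<delta>) * z" "0 \<le> X 0 \<omega>" using nA elim by auto
            then have "\<delta> * z \<le> z" by (simp add: algebra_simps)
            then show False using d by simp
          qed
        qed
      qed
    qed
  qed (use meas in auto)
  also have "\<dots> \<le> prob A + prob B + prob C"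
    using meas measure_Un_le[of "A \<union> B" M C] measure_Un_le[of A M B] by auto
  also have "prob A \<le> real n * T ((1 - \<delta>) * z)"
  proof -
    have "prob A \<le> (\<Sum>i<n. prob (E ((1 - \<delta>) * z) i))"
      unfolding A_def by (intro finite_measure_subadditive_finite) (auto intro: E)
    also have "\<dots> = real n * T ((1 - \<delta>) * z)" using probE by simp
    finally show ?thesis .
  qed
  also have "prob B \<le> (real n * T (\<epsilon> * z))\<^sup>2"
  proof -
    have pair: "prob (E (\<epsilon> * z) (fst p) \<inter> E (\<epsilon> * z) (snd p)) = (T (\<epsilon> * z))\<^sup>2" if p: "p \<in> P" for p
    proof -
      have ne: "fst p \<noteq> snd p" "fst p < n" "snd p < n" using p unfolding P_def by auto
      have "prob (\<Inter>i\<in>{fst p, snd p}. X i -` {\<epsilon> * z<..} \<inter> space M) =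
        (\<Prod>i\<in>{fst p, snd p}. prob (X i -` {\<epsilon> * z<..} \<inter> space M))"
        using ne by (intro indep_varsD[OF ind]) auto
      also have "(\<Inter>i\<in>{fst p, snd p}. X i -` {\<epsilon> * z<..} \<inter> space M) = E (\<epsilon> * z) (fst p) \<inter> E (\<epsilon> * z) (snd p)"
        unfolding E_def by auto
      finally show ?thesis using ne probE[of _ "\<epsilon> * z"] by (simp add: power2_eq_square E_def)
    qed
    have "prob B \<le> (\<Sum>p\<in>P. prob (E (\<epsilon> * z) (fst p) \<inter> E (\<epsilon> * z) (snd p)))"
      unfolding B_def using finP by (intro finite_measure_subadditive_finite) (auto simp: P_def intro!: E)
    also have "\<dots> = real (card P) * (T (\<epsilon> * z))\<^sup>2" using pair by simp
    also have "\<dots> \<le> real (card ({..<n} \<times> {..<n})) * (T (\<epsilon> * z))\<^sup>2"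
      unfolding P_def by (intro mult_right_mono of_nat_mono card_mono) auto
    finally show ?thesis by (simp add: power2_eq_square mult_ac)
  qed
  also have "prob C \<le> real n * (\<integral>x. min x (\<epsilon> * z) \<partial>\<mu>) / (\<delta> * z)"
  proof -
    have int: "integrable M (\<lambda>\<omega>. min (X i \<omega>) (\<epsilon> * z))" if i: "i < n" for i
    proof (rule integrable_const_bound[of _ "\<epsilon> * z"])
      show "AE \<omega> in M. norm (min (X i \<omega>) (\<epsilon> * z)) \<le> \<epsilon> * z" using nn
        by eventually_elim (use ez i in auto)
    qed (use i in measurable)
    then have "integrable M Sm" unfolding Sm_def by (intro Bochner_Integration.integrable_sum) auto
    moreover have "AE \<omega> in M. 0 \<le> Sm \<omega>"
      using nn by eventually_elim (use ez in \<open>auto simp: Sm_def intro!: sum_nonneg\<close>)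
    ultimately have "prob C \<le> expectation Sm / (\<delta> * z)" unfolding C_def
      using pos by (intro integral_Markov_inequality_measure[of _ _ "{}"]) auto
    also have "expectation Sm = (\<Sum>i<n. expectation (\<lambda>\<omega>. min (X i \<omega>) (\<epsilon> * z)))"
      unfolding Sm_def by (intro Bochner_Integration.integral_sum int) auto
    also have "\<dots> = (\<Sum>i<n. \<integral>x. min x (\<epsilon> * z) \<partial>\<mu>)"
      by (intro sum.cong refl) (auto simp: law[symmetric] integral_distr)
    finally show ?thesis by simp
  qed
  finally show ?thesis unfolding T_def by simp
qed

text \<open>
  For nonnegative summands one summand above \<open>z\<close> suffices.
\<close>

lemma sum_tail_lower:
  fixes X :: "nat \<Rightarrow> 'a \<Rightarrow> real" and \<mu> :: "real measure"
  assumes ind: "indep_vars (\<lambda>_. borel) X {..<n}" and law: "\<And>i. i < n \<Longrightarrow> distr M borel (X i) = \<mu>"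
    and nonneg: "AE x in \<mu>. 0 \<le> x"
  shows "1 - (1 - measure \<mu> {z<..}) ^ n \<le> prob {\<omega> \<in> space M. (\<Sum>i<n. X i \<omega>) > z}"
proof (cases "n = 0")
  case False
  have rv [measurable]: "X i \<in> borel_measurable M" if "i < n" for i
    using ind that by (auto simp: indep_vars_def2)
  have nn: "AE \<omega> in M. \<forall>i\<in>{..<n}. 0 \<le> X i \<omega>"
  proof (rule AE_finite_allI)
    fix i assume i: "i \<in> {..<n}"
    then have "AE x in distr M borel (X i). 0 \<le> x" using nonneg by (subst law) auto
    then show "AE \<omega> in M. 0 \<le> X i \<omega>" using i by (subst (asm) AE_distr_iff) auto
  qed simp
  have le: "prob (X i -` {..z} \<inter> space M) = 1 - measure \<mu> {z<..}" if i: "i < n" for i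
  proof -
    have "X i -` {..z} \<inter> space M = space M - (X i -` {z<..} \<inter> space M)" by auto
    then have "prob (X i -` {..z} \<inter> space M) = 1 - prob (X i -` {z<..} \<inter> space M)"
      using measurable_sets[OF rv[OF i], of "{z<..}"] by (simp add: prob_compl)
    then show ?thesis using law[OF i] rv[OF i] by (auto simp: measure_distr)
  qed
  have "prob {\<omega> \<in> space M. \<not> (\<Sum>i<n. X i \<omega>) > z} \<le> prob (\<Inter>i\<in>{..<n}. X i -` {..z} \<inter> space M)"
  proof (rule finite_measure_mono_AE)
    show "AE \<omega> in M. \<omega> \<in> {\<omega> \<in> space M. \<not> (\<Sum>i<n. X i \<omega>) > z} \<longrightarrow> \<omega> \<in> (\<Inter>i\<in>{..<n}. X i -` {..z} \<inter> space M)"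
      using nn
    proof eventually_elim
      case (elim \<omega>)
      have "X i \<omega> \<le> (\<Sum>i<n. X i \<omega>)" if "i < n" for i
        using elim that by (intro member_le_sum) auto
      then show ?case by force
    qed
    show "(\<Inter>i\<in>{..<n}. X i -` {..z} \<inter> space M) \<in> events"
      using False by (intro sets.finite_INT) (auto intro!: measurable_sets[OF rv])
  qed
  also have "\<dots> = (\<Prod>i<n. prob (X i -` {..z} \<inter> space M))"
    using False by (intro indep_varsD[OF ind]) auto
  also have "\<dots> = (1 - measure \<mu> {z<..}) ^ n" using le by simp
  finally have "prob {\<omega> \<in> space M. \<not> (\<Sum>i<n. X i \<omega>) > z} \<le> (1 - measure \<mu> {z<..}) ^ n" .
  moreover have "prob {\<omega> \<in> space M. \<not> (\<Sum>i<n. X i \<omega>) > z} = 1 - prob {\<omega> \<in> space M. (\<Sum>i<n. X i \<omega>) > z}"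
    by (intro prob_neg) measurable
  ultimately show ?thesis by simp
qed simp

end

section \<open>Characteristic functions of normalised Pareto sums\<close>

definition pareto :: "real \<Rightarrow> real measure" where
  "pareto \<alpha> = density lborel (\<lambda>x. ennreal (indicator {1..} x * (\<alpha> * x powr (-\<alpha>-1))))"

lemma pareto_emeasure_atLeast:
  assumes "0 < \<alpha>" "1 \<le> z"
  shows "emeasure (pareto \<alpha>) {z..} = ennreal (z powr (-\<alpha>))"
proof -
  have "emeasure (pareto \<alpha>) {z..} = (\<integral>\<^sup>+x. ennreal (indicator {1..} x * (\<alpha> * x powr (-\<alpha>-1))) * indicator {z..} x \<partial>lborel)"
    unfolding pareto_def by (subst emeasure_density) auto
  also have "\<dots> = (\<integral>\<^sup>+x. ennreal (\<alpha> * x powr (-\<alpha>-1)) * indicator {z..} x \<partial>lborel)"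
    using assms by (intro nn_integral_cong) (auto simp: indicator_def)
  also have "\<dots> = ennreal (0 - (- (z powr (-\<alpha>))))"
  proof (rule nn_integral_FTC_atLeast)
    fix x assume "z \<le> x"
    then show "((\<lambda>x. - (x powr (-\<alpha>))) has_real_derivative \<alpha> * x powr (-\<alpha>-1)) (at x)"
      using assms by (auto intro!: derivative_eq_intros)
    show "0 \<le> \<alpha> * x powr (- \<alpha> - 1)" using assms by simp
  next
    have "((\<lambda>x::real. - (x powr (-\<alpha>))) \<longlongrightarrow> - 0) at_top"
      using assms by (intro tendsto_minus tendsto_neg_powr filterlim_ident) auto
    then show "((\<lambda>x::real. - (x powr (-\<alpha>))) \<longlongrightarrow> 0) at_top" by simp
  qed measurable
  finally show ?thesis by simp
qed

lemma real_distribution_pareto: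
  assumes "0 < \<alpha>"
  shows "real_distribution (pareto \<alpha>)"
proof -
  have "emeasure (pareto \<alpha>) UNIV = (\<integral>\<^sup>+x. ennreal (indicator {1..} x * (\<alpha> * x powr (-\<alpha>-1))) * indicator UNIV x \<partial>lborel)"
    unfolding pareto_def by (subst emeasure_density) auto
  also have "\<dots> = (\<integral>\<^sup>+x. ennreal (indicator {1..} x * (\<alpha> * x powr (-\<alpha>-1))) * indicator {1..} x \<partial>lborel)"
    by (intro nn_integral_cong) (auto simp: indicator_def)
  also have "\<dots> = emeasure (pareto \<alpha>) {1..}"
    unfolding pareto_def by (subst emeasure_density) auto
  finally have "emeasure (pareto \<alpha>) UNIV = 1" using pareto_emeasure_atLeast[OF assms, of 1] by simp
  then show ?thesis
    unfolding real_distribution_def real_distribution_axioms_def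
    by (auto intro!: prob_spaceI simp: pareto_def)
qed

lemma pareto_tail:
  assumes "0 < \<alpha>" "1 \<le> z"
  shows "measure (pareto \<alpha>) {z<..} = z powr (-\<alpha>)"
proof -
  have "emeasure (pareto \<alpha>) {z<..} = (\<integral>\<^sup>+x. ennreal (indicator {1..} x * (\<alpha> * x powr (-\<alpha>-1))) * indicator {z<..} x \<partial>lborel)"
    unfolding pareto_def by (subst emeasure_density) auto
  also have "\<dots> = (\<integral>\<^sup>+x. ennreal (indicator {1..} x * (\<alpha> * x powr (-\<alpha>-1))) * indicator {z..} x \<partial>lborel)"
    using AE_lborel_singleton[of z] by (intro nn_integral_cong_AE) (auto elim!: eventually_mono simp: indicator_def)
  also have "\<dots> = emeasure (pareto \<alpha>) {z..}"
    unfolding pareto_def by (subst emeasure_density) auto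
  finally show ?thesis using pareto_emeasure_atLeast[OF assms] by (simp add: measure_def)
qed

lemma pareto_nonneg: "AE x in pareto \<alpha>. 0 \<le> x"
  unfolding pareto_def by (subst AE_density) (auto simp: indicator_def)

text \<open>
  The Levy-Khintchine exponent without drift for the Levy measure with density \<open>\<alpha> y\<^sup>-\<^sup>\<alpha>\<^sup>-\<^sup>1\<close> on the
  positive half-line, which gives mass \<open>x\<^sup>-\<^sup>\<alpha>\<close> to \<open>(x,\<infinity>)\<close>.
\<close>

definition stable_exponent :: "real \<Rightarrow> real \<Rightarrow> complex" where
  "stable_exponent \<alpha> \<theta> = (CLINT y|lborel. (indicator {0<..} y * (\<alpha> * y powr (-\<alpha>-1))) *\<^sub>R (iexp (\<theta> * y) - 1))"

lemma cmod_iexp_minus_1: "cmod (iexp x - 1) \<le> min 2 \<bar>x\<bar>"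
  using iexp_approx1[of x 0] iexp_approx2[of x 0] by simp

text \<open>
  Near \<open>0\<close> the integrand is of order \<open>y\<^sup>-\<^sup>\<alpha>\<close>, integrable since \<open>\<alpha> < 1\<close>; near infinity it is of order
  \<open>y\<^sup>-\<^sup>\<alpha>\<^sup>-\<^sup>1\<close>, integrable since \<open>\<alpha> > 0\<close>.
\<close>

lemma integrable_stable_majorant:
  fixes \<alpha> \<theta> :: real
  assumes "0 < \<alpha>" "\<alpha> < 1"
  shows "integrable lborel (\<lambda>y. indicator {0<..} y * (\<alpha> * y powr (-\<alpha>-1)) * min 2 \<bar>\<theta> * y\<bar>)"
proof -
  define f where "f y = indicator {0..1} y * (\<bar>\<theta>\<bar> * \<alpha> * y powr (-\<alpha>)) + indicator {1..} y * (2 * \<alpha> * y powr (-\<alpha>-1))" for y :: real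
  have "set_integrable lborel {0..1} (\<lambda>y::real. y powr (-\<alpha>))"
  proof -
    have "(\<lambda>y::real. y powr (-\<alpha>)) absolutely_integrable_on {0..1}"
      using assms by (intro nonnegative_absolutely_integrable_1 integrable_on_powr_from_0) auto
    then show ?thesis unfolding set_integrable_def
      by (subst (asm) integrable_completion) auto
  qed
  moreover have "set_integrable lborel {1..} (\<lambda>y::real. y powr (-\<alpha>-1))"
  proof -
    have "((\<lambda>y::real. y powr (-\<alpha>-1)) has_integral -(1 powr (-\<alpha>-1+1)) / (-\<alpha>-1+1)) {1..}"
      using assms by (intro has_integral_powr_to_inf) auto
    then have "(\<lambda>y::real. y powr (-\<alpha>-1)) absolutely_integrable_on {1..}"
      by (intro nonnegative_absolutely_integrable_1) (auto simp: integrable_on_def)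
    then show ?thesis unfolding set_integrable_def
      by (subst (asm) integrable_completion) auto
  qed
  ultimately have "integrable lborel (\<lambda>y. (\<bar>\<theta>\<bar> * \<alpha>) * (indicator {0..1} y * y powr (-\<alpha>)) + (2 * \<alpha>) * (indicator {1..} y * y powr (-\<alpha>-1)))"
    unfolding set_integrable_def by (intro Bochner_Integration.integrable_add integrable_mult_right) auto
  then have f: "integrable lborel f" unfolding f_def by (simp add: mult_ac)
  show ?thesis
  proof (rule Bochner_Integration.integrable_bound[OF f])
    show "AE y in lborel. norm (indicator {0<..} y * (\<alpha> * y powr (-\<alpha>-1)) * min 2 \<bar>\<theta> * y\<bar>) \<le> norm (f y)"
    proof (rule AE_I2)
      fix y :: real
      show "norm (indicator {0<..} y * (\<alpha> * y powr (-\<alpha>-1)) * min 2 \<bar>\<theta> * y\<bar>) \<le> norm (f y)"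
      proof (cases "y > 0")
        case False then show ?thesis by simp
      next
        case y: True
        have f0: "f y \<ge> 0" using assms by (simp add: f_def)
        have nn: "\<alpha> * y powr (-\<alpha>-1) \<ge> 0" using assms by simp
        show ?thesis
        proof (cases "y \<le> 1")
          case True
          have "(\<alpha> * y powr (-\<alpha>-1)) * min 2 \<bar>\<theta> * y\<bar> \<le> (\<alpha> * y powr (-\<alpha>-1)) * \<bar>\<theta> * y\<bar>"
            using nn by (intro mult_left_mono) auto
          also have "\<dots> = \<bar>\<theta>\<bar> * \<alpha> * (y powr (-\<alpha>-1) * y powr 1)" using y by (simp add: abs_mult)
          also have "\<dots> = \<bar>\<theta>\<bar> * \<alpha> * y powr (-\<alpha>)" by (simp only: powr_add[symmetric]) simp
          also have "\<dots> \<le> f y" using True y assms by (auto simp: f_def indicator_def)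
          finally show ?thesis using f0 nn y assms by (simp add: abs_mult)
        next
          case False
          have "(\<alpha> * y powr (-\<alpha>-1)) * min 2 \<bar>\<theta> * y\<bar> \<le> (\<alpha> * y powr (-\<alpha>-1)) * 2"
            using nn by (intro mult_left_mono) auto
          also have "\<dots> = f y" using False by (simp add: f_def)
          finally show ?thesis using f0 nn y assms by (simp add: abs_mult)
        qed
      qed
    qed
  qed measurable
qed

lemma integrable_stable_exponent:
  assumes "0 < \<alpha>" "\<alpha> < 1"
  shows "complex_integrable lborel (\<lambda>y. (indicator {0<..} y * (\<alpha> * y powr (-\<alpha>-1))) *\<^sub>R (iexp (\<theta> * y) - 1))"
proof (rule Bochner_Integration.integrable_bound[OF integrable_stable_majorant[OF assms, of \<theta>]])
  show "AE y in lborel. norm ((indicator {0<..} y * (\<alpha> * y powr (-\<alpha>-1))) *\<^sub>R (iexp (\<theta> * y) - 1)) \<le>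
    norm (indicator {0<..} y * (\<alpha> * y powr (-\<alpha>-1)) * min 2 \<bar>\<theta> * y\<bar>)"
  proof (rule AE_I2)
    fix y :: real
    show "norm ((indicator {0<..} y * (\<alpha> * y powr (-\<alpha>-1))) *\<^sub>R (iexp (\<theta> * y) - 1)) \<le>
      norm (indicator {0<..} y * (\<alpha> * y powr (-\<alpha>-1)) * min 2 \<bar>\<theta> * y\<bar>)"
      unfolding norm_scaleR real_norm_def abs_mult[of _ "min 2 \<bar>\<theta> * y\<bar>"]
      using cmod_iexp_minus_1[of "\<theta> * y"] by (intro mult_left_mono) auto
  qed
qed measurable

text \<open>
  Substitution of \<open>y / k\<close> with \<open>k = c\<^sup>1\<^sup>/\<^sup>\<alpha>\<close>: the Levy measure is homogeneous of degree \<open>-\<alpha>\<close>.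
\<close>

lemma stable_exponent_scale:
  assumes "0 < \<alpha>" "\<alpha> < 1" "0 < c"
  shows "stable_exponent \<alpha> (c powr (1 / \<alpha>) * \<theta>) = of_real c * stable_exponent \<alpha> \<theta>"
proof -
  define k where "k = c powr (1 / \<alpha>)"
  have k: "k > 0" using assms by (simp add: k_def)
  have ka: "k powr \<alpha> = c" unfolding k_def using assms by (simp add: powr_powr)
  let ?g = "\<lambda>\<theta> y. (indicator {0<..} y * (\<alpha> * y powr (-\<alpha>-1))) *\<^sub>R (iexp (\<theta> * y) - 1)"
  have "stable_exponent \<alpha> (k * \<theta>) = \<bar>1/k\<bar> *\<^sub>R (CLINT y|lborel. ?g (k * \<theta>) (0 + (1/k) * y))"
    unfolding stable_exponent_def using k by (intro lborel_integral_real_affine) auto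
  also have "(\<lambda>y. ?g (k * \<theta>) (0 + (1/k) * y)) = (\<lambda>y. (k powr (\<alpha>+1)) *\<^sub>R ?g \<theta> y)"
  proof
    fix y :: real
    show "?g (k * \<theta>) (0 + (1/k) * y) = (k powr (\<alpha>+1)) *\<^sub>R ?g \<theta> y"
    proof (cases "y > 0")
      case True
      have "((1/k) * y) powr (-\<alpha>-1) = (1/k) powr (-\<alpha>-1) * y powr (-\<alpha>-1)"
        by (rule powr_mult)
      also have "(1/k) powr (-\<alpha>-1) = k powr (\<alpha>+1)"
        using k by (simp add: powr_divide powr_minus_divide[symmetric] add.commute)
      finally have "((1/k) * y) powr (-\<alpha>-1) = k powr (\<alpha>+1) * y powr (-\<alpha>-1)" .
      moreover have "k * \<theta> * (1 / k * y) = \<theta> * y" using k by simp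
      ultimately show ?thesis using True k by simp
    next
      case False
      then have "\<not> 0 < (1/k) * y" using k by (simp add: zero_less_divide_iff)
      then show ?thesis using False by simp
    qed
  qed
  also have "\<bar>1/k\<bar> *\<^sub>R (CLINT y|lborel. (k powr (\<alpha>+1)) *\<^sub>R ?g \<theta> y) = ((1/k) * k powr (\<alpha>+1)) *\<^sub>R stable_exponent \<alpha> \<theta>"
    unfolding stable_exponent_def by (subst integral_scaleR_right) (use k in simp)
  also have "(1/k) * k powr (\<alpha>+1) = c" using k ka by (simp add: powr_add)
  finally show ?thesis unfolding k_def by (simp add: scaleR_conv_of_real)
qed

lemma stable_exponent_Re_le:
  assumes "0 < \<alpha>" "\<alpha> < 1"
  shows "Re (stable_exponent \<alpha> \<theta>) \<le> 0"
proof -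
  let ?g = "\<lambda>y. (indicator {0<..} y * (\<alpha> * y powr (-\<alpha>-1))) *\<^sub>R (iexp (\<theta> * y) - 1)"
  have "Re (stable_exponent \<alpha> \<theta>) = (\<integral>y. Re (?g y) \<partial>lborel)"
    unfolding stable_exponent_def using integral_Re[OF integrable_stable_exponent[OF assms, of \<theta>]] by simp
  also have "\<dots> \<le> (\<integral>(y::real). 0 \<partial>lborel)"
  proof (rule integral_mono)
    show "integrable lborel (\<lambda>y. Re (?g y))" using integrable_Re[OF integrable_stable_exponent[OF assms, of \<theta>]] .
    fix y :: real
    have "Re (iexp (\<theta> * y)) \<le> cmod (iexp (\<theta> * y))" by (rule complex_Re_le_cmod)
    then have "Re (iexp (\<theta> * y) - 1) \<le> 0" by simp
    moreover have "indicator {0<..} y * (\<alpha> * y powr (-\<alpha>-1)) \<ge> 0" using assms by simp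
    ultimately show "Re (?g y) \<le> 0" by (simp only: scaleR_complex.sel mult_nonneg_nonpos)
  qed simp
  finally show ?thesis by simp
qed

text \<open>
  The Pareto density is the density of the Levy measure cut off at \<open>1\<close>; rescaling by \<open>n\<^sup>1\<^sup>/\<^sup>\<alpha>\<close> moves the
  cut-off to \<open>n\<^sup>-\<^sup>1\<^sup>/\<^sup>\<alpha>\<close> and produces exactly the factor \<open>n\<close>.
\<close>

lemma char_pareto_scaled:
  assumes \<alpha>: "0 < \<alpha>" "\<alpha> < 1" and n: "n > (0::nat)"
  shows "of_nat n * (char (pareto \<alpha>) (\<theta> / real n powr (1/\<alpha>)) - 1) =
    (CLINT y|lborel. (indicator {real n powr (-1/\<alpha>)..} y * (\<alpha> * y powr (-\<alpha>-1))) *\<^sub>R (iexp (\<theta> * y) - 1))"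
proof -
  define c where "c = real n powr (1/\<alpha>)"
  have c: "c > 0" using n by (simp add: c_def)
  interpret P: real_distribution "pareto \<alpha>" by (rule real_distribution_pareto[OF \<alpha>(1)])
  let ?f = "\<lambda>x. indicator {1..} x * (\<alpha> * x powr (-\<alpha>-1))"
  have "char (pareto \<alpha>) (\<theta> / c) - 1 = (CLINT x|pareto \<alpha>. iexp (\<theta> / c * x) - 1)"
  proof -
    have "complex_integrable (pareto \<alpha>) (\<lambda>x. iexp (\<theta> / c * x))"
      by (rule P.integrable_const_bound[where B=1], rule AE_I2)
        (simp_all only: norm_exp_i_times order_refl, measurable)
    then show ?thesis unfolding char_def using P.prob_space
      by (subst Bochner_Integration.integral_diff) auto
  qed
  also have "\<dots> = (CLINT x|lborel. ?f x *\<^sub>R (iexp (\<theta> / c * x) - 1))"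
    unfolding pareto_def using \<alpha> by (subst integral_density) auto
  also have "\<dots> = \<bar>c\<bar> *\<^sub>R (CLINT y|lborel. ?f (0 + c * y) *\<^sub>R (iexp (\<theta> / c * (0 + c * y)) - 1))"
    using c by (intro lborel_integral_real_affine) auto
  also have "(\<lambda>y. ?f (0 + c * y) *\<^sub>R (iexp (\<theta> / c * (0 + c * y)) - 1)) =
     (\<lambda>y. (c powr (-\<alpha>-1)) *\<^sub>R ((indicator {real n powr (-1/\<alpha>)..} y * (\<alpha> * y powr (-\<alpha>-1))) *\<^sub>R (iexp (\<theta> * y) - 1)))"
  proof
    fix y :: real
    have ic: "1 / c = real n powr (-1/\<alpha>)" unfolding c_def by (simp add: powr_minus_divide)
    have iff: "1 \<le> c * y \<longleftrightarrow> real n powr (-1/\<alpha>) \<le> y" unfolding ic[symmetric] using c by (simp add: field_simps)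
    show "?f (0 + c * y) *\<^sub>R (iexp (\<theta> / c * (0 + c * y)) - 1) =
      (c powr (-\<alpha>-1)) *\<^sub>R ((indicator {real n powr (-1/\<alpha>)..} y * (\<alpha> * y powr (-\<alpha>-1))) *\<^sub>R (iexp (\<theta> * y) - 1))"
    proof (cases "1 \<le> c * y")
      case True
      then have y: "y > 0" using c by (smt (verit) mult_nonneg_nonpos)
      have "(c * y) powr (-\<alpha>-1) = c powr (-\<alpha>-1) * y powr (-\<alpha>-1)" by (rule powr_mult)
      moreover have "\<theta> / c * (c * y) = \<theta> * y" using c by simp
      ultimately show ?thesis using True iff by (simp add: mult_ac)
    qed (use iff in auto)
  qed
  also have "\<bar>c\<bar> *\<^sub>R (CLINT y|lborel. (c powr (-\<alpha>-1)) *\<^sub>R ((indicator {real n powr (-1/\<alpha>)..} y * (\<alpha> * y powr (-\<alpha>-1))) *\<^sub>R (iexp (\<theta> * y) - 1)))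
     = (c * c powr (-\<alpha>-1)) *\<^sub>R (CLINT y|lborel. (indicator {real n powr (-1/\<alpha>)..} y * (\<alpha> * y powr (-\<alpha>-1))) *\<^sub>R (iexp (\<theta> * y) - 1))"
    by (subst integral_scaleR_right) (use c in simp)
  also have "c * c powr (-\<alpha>-1) = 1 / real n"
  proof -
    have "c * c powr (-\<alpha>-1) = c powr 1 * c powr (-\<alpha>-1)" using c by simp
    also have "\<dots> = c powr (-\<alpha>)" by (simp only: powr_add[symmetric]) simp
    also have "\<dots> = real n powr (-1)" unfolding c_def using \<alpha> by (simp add: powr_powr)
    finally show ?thesis using n by (simp add: powr_minus_divide)
  qed
  finally show ?thesis unfolding c_def[symmetric] using n by (simp add: scaleR_conv_of_real)
qed

lemma char_pareto_limit:
  assumes \<alpha>: "0 < \<alpha>" "\<alpha> < 1"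
  shows "(\<lambda>n. of_nat n * (char (pareto \<alpha>) (\<theta> / real n powr (1/\<alpha>)) - 1)) \<longlonglongrightarrow> stable_exponent \<alpha> \<theta>"
proof -
  let ?h = "\<lambda>n y. (indicator {real n powr (-1/\<alpha>)..} y * (\<alpha> * y powr (-\<alpha>-1))) *\<^sub>R (iexp (\<theta> * y) - 1)"
  have "(\<lambda>n. CLINT y|lborel. ?h n y) \<longlonglongrightarrow>
    (CLINT y|lborel. (indicator {0<..} y * (\<alpha> * y powr (-\<alpha>-1))) *\<^sub>R (iexp (\<theta> * y) - 1))"
  proof (rule integral_dominated_convergence[OF _ _ integrable_stable_majorant[OF \<alpha>, of \<theta>]])
    have lim0: "(\<lambda>n. real n powr (-1/\<alpha>)) \<longlonglongrightarrow> 0"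
      using \<alpha> by (intro tendsto_neg_powr filterlim_real_sequentially) (auto simp: divide_neg_pos)
    show "AE y in lborel. (\<lambda>n. ?h n y) \<longlonglongrightarrow> (indicator {0<..} y * (\<alpha> * y powr (-\<alpha>-1))) *\<^sub>R (iexp (\<theta> * y) - 1)"
    proof (rule AE_mp[OF AE_lborel_singleton[of 0]], rule AE_I2, intro impI)
      fix y :: real assume y0: "y \<noteq> 0"
      have "\<forall>\<^sub>F n in sequentially. ?h n y = (indicator {0<..} y * (\<alpha> * y powr (-\<alpha>-1))) *\<^sub>R (iexp (\<theta> * y) - 1)"
      proof (cases "y > 0")
        case True
        then have "\<forall>\<^sub>F n in sequentially. real n powr (-1/\<alpha>) < y" using order_tendstoD(2)[OF lim0] by blast
        then show ?thesis by eventually_elim (use True in auto)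
      next
        case False
        then have "\<not> real n powr (-1/\<alpha>) \<le> y" for n using y0 powr_ge_zero[of "real n" "-1/\<alpha>"] by linarith
        then show ?thesis using False by simp
      qed
      then show "(\<lambda>n. ?h n y) \<longlonglongrightarrow> (indicator {0<..} y * (\<alpha> * y powr (-\<alpha>-1))) *\<^sub>R (iexp (\<theta> * y) - 1)"
        by (rule tendsto_eventually)
    qed
    fix n
    show "AE y in lborel. norm (?h n y) \<le> indicator {0<..} y * (\<alpha> * y powr (-\<alpha>-1)) * min 2 \<bar>\<theta> * y\<bar>"
    proof (rule AE_mp[OF AE_lborel_singleton[of 0]], rule AE_I2, intro impI)
      fix y :: real assume y0: "y \<noteq> 0"
      have "indicator {real n powr (-1/\<alpha>)..} y \<le> (indicator {0<..} y :: real)"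
      proof (cases "real n powr (-1/\<alpha>) \<le> y")
        case True
        then have "0 < y" using y0 powr_ge_zero[of "real n" "-1/\<alpha>"] by linarith
        then show ?thesis by simp
      qed simp
      then have "norm (?h n y) \<le> indicator {0<..} y * (\<alpha> * y powr (-\<alpha>-1)) * norm (iexp (\<theta> * y) - 1)"
        unfolding norm_scaleR using \<alpha> by (intro mult_right_mono) (auto simp: indicator_def)
      also have "\<dots> \<le> indicator {0<..} y * (\<alpha> * y powr (-\<alpha>-1)) * min 2 \<bar>\<theta> * y\<bar>"
        using cmod_iexp_minus_1[of "\<theta> * y"] \<alpha> by (intro mult_left_mono) auto
      finally show "norm (?h n y) \<le> indicator {0<..} y * (\<alpha> * y powr (-\<alpha>-1)) * min 2 \<bar>\<theta> * y\<bar>" .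
    qed
  qed measurable
  moreover have "\<forall>\<^sub>F n in sequentially. (CLINT y|lborel. ?h n y) = of_nat n * (char (pareto \<alpha>) (\<theta> / real n powr (1/\<alpha>)) - 1)"
    using eventually_gt_at_top[of 0] by eventually_elim (simp add: char_pareto_scaled[OF \<alpha>])
  ultimately show ?thesis unfolding stable_exponent_def by (rule Lim_transform_eventually)
qed

text \<open>
  Both \<open>z n\<close> and \<open>exp (w / n)\<close> lie in the unit disc, where \<open>n\<close>-th powers differ by at most \<open>n\<close> times
  the difference of the bases.
\<close>

lemma power_tendsto_exp:
  fixes z :: "nat \<Rightarrow> complex" and w :: complex
  assumes lim: "(\<lambda>n. of_nat n * (z n - 1)) \<longlonglongrightarrow> w" and z: "\<And>n. cmod (z n) \<le> 1" and w: "Re w \<le> 0"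
  shows "(\<lambda>n. z n ^ n) \<longlonglongrightarrow> exp w"
proof -
  let ?e = "\<lambda>n::nat. exp (w / of_nat n)"
  have "(\<lambda>n. of_nat n * (?e n - 1)) \<longlonglongrightarrow> w"
  proof -
    have "((\<lambda>h. (exp (w * h) - 1) / h) \<longlongrightarrow> w) (at 0)"
    proof -
      have "((\<lambda>h::complex. exp (w * h)) has_field_derivative w) (at 0)"
        by (auto intro!: derivative_eq_intros)
      then show ?thesis by (simp add: has_field_derivative_iff)
    qed
    moreover have "filterlim (\<lambda>n. inverse (of_nat n) :: complex) (at 0) sequentially"
      unfolding filterlim_at using eventually_gt_at_top[of 0] lim_inverse_n
      by (auto elim!: eventually_mono)
    ultimately have "(\<lambda>n. (exp (w * inverse (of_nat n)) - 1) / inverse (of_nat n)) \<longlonglongrightarrow> w"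
      by (rule filterlim_compose)
    then show ?thesis by (simp add: field_simps)
  qed
  then have "(\<lambda>n. of_nat n * (z n - 1) - of_nat n * (?e n - 1)) \<longlonglongrightarrow> w - w" by (intro tendsto_diff lim)
  then have d: "(\<lambda>n. cmod (of_nat n * (z n - ?e n))) \<longlonglongrightarrow> 0"
    by (auto simp: algebra_simps intro: tendsto_norm_zero)
  have "(\<lambda>n. z n ^ n - ?e n ^ n) \<longlonglongrightarrow> 0"
  proof (rule Lim_null_comparison[OF _ d], rule always_eventually, rule allI)
    fix n
    have "cmod (?e n) \<le> 1" using w by (simp add: divide_nonpos_nonneg Re_divide_of_nat)
    then have "cmod (z n ^ n - ?e n ^ n) \<le> real n * cmod (z n - ?e n)"
      using z by (intro norm_power_diff) auto
    then show "cmod (z n ^ n - ?e n ^ n) \<le> cmod (of_nat n * (z n - ?e n))" by (simp add: norm_mult)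
  qed
  moreover have "(\<lambda>n. ?e n ^ n) \<longlonglongrightarrow> exp w"
  proof (rule tendsto_eventually)
    show "\<forall>\<^sub>F n in sequentially. ?e n ^ n = exp w"
      using eventually_gt_at_top[of 0] by eventually_elim (simp add: exp_of_nat_mult[symmetric])
  qed
  ultimately have "(\<lambda>n. (z n ^ n - ?e n ^ n) + ?e n ^ n) \<longlonglongrightarrow> 0 + exp w" by (rule tendsto_add)
  then show ?thesis by simp
qed

section \<open>The positive stable law\<close>

lemma indep_vars_PiM_coordinates:
  fixes M :: "'i \<Rightarrow> 'b :: topological_space measure"
  assumes M: "\<And>i. i \<in> I \<Longrightarrow> prob_space (M i)" "\<And>i. i \<in> I \<Longrightarrow> sets (M i) = sets borel" and I: "I \<noteq> {}"
  shows "prob_space.indep_vars (PiM I M) (\<lambda>_. borel) (\<lambda>i x. x i) I"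
    and "\<And>i. i \<in> I \<Longrightarrow> distr (PiM I M) borel (\<lambda>x. x i) = M i"
proof -
  interpret prob_space "PiM I M" using M by (intro prob_space_PiM) auto
  have comp: "distr (PiM I M) borel (\<lambda>x. x i) = M i" if i: "i \<in> I" for i
  proof -
    have "distr (PiM I M) borel (\<lambda>x. x i) = distr (PiM I M) (M i) (\<lambda>x. x i)"
      using M(2)[OF i] by (intro distr_cong) auto
    then show ?thesis using distr_PiM_component[of I M i] M i by simp
  qed
  then show "\<And>i. i \<in> I \<Longrightarrow> distr (PiM I M) borel (\<lambda>x. x i) = M i" .
  have meas: "(\<lambda>x. x i) \<in> borel_measurable (PiM I M)" if "i \<in> I" for i
    using measurable_component_singleton[OF that, of M] M(2)[OF that] by (simp cong: measurable_cong_sets)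
  have "distr (PiM I M) (PiM I (\<lambda>_. borel)) (\<lambda>x. \<lambda>i\<in>I. x i) = distr (PiM I M) (PiM I M) (\<lambda>x. x)"
    using M(2) by (intro distr_cong sets_PiM_cong refl) (auto simp: space_PiM PiE_def extensional_restrict)
  also have "\<dots> = PiM I M" by (rule distr_id)
  also have "\<dots> = PiM I (\<lambda>i. distr (PiM I M) borel (\<lambda>x. x i))" using comp by (intro PiM_cong) auto
  finally show "indep_vars (\<lambda>_. borel) (\<lambda>i x. x i) I"
    using I meas by (subst indep_vars_iff_distr_eq_PiM') auto
qed

lemma filterlim_powr_at_top:
  fixes p :: real
  assumes "p > 0"
  shows "filterlim (\<lambda>x. x powr p) at_top at_top"
  unfolding filterlim_at_top
proof
  fix Z :: real
  show "\<forall>\<^sub>F x in at_top. Z \<le> x powr p"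
    using eventually_ge_at_top[of "max Z 1 powr (1/p)"]
  proof eventually_elim
    case (elim x)
    then have "(max Z 1 powr (1/p)) powr p \<le> x powr p" using assms by (intro powr_mono2) auto
    then show ?case using assms by (simp add: powr_powr)
  qed
qed

lemma char_distr_mult:
  assumes "f \<in> borel_measurable M"
  shows "char (distr M borel (\<lambda>\<omega>. c * f \<omega>)) t = char (distr M borel f) (t * c)"
  unfolding char_def using assms by (subst (1 2) integral_distr) (auto simp: mult_ac)

lemma (in real_distribution) finite_atoms_ge:
  assumes "p > 0"
  shows "finite {x. p \<le> prob {x}}"
proof (rule ccontr)
  assume inf: "infinite {x. p \<le> prob {x}}"
  obtain n :: nat where n: "1 < real n * p" using ex_less_of_nat_mult[OF assms] by blast
  obtain B where B: "finite B" "card B = n" "B \<subseteq> {x. p \<le> prob {x}}"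
    using infinite_arbitrarily_large[OF inf] by blast
  have "real n * p \<le> (\<Sum>x\<in>B. prob {x})" using B sum_bounded_below[of B p "\<lambda>x. prob {x}"] by auto
  also have "\<dots> = prob B" using B by (intro finite_measure_eq_sum_singleton[symmetric]) auto
  also have "\<dots> \<le> 1" by simp
  finally show False using n by simp
qed

text \<open>
  Let \<open>p\<close> be the largest mass of an atom, attained at \<open>a\<close>. The convolution has the atom \<open>k a\<close> of the
  same mass, and \<open>p = \<integral> M {k a - u} dM(u)\<close> with an integrand at most \<open>p\<close> forces \<open>M {k a - u} = p\<close> for
  almost every \<open>u\<close>. Only finitely many points carry mass \<open>p\<close>, so \<open>M\<close> would have bounded support.
\<close>

lemma no_atoms_of_self_convolution:
  fixes M :: "real measure"
  assumes "real_distribution M" and conv: "M \<star> M = distr M borel (\<lambda>x. k * x)" and k: "k \<noteq> 0"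
    and unbounded: "\<And>b. measure M {b<..} > 0"
  shows "measure M {x} = 0"
proof (rule ccontr)
  interpret real_distribution M by fact
  assume "prob {x} \<noteq> 0"
  then have pos: "prob {x} > 0" by (simp add: less_le)
  let ?A = "{u. prob {x} \<le> prob {u}}"
  have A: "finite ?A" "x \<in> ?A" using finite_atoms_ge[OF pos] by auto
  define p where "p = Max ((\<lambda>u. prob {u}) ` ?A)"
  have "p \<in> (\<lambda>u. prob {u}) ` ?A" unfolding p_def using A by (intro Max_in) auto
  then obtain a where a: "p = prob {a}" by blast
  have p_pos: "p > 0" using pos A unfolding p_def by (subst Max_gr_iff) auto
  have le: "prob {u} \<le> p" for u
  proof (cases "u \<in> ?A")
    case True then show ?thesis unfolding p_def using A by (intro Max_ge) auto
  next
    case False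
    moreover have "prob {x} \<le> p" unfolding p_def using A by (intro Max_ge) auto
    ultimately show ?thesis by simp
  qed
  have [measurable]: "(\<lambda>u. prob {k * a - u}) \<in> borel_measurable M"
  proof -
    have "(\<lambda>u. emeasure M (Pair u -` {q \<in> space (M \<Otimes>\<^sub>M M). snd q = k * a - fst q})) \<in> borel_measurable M"
      by (intro measurable_emeasure_Pair) measurable
    also have "(\<lambda>u. emeasure M (Pair u -` {q \<in> space (M \<Otimes>\<^sub>M M). snd q = k * a - fst q})) = (\<lambda>u. emeasure M {k * a - u})"
      by (intro ext arg_cong[where f="emeasure M"]) (auto simp: space_pair_measure)
    finally show ?thesis by (simp add: measure_def)
  qed
  have "emeasure (M \<star> M) {k * a} = emeasure M {a}"
  proof -
    have "(\<lambda>x. k * x) -` {k * a} \<inter> space M = {a}" using k by auto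
    then show ?thesis unfolding conv by (subst emeasure_distr) auto
  qed
  moreover have "emeasure (M \<star> M) {k * a} = (\<integral>\<^sup>+u. emeasure M {b. b + u \<in> {k * a}} \<partial>M)"
    by (rule convolution_emeasure) (auto simp: finite_measure_axioms)
  moreover have "{b. b + u \<in> {k * a}} = {k * a - u}" for u by auto
  ultimately have "(\<integral>\<^sup>+u. emeasure M {k * a - u} \<partial>M) = p"
    using a by (simp add: emeasure_eq_measure)
  then have "(\<integral>\<^sup>+u. ennreal (prob {k * a - u}) \<partial>M) = p" by (simp add: emeasure_eq_measure)
  then have int: "(\<integral>u. prob {k * a - u} \<partial>M) = p"
    using p_pos by (simp add: integral_eq_nn_integral)
  have i: "integrable M (\<lambda>u. prob {k * a - u})" by (rule integrable_const_bound[of _ 1]) auto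
  have "(\<integral>u. p - prob {k * a - u} \<partial>M) = 0"
    using i int prob_space by (subst Bochner_Integration.integral_diff) auto
  then have "AE u in M. p - prob {k * a - u} = 0"
    using i le by (subst (asm) integral_nonneg_eq_0_iff_AE) auto
  define B where "B = (\<lambda>u. k * a - u) ` {u. p \<le> prob {u}}"
  define b where "b = Max (insert 0 B)"
  have "finite B" unfolding B_def using finite_atoms_ge[OF p_pos] by simp
  then have b: "v \<le> b" if "v \<in> B" for v unfolding b_def using that by (intro Max_ge) auto
  have "AE u in M. u \<le> b"
    using \<open>AE u in M. p - prob {k * a - u} = 0\<close>
  proof eventually_elim
    case (elim u)
    have "u \<in> B" unfolding B_def using elim by (intro image_eqI[of _ _ "k * a - u"]) auto
    then show ?case by (rule b)
  qed
  then have "AE u in M. u \<notin> {b<..}" by eventually_elim auto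
  then have "prob {b<..} = 0" by (subst (asm) AE_iff_measurable[of "{b<..}"]) (auto simp: measure_def)
  then show False using unbounded[of b] by simp
qed

text \<open>
  The law is a subsequential limit of sums of Pareto variables divided by \<open>n\<^sup>1\<^sup>/\<^sup>\<alpha>\<close>. The tail bounds
  hold for the sums with constants that do not depend on \<open>n\<close>; they give tightness and pass to the
  limit. They hold a priori only at continuity points, which suffices to see that the limit has
  unbounded support and hence, by its stability, no atoms.
\<close>

theorem stable_law_exists:
  fixes \<alpha> :: real
  assumes \<alpha>: "0 < \<alpha>" "\<alpha> < 1"
  shows "\<exists>\<mu>. real_distribution \<mu> \<and> (AE x in \<mu>. 0 \<le> x) \<and> (\<forall>\<theta>. char \<mu> \<theta> = exp (stable_exponent \<alpha> \<theta>)) \<and>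
    (\<forall>x. measure \<mu> {x} = 0) \<and> ((\<lambda>x. x powr \<alpha> * measure \<mu> {x<..}) \<longlongrightarrow> 1) at_top"
proof -
  define \<Omega> where "\<Omega> = PiM UNIV (\<lambda>_::nat. pareto \<alpha>)"
  interpret P: real_distribution "pareto \<alpha>" by (rule real_distribution_pareto[OF \<alpha>(1)])
  interpret \<Omega>: prob_space \<Omega> unfolding \<Omega>_def by (intro prob_space_PiM P.prob_space_axioms)
  have ind: "\<Omega>.indep_vars (\<lambda>_. borel) (\<lambda>i \<omega>. \<omega> i) UNIV"
    and law: "\<And>i. distr \<Omega> borel (\<lambda>\<omega>. \<omega> i) = pareto \<alpha>"
    unfolding \<Omega>_def using indep_vars_PiM_coordinates[of UNIV "\<lambda>_. pareto \<alpha>"] P.prob_space_axioms by auto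
  have [measurable]: "(\<lambda>\<omega>. \<omega> i) \<in> borel_measurable \<Omega>" for i
    using ind by (auto simp: \<Omega>.indep_vars_def2)
  define c where "c m = real (Suc m) powr (1/\<alpha>)" for m
  have c: "c m \<ge> 1" for m unfolding c_def using \<alpha> by (intro ge_one_powr_ge_zero) auto
  have c0: "c m > 0" for m using c[of m] by simp
  define S where "S m \<omega> = (\<Sum>i<Suc m. \<omega> i)" for m and \<omega> :: "nat \<Rightarrow> real"
  have [measurable]: "S m \<in> borel_measurable \<Omega>" for m unfolding S_def by measurable
  define \<nu> where "\<nu> m = distr \<Omega> borel (\<lambda>\<omega>. (1 / c m) * S m \<omega>)" for m
  have \<nu>: "real_distribution (\<nu> m)" for m unfolding \<nu>_def by (intro \<Omega>.real_distribution_distr) measurable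
  interpret \<nu>: real_distribution "\<nu> m" for m by (rule \<nu>)
  have char_\<nu>: "char (\<nu> m) \<theta> = char (pareto \<alpha>) (\<theta> / c m) ^ Suc m" for m \<theta>
  proof -
    have "char (distr \<Omega> borel (S m)) t = char (pareto \<alpha>) t ^ Suc m" for t
      unfolding S_def
      by (subst \<Omega>.char_distr_sum) (auto simp: law intro: \<Omega>.indep_vars_subset[OF ind])
    then show ?thesis unfolding \<nu>_def by (subst char_distr_mult) auto
  qed
  have F: "measure (\<nu> m) {x<..} = \<Omega>.prob {\<omega> \<in> space \<Omega>. (\<Sum>i<Suc m. \<omega> i) > c m * x}" for m x
    unfolding \<nu>_def using c0[of m]
    by (subst measure_distr) (auto simp: S_def field_simps intro!: arg_cong[where f="\<Omega>.prob"])
  have ratio: "((\<lambda>z. measure (pareto \<alpha>) {2 * z<..} / measure (pareto \<alpha>) {z<..}) \<longlongrightarrow> 2 powr (-\<alpha>)) at_top"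
  proof (rule tendsto_eventually)
    show "\<forall>\<^sub>F z in at_top. measure (pareto \<alpha>) {2 * z<..} / measure (pareto \<alpha>) {z<..} = 2 powr (-\<alpha>)"
      using eventually_ge_at_top[of 1] by eventually_elim (use \<alpha> in \<open>simp add: pareto_tail powr_mult\<close>)
  qed
  obtain C z0 where C: "C > 0" "\<And>z. z \<ge> z0 \<Longrightarrow> (\<integral>x. min x z \<partial>pareto \<alpha>) \<le> C * (z * measure (pareto \<alpha>) {z<..})"
    using truncated_mean_bound[OF P.real_distribution_axioms pareto_nonneg \<alpha> ratio] by blast
  define z1 where "z1 = max z0 1"
  have Npow: "real (Suc m) * (y * (c m * x)) powr (-\<alpha>) = y powr (-\<alpha>) * x powr (-\<alpha>)" for m x y
  proof -
    have "c m powr (-\<alpha>) = real (Suc m) powr (-1)" unfolding c_def using \<alpha> by (simp add: powr_powr)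
    then have "real (Suc m) * c m powr (-\<alpha>) = 1" by (simp add: powr_minus_divide)
    then show ?thesis by (simp add: powr_mult mult_ac)
  qed
  \<comment> \<open>The bound of \<open>sum_tail_upper\<close> at the level \<open>n\<^sup>1\<^sup>/\<^sup>\<alpha> x\<close>, where it no longer depends on \<open>n\<close>.\<close>
  define U where "U \<delta> \<epsilon> x = (1-\<delta>) powr (-\<alpha>) * x powr (-\<alpha>) + (\<epsilon> powr (-\<alpha>) * x powr (-\<alpha>))\<^sup>2
      + C * (\<epsilon> * \<epsilon> powr (-\<alpha>) * x powr (-\<alpha>)) / \<delta>" for \<delta> \<epsilon> x
  have upper: "measure (\<nu> m) {x<..} \<le> U \<delta> \<epsilon> x"
    if x: "x > 0" "0 < \<delta>" "0 < \<epsilon>" "(1-\<delta>) * (c m * x) \<ge> 1" "\<epsilon> * (c m * x) \<ge> z1" for m x \<delta> \<epsilon>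
  proof -
    let ?z = "c m * x" and ?n = "real (Suc m)"
    have z: "?z > 0" using x c0 by simp
    have "measure (\<nu> m) {x<..} \<le> ?n * measure (pareto \<alpha>) {(1-\<delta>) * ?z<..} + (?n * measure (pareto \<alpha>) {\<epsilon> * ?z<..})\<^sup>2
       + ?n * (\<integral>x. min x (\<epsilon> * ?z) \<partial>pareto \<alpha>) / (\<delta> * ?z)"
      unfolding F using x z
      by (intro \<Omega>.sum_tail_upper \<Omega>.indep_vars_subset[OF ind] law pareto_nonneg) auto
    also have "?n * measure (pareto \<alpha>) {(1-\<delta>) * ?z<..} = (1-\<delta>) powr (-\<alpha>) * x powr (-\<alpha>)"
      using x \<alpha> by (simp only: pareto_tail Npow)
    also have t: "?n * measure (pareto \<alpha>) {\<epsilon> * ?z<..} = \<epsilon> powr (-\<alpha>) * x powr (-\<alpha>)"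
      using x \<alpha> by (subst pareto_tail) (auto simp: z1_def Npow simp del: of_nat_Suc)
    also have "?n * (\<integral>x. min x (\<epsilon> * ?z) \<partial>pareto \<alpha>) / (\<delta> * ?z) \<le>
        ?n * (C * ((\<epsilon> * ?z) * measure (pareto \<alpha>) {\<epsilon> * ?z<..})) / (\<delta> * ?z)"
      using x z by (intro divide_right_mono mult_left_mono C(2)) (auto simp: z1_def)
    also have "\<dots> = C * (\<epsilon> * (?n * measure (pareto \<alpha>) {\<epsilon> * ?z<..})) / \<delta>"
      using z x c0[of m] by (simp add: field_simps del: of_nat_Suc)
    finally show ?thesis unfolding U_def t by (simp add: mult_ac)
  qed
  have lower: "1 - (1 + (- (x powr (-\<alpha>))) / real (Suc m)) ^ Suc m \<le> measure (\<nu> m) {x<..}"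
    if x: "x > 0" "c m * x \<ge> 1" for m x
  proof -
    have "1 - (1 - measure (pareto \<alpha>) {c m * x<..}) ^ Suc m \<le> measure (\<nu> m) {x<..}"
      unfolding F using law by (intro \<Omega>.sum_tail_lower \<Omega>.indep_vars_subset[OF ind] pareto_nonneg) auto
    moreover have "real (Suc m) * (1 * (c m * x)) powr (-\<alpha>) = 1 powr (-\<alpha>) * x powr (-\<alpha>)" by (rule Npow)
    then have "measure (pareto \<alpha>) {c m * x<..} = x powr (-\<alpha>) / real (Suc m)"
      using x \<alpha> by (subst pareto_tail) (auto simp: field_simps simp del: of_nat_Suc)
    ultimately show ?thesis by simp
  qed
  have nonneg: "measure (\<nu> m) {..y} = 0" if "y < 0" for m y
  proof -
    have "AE \<omega> in \<Omega>. 0 \<le> \<omega> i" for i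
    proof -
      have "AE x in distr \<Omega> borel (\<lambda>\<omega>. \<omega> i). 0 \<le> x" unfolding law by (rule pareto_nonneg)
      then show ?thesis by (subst (asm) AE_distr_iff) auto
    qed
    then have "AE \<omega> in \<Omega>. \<forall>i. 0 \<le> \<omega> i" by (simp add: AE_all_countable)
    then have "AE \<omega> in \<Omega>. \<not> (1 / c m) * S m \<omega> \<le> y"
    proof eventually_elim
      case (elim \<omega>)
      then have "S m \<omega> \<ge> 0" unfolding S_def by (intro sum_nonneg) auto
      then have "(1 / c m) * S m \<omega> \<ge> 0" using c0[of m] by simp
      then show ?case using that by linarith
    qed
    then have "AE x in \<nu> m. x \<notin> {..y}" unfolding \<nu>_def by (subst AE_distr_iff) auto
    then show ?thesis by (subst (asm) AE_iff_measurable[of "{..y}"]) (auto simp: measure_def)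
  qed
  have tendsto_x: "((\<lambda>x. x powr (-a)) \<longlongrightarrow> 0) at_top" if "a > 0" for a :: real
    using that by (intro tendsto_neg_powr filterlim_ident) auto
  have "tight \<nu>" unfolding tight_def
  proof (intro conjI allI impI)
    fix e :: real assume e: "e > 0"
    have "((\<lambda>x. U (1/2) 1 x) \<longlongrightarrow> (1-1/2) powr (-\<alpha>) * 0 + (1 powr (-\<alpha>) * 0)\<^sup>2 + C * (1 * 1 powr (-\<alpha>) * 0) / (1/2)) at_top"
      unfolding U_def using \<alpha> by (intro tendsto_intros tendsto_x) auto
    then have "\<forall>\<^sub>F x in at_top. U (1/2) 1 x < e" using e by (intro order_tendstoD(2)) auto
    then have "\<forall>\<^sub>F x in at_top. U (1/2) 1 x < e \<and> x \<ge> max 2 z1" using eventually_ge_at_top by (rule eventually_conj)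
    then obtain b where b: "U (1/2) 1 b < e" "b \<ge> 2" "b \<ge> z1"
      by (auto simp: eventually_at_top_linorder)
    have "measure (\<nu> m) {-1<..b} > 1 - e" for m
    proof -
      have "b \<le> c m * b" using c[of m] b by (simp add: mult_le_cancel_right1)
      then have "2 \<le> c m * b" "z1 \<le> c m * b" using b by linarith+
      then have 1: "measure (\<nu> m) {b<..} \<le> U (1/2) 1 b" using b by (intro upper) simp_all
      have "measure (\<nu> m) {-1<..b} = cdf (\<nu> m) b - cdf (\<nu> m) (-1)" using b by (intro \<nu>.cdf_diff_eq[symmetric]) auto
      also have "cdf (\<nu> m) (-1) = 0" using nonneg[of "-1" m] by (simp add: cdf_def)
      also have "cdf (\<nu> m) b = 1 - measure (\<nu> m) {b<..}"
      proof -
        have "{b<..} = space (\<nu> m) - {..b}" by auto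
        then show ?thesis using \<nu>.prob_compl[of "{..b}" m] by (simp add: cdf_def)
      qed
      finally show ?thesis using 1 b by simp
    qed
    then show "\<exists>a b. a < b \<and> (\<forall>n. 1 - e < measure (\<nu> n) {a<..b})"
      using b by (intro exI[of _ "-1"] exI[of _ b]) auto
  qed (rule \<nu>)
  then obtain r \<mu> where r: "strict_mono r" and \<mu>: "real_distribution \<mu>" and wc: "weak_conv_m (\<nu> \<circ> id \<circ> r) \<mu>"
    using tight_imp_convergent_subsubsequence[of \<nu> id] by (auto simp: strict_mono_id)
  interpret \<mu>: real_distribution \<mu> by (rule \<mu>)
  have Sr: "filterlim (\<lambda>n. Suc (r n)) sequentially sequentially"
    using filterlim_subseq[OF r] filterlim_Suc by (rule filterlim_compose[rotated])
  have char_\<mu>: "char \<mu> \<theta> = exp (stable_exponent \<alpha> \<theta>)" for \<theta>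
  proof (rule LIMSEQ_unique)
    show "(\<lambda>n. char ((\<nu> \<circ> id \<circ> r) n) \<theta>) \<longlonglongrightarrow> char \<mu> \<theta>"
      using \<nu> \<mu> wc by (intro levy_continuity1) (auto simp: comp_def)
    have "(\<lambda>n. char (pareto \<alpha>) (\<theta> / real n powr (1/\<alpha>)) ^ n) \<longlonglongrightarrow> exp (stable_exponent \<alpha> \<theta>)"
      by (intro power_tendsto_exp char_pareto_limit P.cmod_char_le_1 stable_exponent_Re_le \<alpha>)
    from filterlim_compose[OF this Sr]
    show "(\<lambda>n. char ((\<nu> \<circ> id \<circ> r) n) \<theta>) \<longlonglongrightarrow> exp (stable_exponent \<alpha> \<theta>)"
      unfolding comp_def id_def char_\<nu> c_def .
  qed
  define T where "T x = measure \<mu> {x<..}" for x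
  have T_cdf: "T x = 1 - cdf \<mu> x" for x
  proof -
    have "{x<..} = space \<mu> - {..x}" by auto
    then show ?thesis unfolding T_def using \<mu>.prob_compl[of "{..x}"] by (simp add: cdf_def)
  qed
  have conv: "(\<lambda>n. cdf (\<nu> (r n)) x) \<longlonglongrightarrow> cdf \<mu> x" if "measure \<mu> {x} = 0" for x
    using wc that unfolding weak_conv_m_def weak_conv_def by (simp add: \<mu>.isCont_cdf)
  have convT: "(\<lambda>n. measure (\<nu> (r n)) {x<..}) \<longlonglongrightarrow> T x" if "measure \<mu> {x} = 0" for x
  proof -
    have "measure (\<nu> m) {x<..} = 1 - cdf (\<nu> m) x" for m
    proof -
      have "{x<..} = space (\<nu> m) - {..x}" by auto
      then show ?thesis using \<nu>.prob_compl[of "{..x}" m] by (simp add: cdf_def)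
    qed
    then show ?thesis unfolding T_cdf using conv[OF that] by (simp add: tendsto_diff)
  qed
  have c_lim: "filterlim (\<lambda>n. c (r n)) at_top sequentially"
  proof -
    have "filterlim (\<lambda>n. real n powr (1/\<alpha>)) at_top sequentially"
      using \<alpha> by (intro filterlim_compose[OF filterlim_powr_at_top filterlim_real_sequentially]) auto
    from filterlim_compose[OF this Sr] show ?thesis unfolding c_def .
  qed
  have T_upper: "T x \<le> U \<delta> \<epsilon> x" if "measure \<mu> {x} = 0" "x > 0" "0 < \<delta>" "\<delta> < 1" "0 < \<epsilon>" for x \<delta> \<epsilon>
  proof (rule LIMSEQ_le_const2[OF convT[OF that(1)]])
    have "\<forall>\<^sub>F n in sequentially. c (r n) \<ge> max (1 / ((1-\<delta>) * x)) (z1 / (\<epsilon> * x))"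
      using c_lim unfolding filterlim_at_top by blast
    then have "\<forall>\<^sub>F n in sequentially. measure (\<nu> (r n)) {x<..} \<le> U \<delta> \<epsilon> x"
    proof eventually_elim
      case (elim n)
      then show ?case using that by (intro upper) (auto simp: field_simps)
    qed
    then show "\<exists>N. \<forall>n\<ge>N. measure (\<nu> (r n)) {x<..} \<le> U \<delta> \<epsilon> x" by (simp add: eventually_sequentially)
  qed
  have T_lower: "1 - exp (- (x powr (-\<alpha>))) \<le> T x" if "measure \<mu> {x} = 0" "x > 0" for x
  proof (rule tendsto_le[OF _ convT[OF that(1)]])
    show "(\<lambda>n. 1 - (1 + (- (x powr (-\<alpha>))) / real (Suc (r n))) ^ Suc (r n)) \<longlonglongrightarrow> 1 - exp (- (x powr (-\<alpha>)))"
      using filterlim_compose[OF tendsto_exp_limit_sequentially[of "- (x powr (-\<alpha>))"] Sr]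
      by (intro tendsto_diff tendsto_const)
    have "\<forall>\<^sub>F n in sequentially. c (r n) \<ge> 1 / x"
      using c_lim unfolding filterlim_at_top by blast
    then show "\<forall>\<^sub>F n in sequentially. 1 - (1 + (- (x powr (-\<alpha>))) / real (Suc (r n))) ^ Suc (r n) \<le> measure (\<nu> (r n)) {x<..}"
      by eventually_elim (use that in \<open>intro lower; simp add: field_simps\<close>)
  qed simp
  have cont_point: "\<exists>x. a < x \<and> x < b \<and> measure \<mu> {x} = 0" if ab: "a < b" for a b
  proof -
    obtain x where "x \<in> {a<..<b}" "x \<notin> {x. measure \<mu> {x} > 0}"
      using real_interval_avoid_countable_set[OF ab \<mu>.countable_atoms] by blast
    then show ?thesis by (auto simp: not_less antisym)
  qed
  have T_pos: "T b > 0" for b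
  proof -
    obtain x where x: "max b 1 < x" "measure \<mu> {x} = 0" using cont_point[of "max b 1" "max b 1 + 1"] by auto
    have "0 < 1 - exp (- (x powr (-\<alpha>)))" using x by simp
    also have "\<dots> \<le> T x" using x by (intro T_lower) auto
    also have "\<dots> \<le> T b" unfolding T_def using x by (intro \<mu>.finite_measure_mono) auto
    finally show ?thesis .
  qed
  have "\<mu> \<star> \<mu> = distr \<mu> borel (\<lambda>x. 2 powr (1/\<alpha>) * x)"
  proof (rule Levy_uniqueness)
    define \<Omega>2 where "\<Omega>2 = PiM UNIV (\<lambda>_::bool. \<mu>)"
    interpret \<Omega>2: prob_space \<Omega>2 unfolding \<Omega>2_def by (intro prob_space_PiM \<mu>.prob_space_axioms)
    have ind2: "\<Omega>2.indep_vars (\<lambda>_. borel) (\<lambda>i \<omega>. \<omega> i) UNIV"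
      and law2: "\<And>i. distr \<Omega>2 borel (\<lambda>\<omega>. \<omega> i) = \<mu>"
      unfolding \<Omega>2_def using indep_vars_PiM_coordinates[of UNIV "\<lambda>_. \<mu>"] \<mu>.prob_space_axioms by auto
    have [measurable]: "(\<lambda>\<omega>. \<omega> i) \<in> borel_measurable \<Omega>2" for i
      using ind2 by (auto simp: \<Omega>2.indep_vars_def2)
    have iv: "\<Omega>2.indep_var borel (\<lambda>\<omega>. \<omega> True) borel (\<lambda>\<omega>. \<omega> False)"
    proof -
      have "\<Omega>2.indep_vars (case_bool borel borel) (case_bool (\<lambda>\<omega>. \<omega> True) (\<lambda>\<omega>. \<omega> False)) UNIV"
        using ind2 by (subst \<Omega>2.indep_vars_cong[of UNIV UNIV _ "\<lambda>i \<omega>. \<omega> i" _ "\<lambda>_. borel"]) (auto split: bool.split)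
      then show ?thesis unfolding \<Omega>2.indep_var_def .
    qed
    have eq: "\<mu> \<star> \<mu> = distr \<Omega>2 borel (\<lambda>\<omega>. \<omega> True + \<omega> False)"
      using \<Omega>2.sum_indep_random_variable[OF iv] by (simp add: law2)
    show "real_distribution (\<mu> \<star> \<mu>)" unfolding eq by (intro \<Omega>2.real_distribution_distr) measurable
    show "real_distribution (distr \<mu> borel (\<lambda>x. 2 powr (1/\<alpha>) * x))" by (intro \<mu>.real_distribution_distr) auto
    show "char (\<mu> \<star> \<mu>) = char (distr \<mu> borel (\<lambda>x. 2 powr (1/\<alpha>) * x))"
    proof
      fix t
      have "char (\<mu> \<star> \<mu>) t = char \<mu> t * char \<mu> t" unfolding eq by (subst \<Omega>2.char_distr_add[OF iv]) (simp add: law2)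
      also have "\<dots> = exp (of_real 2 * stable_exponent \<alpha> t)" unfolding char_\<mu> by (simp add: exp_add[symmetric])
      also have "\<dots> = char \<mu> (t * 2 powr (1/\<alpha>))"
        unfolding char_\<mu> using stable_exponent_scale[OF \<alpha>, of 2 t] by (simp add: mult.commute)
      also have "\<dots> = char (distr \<mu> borel (\<lambda>x. 2 powr (1/\<alpha>) * x)) t"
        using char_distr_mult[of "\<lambda>x. x" \<mu> "2 powr (1/\<alpha>)" t] distr_id2[of borel \<mu>] by simp
      finally show "char (\<mu> \<star> \<mu>) t = char (distr \<mu> borel (\<lambda>x. 2 powr (1/\<alpha>) * x)) t" .
    qed
  qed
  then have atoms: "measure \<mu> {x} = 0" for x
    using T_pos unfolding T_def by (intro no_atoms_of_self_convolution[OF \<mu>]) auto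
  have "AE x in \<mu>. 0 \<le> x"
  proof -
    have "cdf \<mu> y = 0" if "y < 0" for y
    proof -
      have "(\<lambda>n. cdf (\<nu> (r n)) y) \<longlonglongrightarrow> cdf \<mu> y" using conv[OF atoms] .
      then show ?thesis using nonneg[OF that] by (simp add: cdf_def LIMSEQ_const_iff)
    qed
    then have "\<forall>\<^sub>F y in at_left 0. cdf \<mu> y = 0"
      unfolding eventually_at_left[of "-1::real" 0, simplified] by (intro exI[of _ "-1"]) auto
    then have "measure \<mu> {..<0} = 0"
      using tendsto_unique[OF _ \<mu>.cdf_at_left[of 0] tendsto_eventually] by auto
    then show ?thesis by (subst AE_iff_measurable[of "{..<0}"]) (auto simp: \<mu>.emeasure_eq_measure)
  qed
  moreover have "((\<lambda>x. x powr \<alpha> * T x) \<longlongrightarrow> 1) at_top"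
  proof (rule tendsto_sandwich[where f="\<lambda>x. 1 / (1 + x powr (-\<alpha>))"])
    \<comment> \<open>\<open>\<epsilon> = e x\<close> vanishes so slowly that \<open>\<epsilon>\<^sup>-\<^sup>2\<^sup>\<alpha> x\<^sup>-\<^sup>\<alpha>\<close> still does, and \<open>\<delta> = d x\<close> so slowly that \<open>\<epsilon>\<^sup>1\<^sup>-\<^sup>\<alpha> / \<delta>\<close> does.\<close>
    define d where "d x = x powr (-((1-\<alpha>)/8))" for x :: real
    define e where "e x = x powr (-(1/4))" for x :: real
    have xx: "x powr \<alpha> * x powr (-\<alpha>) = 1" if "x > 0" for x
      using that by (simp add: powr_minus)
    show "\<forall>\<^sub>F x in at_top. x powr \<alpha> * T x \<le> (1 - d x) powr (-\<alpha>) + x powr (-(\<alpha>/2)) + C * x powr (-((1-\<alpha>)/8))"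
      using eventually_gt_at_top[of 1]
    proof eventually_elim
      case (elim x)
      have x: "x > 0" using elim by simp
      have "d x < 1" unfolding d_def using elim \<alpha> by (subst powr_less_one) auto
      then have "T x \<le> U (d x) (e x) x" using x by (intro T_upper atoms) (auto simp: d_def e_def)
      then have "x powr \<alpha> * T x \<le> x powr \<alpha> * U (d x) (e x) x" using x by (intro mult_left_mono) auto
      also have "\<dots> = (1 - d x) powr (-\<alpha>) * (x powr \<alpha> * x powr (-\<alpha>))
          + (e x powr (-\<alpha>) * e x powr (-\<alpha>) * x powr (-\<alpha>)) * (x powr \<alpha> * x powr (-\<alpha>))
          + C * (e x * e x powr (-\<alpha>) / d x) * (x powr \<alpha> * x powr (-\<alpha>))"
        unfolding U_def by (simp add: algebra_simps power2_eq_square)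
      also have "e x powr (-\<alpha>) * e x powr (-\<alpha>) * x powr (-\<alpha>) = x powr (-(\<alpha>/2))"
        unfolding e_def powr_powr powr_add[symmetric] by (simp add: field_simps)
      also have "e x * e x powr (-\<alpha>) / d x = x powr (-((1-\<alpha>)/8))"
        unfolding e_def d_def powr_powr powr_add[symmetric] powr_diff[symmetric]
        by (intro arg_cong2[where f="(powr)"]) (simp_all add: field_simps)
      finally show ?case unfolding xx[OF x] by simp
    qed
    have "((\<lambda>x. (1 - d x) powr (-\<alpha>) + x powr (-(\<alpha>/2)) + C * x powr (-((1-\<alpha>)/8))) \<longlongrightarrow>
       (1 - 0) powr (-\<alpha>) + 0 + C * 0) at_top"
      unfolding d_def using \<alpha> by (intro tendsto_intros tendsto_x) auto
    then show "((\<lambda>x. (1 - d x) powr (-\<alpha>) + x powr (-(\<alpha>/2)) + C * x powr (-((1-\<alpha>)/8))) \<longlongrightarrow> 1) at_top" by simp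
    show "\<forall>\<^sub>F x in at_top. 1 / (1 + x powr (-\<alpha>)) \<le> x powr \<alpha> * T x"
      using eventually_gt_at_top[of 1]
    proof eventually_elim
      case (elim x)
      define u where "u = x powr (-\<alpha>)"
      have x: "x > 0" "u > 0" using elim by (auto simp: u_def)
      have "exp (-u) \<le> 1 / (1 + u)"
        using exp_ge_add_one_self[of u] x by (simp add: exp_minus inverse_eq_divide frac_le)
      moreover have "1 - 1 / (1 + u) = u / (1 + u)" using x by (simp add: field_simps)
      ultimately have "u / (1 + u) \<le> T x" using T_lower[OF atoms x(1)] unfolding u_def by linarith
      then have "x powr \<alpha> * (u / (1 + u)) \<le> x powr \<alpha> * T x" by (intro mult_left_mono) auto
      then show ?case using xx[OF x(1)] unfolding u_def by simp
    qed
    have "((\<lambda>x. 1 / (1 + x powr (-\<alpha>))) \<longlongrightarrow> 1 / (1 + 0)) at_top"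
      using \<alpha> by (intro tendsto_intros tendsto_x) auto
    then show "((\<lambda>x. 1 / (1 + x powr (-\<alpha>))) \<longlongrightarrow> 1) at_top" by simp
  qed
  ultimately show ?thesis using \<mu> char_\<mu> atoms unfolding T_def by blast
qed

section \<open>Stable increments over the dyadic grids\<close>

text \<open>
  The last assumption fixes the scale of the law: it makes \<open>n\<^sup>1\<^sup>/\<^sup>\<alpha>\<close> an admissible norming sequence.
\<close>

locale positive_stable_law =
  fixes \<alpha> :: real and \<mu> :: "real measure"
  assumes \<alpha>: "0 < \<alpha>" "\<alpha> < 1"
    and real_distribution: "real_distribution \<mu>"
    and nonneg: "AE x in \<mu>. 0 \<le> x"
    and char_eq: "\<And>\<theta>. char \<mu> \<theta> = exp (stable_exponent \<alpha> \<theta>)"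
    and no_atoms: "\<And>x. measure \<mu> {x} = 0"
    and tail: "((\<lambda>x. x powr \<alpha> * measure \<mu> {x<..}) \<longlongrightarrow> 1) at_top"
begin

sublocale law1: real_distribution \<mu> by (rule real_distribution)

text \<open>
  The laws of the increments over intervals of length \<open>c\<close>; by stability they form a convolution
  semigroup (\<open>sum_law\<close>).
\<close>

definition law :: "real \<Rightarrow> real measure" where
  "law c = distr \<mu> borel (\<lambda>x. c powr (1/\<alpha>) * x)"

lemma real_distribution_law: "real_distribution (law c)"
  unfolding law_def by (intro law1.real_distribution_distr) auto

lemma sets_law [simp, measurable_cong]: "sets (law c) = sets borel" by (simp add: law_def)
lemma space_law [simp]: "space (law c) = UNIV" by (simp add: law_def)
lemma prob_space_law: "prob_space (law c)"
  using real_distribution_law by (simp add: real_distribution_def)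

lemma law_nonneg: "AE x in law c. 0 \<le> x"
  unfolding law_def using nonneg by (subst AE_distr_iff) (auto elim!: eventually_mono)

lemma char_law:
  assumes "c \<ge> 0"
  shows "char (law c) \<theta> = exp (of_real c * stable_exponent \<alpha> \<theta>)"
proof -
  have "char (law c) \<theta> = char \<mu> (c powr (1/\<alpha>) * \<theta>)"
    unfolding law_def
    by (subst char_distr_mult) (simp_all add: distr_id2[OF law1.events_eq_borel[symmetric]] mult.commute)
  also have "\<dots> = exp (of_real c * stable_exponent \<alpha> \<theta>)"
  proof (cases "c = 0")
    case False
    then show ?thesis using assms \<alpha> by (simp add: char_eq stable_exponent_scale)
  qed (simp add: law1.char_zero)
  finally show ?thesis .
qed

lemma law_1: "law 1 = \<mu>"
proof -
  have "law 1 = distr \<mu> borel (\<lambda>x. x)" unfolding law_def by (intro distr_cong) auto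
  then show ?thesis by (simp add: distr_id2[OF law1.events_eq_borel[symmetric]])
qed

lemma law_eqI:
  assumes "real_distribution M" "c \<ge> 0" "\<And>\<theta>. char M \<theta> = exp (of_real c * stable_exponent \<alpha> \<theta>)"
  shows "M = law c"
  using assms real_distribution_law by (intro Levy_uniqueness) (auto simp: char_law)

lemma sum_law:
  assumes "prob_space M" and ind: "prob_space.indep_vars M (\<lambda>_. borel) X I" and "finite I"
    and X: "\<And>i. i \<in> I \<Longrightarrow> distr M borel (X i) = law (c i)" "\<And>i. i \<in> I \<Longrightarrow> c i \<ge> 0"
  shows "distr M borel (\<lambda>\<omega>. \<Sum>i\<in>I. X i \<omega>) = law (\<Sum>i\<in>I. c i)"
proof -
  interpret prob_space M by fact
  have [measurable]: "X i \<in> borel_measurable M" if "i \<in> I" for i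
    using ind that by (auto simp: indep_vars_def2)
  show ?thesis
  proof (rule law_eqI)
    show "real_distribution (distr M borel (\<lambda>\<omega>. \<Sum>i\<in>I. X i \<omega>))"
      by (intro real_distribution_distr) measurable
    show "char (distr M borel (\<lambda>\<omega>. \<Sum>i\<in>I. X i \<omega>)) \<theta> = exp (of_real (\<Sum>i\<in>I. c i) * stable_exponent \<alpha> \<theta>)" for \<theta>
      using X \<open>finite I\<close> by (subst char_distr_sum[OF ind]) (simp add: char_law exp_sum sum_distrib_right)
  qed (use X in \<open>auto intro: sum_nonneg\<close>)
qed

definition increments_measure :: "nat \<Rightarrow> (nat \<Rightarrow> real) measure" where
  "increments_measure n = PiM UNIV (\<lambda>_. law (1 / 2^n))"

definition dyadics_at :: "nat \<Rightarrow> real set" where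
  "dyadics_at n = {t. \<exists>k::nat. t = real k / 2^n}"

definition dyadics :: "real set" where "dyadics = (\<Union>n. dyadics_at n)"

definition grid_value :: "nat \<Rightarrow> (nat \<Rightarrow> real) \<Rightarrow> real \<Rightarrow> real" where
  "grid_value n x t = (\<Sum>i<nat \<lfloor>2^n * t\<rfloor>. x i)"

definition grid_fdd :: "nat \<Rightarrow> real set \<Rightarrow> (real \<Rightarrow> real) measure" where
  "grid_fdd n J = distr (increments_measure n) (PiM J (\<lambda>_. borel)) (\<lambda>x. \<lambda>t\<in>J. grid_value n x t)"

text \<open>
  Finite-dimensional laws of the process on the dyadic numbers. Any grid that contains \<open>J\<close> would
  serve (\<open>dyadic_fdd_eq\<close>); taking it as fine as needed makes the consistency of the family a mere
  restriction.
\<close>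

definition dyadic_fdd :: "real set \<Rightarrow> (real \<Rightarrow> real) measure" where
  "dyadic_fdd J = grid_fdd (LEAST n. J \<subseteq> dyadics_at n) J"

lemma sets_increments_measure [simp, measurable_cong]:
  "sets (increments_measure n) = sets (PiM UNIV (\<lambda>_. borel))"
  unfolding increments_measure_def by (intro sets_PiM_cong) auto

lemma space_increments_measure [simp]: "space (increments_measure n) = UNIV"
  unfolding increments_measure_def by (simp add: space_PiM)

lemma prob_space_increments_measure: "prob_space (increments_measure n)"
  unfolding increments_measure_def by (intro prob_space_PiM prob_space_law)

lemma increments_measure_indep:
  "prob_space.indep_vars (increments_measure n) (\<lambda>_. borel) (\<lambda>i x. x i) UNIV"
  "distr (increments_measure n) borel (\<lambda>x. x i) = law (1 / 2^n)"
  unfolding increments_measure_def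
  using indep_vars_PiM_coordinates[of UNIV "\<lambda>_. law (1 / 2^n)"] prob_space_law by auto

lemma measurable_increment: "(\<lambda>x. x i) \<in> borel_measurable (increments_measure n)"
  by measurable

lemma measurable_grid_value [measurable]: "(\<lambda>x. grid_value n x t) \<in> borel_measurable (PiM UNIV (\<lambda>_. borel))"
  unfolding grid_value_def by measurable

lemma dyadics_at_Suc: "dyadics_at n \<subseteq> dyadics_at (Suc n)"
proof
  fix t assume "t \<in> dyadics_at n"
  then obtain k :: nat where "t = real k / 2^n" by (auto simp: dyadics_at_def)
  then have "t = real (2 * k) / 2 ^ Suc n" by simp
  then show "t \<in> dyadics_at (Suc n)" unfolding dyadics_at_def by blast
qed

lemma dyadics_at_mono: "n \<le> m \<Longrightarrow> dyadics_at n \<subseteq> dyadics_at m"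
  using lift_Suc_mono_le[of dyadics_at n m, OF dyadics_at_Suc] by simp

lemma finite_dyadics_level:
  assumes "finite J" "J \<subseteq> dyadics"
  shows "\<exists>n. J \<subseteq> dyadics_at n"
  using assms
proof (induction J rule: finite_induct)
  case (insert t J)
  then obtain n m where "J \<subseteq> dyadics_at n" "t \<in> dyadics_at m" by (auto simp: dyadics_def)
  then have "insert t J \<subseteq> dyadics_at (max n m)"
    using dyadics_at_mono[of n "max n m"] dyadics_at_mono[of m "max n m"] by auto
  then show ?case ..
qed simp

lemma measurable_pair_sums [measurable]:
  "(\<lambda>x i. x (2*i) + x (Suc (2*i))) \<in> measurable (PiM UNIV (\<lambda>_::nat. borel :: real measure)) (PiM UNIV (\<lambda>_::nat. borel))"
proof -
  have "(\<lambda>x. \<lambda>i\<in>UNIV. x (2*i) + x (Suc (2*i))) \<in> measurable (PiM UNIV (\<lambda>_::nat. borel :: real measure)) (PiM UNIV (\<lambda>_::nat. borel))"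
    by (intro measurable_restrict) measurable
  then show ?thesis unfolding restrict_UNIV .
qed

text \<open>
  Adding neighbouring increments of the finer grid gives the increments of the coarser one: this is
  where stability enters the construction.
\<close>

lemma halve_increments_measure:
  "distr (increments_measure (Suc n)) (PiM UNIV (\<lambda>_. borel)) (\<lambda>x i. x (2*i) + x (Suc (2*i))) = increments_measure n"
proof -
  let ?M = "increments_measure (Suc n)"
  interpret prob_space ?M by (rule prob_space_increments_measure)
  have "indep_vars (\<lambda>j. PiM {2*j, Suc (2*j)} (\<lambda>_. borel)) (\<lambda>j \<omega>. restrict (\<lambda>i. \<omega> i) {2*j, Suc (2*j)}) (UNIV :: nat set)"
    by (intro indep_vars_restrict[OF increments_measure_indep(1)]) (auto simp: disjoint_family_on_def)
  then have "indep_vars (\<lambda>_. borel) (\<lambda>j \<omega>. (\<lambda>y. y (2*j) + y (Suc (2*j))) (restrict (\<lambda>i. \<omega> i) {2*j, Suc (2*j)})) (UNIV :: nat set)"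
    by (rule indep_vars_compose2) measurable
  then have ind: "indep_vars (\<lambda>_. borel) (\<lambda>j \<omega>. \<omega> (2*j) + \<omega> (Suc (2*j))) (UNIV :: nat set)" by simp
  have law: "distr ?M borel (\<lambda>x. x (2*i) + x (Suc (2*i))) = law (1 / 2^n)" for i
  proof -
    have "distr ?M borel (\<lambda>x. \<Sum>j\<in>{2*i,Suc (2*i)}. x j) = law (\<Sum>j\<in>{2*i,Suc (2*i)}. 1 / 2^Suc n)"
      by (intro sum_law prob_space_axioms indep_vars_subset[OF increments_measure_indep(1)]) (auto simp: increments_measure_indep(2))
    then show ?thesis by (simp add: field_simps)
  qed
  have "distr ?M (PiM UNIV (\<lambda>_. borel)) (\<lambda>x. \<lambda>i\<in>UNIV. x (2*i) + x (Suc (2*i))) =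
    PiM UNIV (\<lambda>i. distr ?M borel (\<lambda>x. x (2*i) + x (Suc (2*i))))"
    using ind by (subst (asm) indep_vars_iff_distr_eq_PiM') (auto simp: indep_vars_def2)
  then show ?thesis unfolding law restrict_UNIV by (simp add: increments_measure_def)
qed

lemma grid_value_halve:
  assumes "t \<in> dyadics_at n"
  shows "grid_value n (\<lambda>i. x (2*i) + x (Suc (2*i))) t = grid_value (Suc n) x t"
proof -
  obtain k :: nat where k: "t = real k / 2^n" using assms by (auto simp: dyadics_at_def)
  have "(\<Sum>i<k. x (2*i) + x (Suc (2*i))) = (\<Sum>i<2*k. x i)" for k
    by (induction k) (simp_all add: algebra_simps)
  moreover have "nat \<lfloor>2^n * t\<rfloor> = k" unfolding k by simp
  moreover have "2^Suc n * t = real (2 * k)" unfolding k by simp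
  then have "nat \<lfloor>2^Suc n * t\<rfloor> = 2 * k" by (simp only: floor_of_nat nat_int)
  ultimately show ?thesis unfolding grid_value_def by simp
qed

lemma grid_fdd_Suc:
  assumes "J \<subseteq> dyadics_at n"
  shows "grid_fdd (Suc n) J = grid_fdd n J"
proof -
  have "grid_fdd n J = distr (distr (increments_measure (Suc n)) (PiM UNIV (\<lambda>_. borel)) (\<lambda>x i. x (2*i) + x (Suc (2*i))))
      (PiM J (\<lambda>_. borel)) (\<lambda>x. \<lambda>t\<in>J. grid_value n x t)"
    unfolding halve_increments_measure grid_fdd_def ..
  also have "\<dots> = distr (increments_measure (Suc n)) (PiM J (\<lambda>_. borel))
      ((\<lambda>x. \<lambda>t\<in>J. grid_value n x t) \<circ> (\<lambda>x i. x (2*i) + x (Suc (2*i))))"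
    by (rule distr_distr) measurable
  also have "\<dots> = grid_fdd (Suc n) J"
    unfolding grid_fdd_def using assms
    by (intro distr_cong refl) (auto simp: comp_def intro!: restrict_ext grid_value_halve)
  finally show ?thesis ..
qed

lemma dyadic_fdd_eq:
  assumes "J \<subseteq> dyadics_at n"
  shows "dyadic_fdd J = grid_fdd n J"
proof -
  let ?l = "LEAST n. J \<subseteq> dyadics_at n"
  have l: "J \<subseteq> dyadics_at ?l" using assms by (rule LeastI)
  have "?l \<le> n" using assms by (rule Least_le)
  then have "grid_fdd n J = grid_fdd ?l J"
  proof (induction n rule: dec_induct)
    case (step m)
    then have "J \<subseteq> dyadics_at m" using l dyadics_at_mono[of ?l m] by blast
    then show ?case using step grid_fdd_Suc by simp
  qed simp
  then show ?thesis by (simp add: dyadic_fdd_def)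
qed

lemma projective_dyadic_fdd: "polish_projective dyadics dyadic_fdd"
  unfolding polish_projective_def projective_family_def
proof (intro conjI allI impI)
  fix J H assume JH: "J \<subseteq> H" "finite H" "H \<subseteq> dyadics"
  then obtain n where n: "H \<subseteq> dyadics_at n" using finite_dyadics_level by blast
  have "distr (dyadic_fdd H) (PiM J (\<lambda>_. borel)) (\<lambda>f. restrict f J) =
    distr (increments_measure n) (PiM J (\<lambda>_. borel)) ((\<lambda>f. restrict f J) \<circ> (\<lambda>x. \<lambda>t\<in>H. grid_value n x t))"
    unfolding dyadic_fdd_eq[OF n] grid_fdd_def using JH
    by (intro distr_distr measurable_restrict_subset) measurable
  also have "\<dots> = grid_fdd n J" unfolding grid_fdd_def using JH
    by (intro distr_cong) (auto simp: comp_def restrict_restrict Int_absorb1)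
  also have "\<dots> = dyadic_fdd J" using n JH by (intro dyadic_fdd_eq[symmetric]) auto
  finally show "dyadic_fdd J = distr (dyadic_fdd H) (PiM J (\<lambda>_. borel)) (\<lambda>f. restrict f J)" ..
next
  fix J :: "real set" assume "finite J" "J \<subseteq> dyadics"
  interpret prob_space "increments_measure n" for n by (rule prob_space_increments_measure)
  show "prob_space (dyadic_fdd J)" unfolding dyadic_fdd_def grid_fdd_def
    by (intro prob_space_distr) measurable
qed

text \<open>
  Kolmogorov's extension theorem over the countable index set of dyadic numbers.
\<close>

theorem dyadic_process_exists:
  "\<exists>N :: (real \<Rightarrow> real) measure. prob_space N \<and> sets N = sets (PiM dyadics (\<lambda>_. borel)) \<and>
    (\<forall>n J. finite J \<longrightarrow> J \<subseteq> dyadics_at n \<longrightarrow> distr N (PiM J (\<lambda>_. borel)) (\<lambda>\<omega>. restrict \<omega> J) = grid_fdd n J)"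
proof -
  interpret P: polish_projective dyadics dyadic_fdd by (rule projective_dyadic_fdd)
  have "distr P.lim (PiM J (\<lambda>_. borel)) (\<lambda>\<omega>. restrict \<omega> J) = grid_fdd n J"
    if J: "finite J" "J \<subseteq> dyadics_at n" for n J
  proof (rule measure_eqI)
    have JD: "J \<subseteq> dyadics" using J by (auto simp: dyadics_def)
    fix A assume "A \<in> sets (distr P.lim (PiM J (\<lambda>_. borel)) (\<lambda>\<omega>. restrict \<omega> J))"
    then have A: "A \<in> sets (PiM J (\<lambda>_. borel))" by simp
    have m: "(\<lambda>\<omega>. restrict \<omega> J) \<in> measurable P.lim (PiM J (\<lambda>_. borel))"
      using measurable_restrict_subset[OF JD, of "\<lambda>_. borel"] by (simp cong: measurable_cong_sets)
    have "emeasure (distr P.lim (PiM J (\<lambda>_. borel)) (\<lambda>\<omega>. restrict \<omega> J)) A = emeasure P.lim (P.emb dyadics J A)"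
      by (subst emeasure_distr[OF m A]) (simp add: prod_emb_def space_PiM)
    also have "\<dots> = emeasure (dyadic_fdd J) A" using P.emeasure_lim_emb[OF JD J(1) A] .
    finally show "emeasure (distr P.lim (PiM J (\<lambda>_. borel)) (\<lambda>\<omega>. restrict \<omega> J)) A = emeasure (grid_fdd n J) A"
      unfolding dyadic_fdd_eq[OF J(2)] .
  qed (simp add: grid_fdd_def)
  then show ?thesis using P.P.prob_space_axioms by (intro exI[of _ P.lim]) auto
qed

lemma dyadic_process_increments:
  assumes "prob_space N" and sets_N: "sets N = sets (PiM dyadics (\<lambda>_. borel))"
    and fdd: "\<And>n J. finite J \<Longrightarrow> J \<subseteq> dyadics_at n \<Longrightarrow> distr N (PiM J (\<lambda>_. borel)) (\<lambda>\<omega>. restrict \<omega> J) = grid_fdd n J"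
  shows "prob_space.indep_vars N (\<lambda>_. borel) (\<lambda>i \<omega>. \<omega> (real (Suc i) / 2^n) - \<omega> (real i / 2^n)) {..<K}"
    and "i < K \<Longrightarrow> distr N borel (\<lambda>\<omega>. \<omega> (real (Suc i) / 2^n) - \<omega> (real i / 2^n)) = law (1 / 2^n)"
    and "AE \<omega> in N. \<omega> 0 = 0"
proof -
  interpret prob_space N by fact
  interpret I: prob_space "increments_measure n" for n by (rule prob_space_increments_measure)
  have coord [measurable]: "(\<lambda>\<omega>. \<omega> t) \<in> borel_measurable N" if "t \<in> dyadics" for t
    using measurable_component_singleton[OF that, of "\<lambda>_. borel"] sets_N by (simp cong: measurable_cong_sets)
  have dy: "real i / 2^n \<in> dyadics_at n" for i n unfolding dyadics_at_def by blast
  then have dy': "real i / 2^n \<in> dyadics" for i n unfolding dyadics_def by blast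
  let ?Z = "\<lambda>i \<omega>. \<omega> (real (Suc i) / 2^n) - \<omega> (real i / 2^n) :: real"
  have Zm: "?Z i \<in> borel_measurable N" for i using dy' by (intro borel_measurable_diff coord) blast+
  let ?J = "(\<lambda>i. real i / 2^n) ` {..K}"
  have J: "finite ?J" "?J \<subseteq> dyadics_at n" "?J \<subseteq> dyadics" using dy dy' by auto
  have joint: "distr N (PiM {..<K} (\<lambda>_. borel)) (\<lambda>\<omega>. \<lambda>i\<in>{..<K}. ?Z i \<omega>) =
    distr (increments_measure n) (PiM {..<K} (\<lambda>_. borel)) (\<lambda>x. \<lambda>i\<in>{..<K}. x i)"
  proof -
    have mr: "(\<lambda>\<omega>. restrict \<omega> ?J) \<in> measurable N (PiM ?J (\<lambda>_. borel))"
      using measurable_restrict_subset[OF J(3), of "\<lambda>_. borel"] sets_N by (simp cong: measurable_cong_sets)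
    have inJ: "real (Suc i) / 2^n \<in> ?J" "real i / 2^n \<in> ?J" if "i < K" for i
      using that by (auto simp del: of_nat_Suc)
    have mz: "(\<lambda>y. \<lambda>i\<in>{..<K}. ?Z i y) \<in> measurable (PiM ?J (\<lambda>_. borel)) (PiM {..<K} (\<lambda>_. borel))"
      by (intro measurable_restrict borel_measurable_diff measurable_component_singleton inJ) auto
    have "distr N (PiM {..<K} (\<lambda>_. borel)) (\<lambda>\<omega>. \<lambda>i\<in>{..<K}. ?Z i \<omega>) =
      distr N (PiM {..<K} (\<lambda>_. borel)) ((\<lambda>y. \<lambda>i\<in>{..<K}. ?Z i y) \<circ> (\<lambda>\<omega>. restrict \<omega> ?J))"
      using inJ by (intro distr_cong refl) (auto simp: comp_def intro!: restrict_ext)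
    also have "\<dots> = distr (grid_fdd n ?J) (PiM {..<K} (\<lambda>_. borel)) (\<lambda>y. \<lambda>i\<in>{..<K}. ?Z i y)"
      unfolding fdd[OF J(1,2), symmetric] by (rule distr_distr[symmetric, OF mz mr])
    also have "\<dots> = distr (increments_measure n) (PiM {..<K} (\<lambda>_. borel))
        ((\<lambda>y. \<lambda>i\<in>{..<K}. ?Z i y) \<circ> (\<lambda>x. \<lambda>t\<in>?J. grid_value n x t))"
      unfolding grid_fdd_def by (rule distr_distr[OF mz]) measurable
    also have "\<dots> = distr (increments_measure n) (PiM {..<K} (\<lambda>_. borel)) (\<lambda>x. \<lambda>i\<in>{..<K}. x i)"
    proof (intro distr_cong refl)
      fix x :: "nat \<Rightarrow> real"
      have "grid_value n x (real (Suc i) / 2^n) - grid_value n x (real i / 2^n) = x i" for i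
        unfolding grid_value_def by (simp del: of_nat_Suc)
      then show "((\<lambda>y. \<lambda>i\<in>{..<K}. ?Z i y) \<circ> (\<lambda>x. \<lambda>t\<in>?J. grid_value n x t)) x = (\<lambda>i\<in>{..<K}. x i)"
        using inJ by (auto simp: comp_def intro!: restrict_ext)
    qed
    finally show ?thesis .
  qed
  have marg: "distr N borel (?Z i) = law (1 / 2^n)" if i: "i < K" for i
  proof -
    have m: "(\<lambda>y. y i) \<in> borel_measurable (PiM {..<K} (\<lambda>_. borel))"
      using i by (intro measurable_component_singleton) auto
    have "distr N borel (?Z i) = distr (distr N (PiM {..<K} (\<lambda>_. borel)) (\<lambda>\<omega>. \<lambda>i\<in>{..<K}. ?Z i \<omega>)) borel (\<lambda>y. y i)"
      using i by (subst distr_distr[OF m measurable_restrict[OF Zm]]) (simp add: comp_def)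
    also have "\<dots> = distr (increments_measure n) borel (\<lambda>x. x i)"
    proof -
      have mx: "(\<lambda>x. \<lambda>i\<in>{..<K}. x i) \<in> measurable (increments_measure n) (PiM {..<K} (\<lambda>_. borel))"
        by (intro measurable_restrict measurable_increment)
      show ?thesis unfolding joint using i by (subst distr_distr[OF m mx]) (simp add: comp_def)
    qed
    finally show ?thesis by (simp add: increments_measure_indep(2))
  qed
  then show "i < K \<Longrightarrow> distr N borel (?Z i) = law (1 / 2^n)" .
  show "indep_vars (\<lambda>_. borel) ?Z {..<K}"
  proof (cases "K = 0")
    case True then show ?thesis by (simp add: indep_vars_def2 indep_sets_def)
  next
    case False
    have "I.indep_vars n (\<lambda>_. borel) (\<lambda>i x. x i) {..<K}"
      by (rule I.indep_vars_subset[OF increments_measure_indep(1)]) simp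
    then have "distr (increments_measure n) (PiM {..<K} (\<lambda>_. borel)) (\<lambda>x. \<lambda>i\<in>{..<K}. x i) =
       PiM {..<K} (\<lambda>i. distr (increments_measure n) borel (\<lambda>x. x i))"
      using False by (subst (asm) I.indep_vars_iff_distr_eq_PiM') (auto intro: measurable_increment)
    also have "\<dots> = PiM {..<K} (\<lambda>i. distr N borel (?Z i))"
      by (intro PiM_cong refl) (simp only: lessThan_iff marg increments_measure_indep(2))
    finally have eq: "distr N (PiM {..<K} (\<lambda>_. borel)) (\<lambda>\<omega>. \<lambda>i\<in>{..<K}. ?Z i \<omega>) = PiM {..<K} (\<lambda>i. distr N borel (?Z i))"
      unfolding joint .
    have "{..<K} \<noteq> {}" using False by auto
    then show ?thesis by (rule indep_vars_iff_distr_eq_PiM'[THEN iffD2, OF _ Zm eq])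
  qed
  show "AE \<omega> in N. \<omega> 0 = 0"
  proof -
    have J0: "finite {0}" "{0} \<subseteq> dyadics_at 0" "{0} \<subseteq> dyadics"
      using dy[of 0 0] dy'[of 0 0] by auto
    have m: "(\<lambda>y. y 0) \<in> borel_measurable (PiM {0::real} (\<lambda>_. borel))"
      by (intro measurable_component_singleton) auto
    have mr: "(\<lambda>\<omega>. restrict \<omega> {0}) \<in> measurable N (PiM {0} (\<lambda>_. borel))"
      using measurable_restrict_subset[OF J0(3), of "\<lambda>_. borel"] sets_N by (simp cong: measurable_cong_sets)
    have "distr N borel (\<lambda>\<omega>. \<omega> 0) = distr (distr N (PiM {0} (\<lambda>_. borel)) (\<lambda>\<omega>. restrict \<omega> {0})) borel (\<lambda>y. y 0)"
      by (subst distr_distr[OF m mr]) (simp add: comp_def)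
    also have "\<dots> = distr (increments_measure 0) borel ((\<lambda>y. y 0) \<circ> (\<lambda>x. \<lambda>t\<in>{0}. grid_value 0 x t))"
      unfolding fdd[OF J0(1,2)] grid_fdd_def by (rule distr_distr[OF m]) measurable
    also have "\<dots> = distr (increments_measure 0) borel (\<lambda>x. 0)"
      by (intro distr_cong) (auto simp: grid_value_def)
    finally have eq: "distr N borel (\<lambda>\<omega>. \<omega> 0) = distr (increments_measure 0) borel (\<lambda>x. 0 :: real)" .
    have "AE x in distr N borel (\<lambda>\<omega>. \<omega> 0). x = 0" unfolding eq by (subst AE_distr_iff) auto
    then show ?thesis using J0(3) by (subst (asm) AE_distr_iff) auto
  qed
qed

end

section \<open>Almost sure limits of independent families\<close>

text \<open>
  Continuous functions that increase to the indicator of an open set. The whole space is treated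
  apart, because \<^const>\<open>infdist\<close> to the empty set is \<open>0\<close>.
\<close>

definition open_ramp :: "real set \<Rightarrow> nat \<Rightarrow> real \<Rightarrow> real" where
  "open_ramp A m x = (if A = UNIV then 1 else min 1 (real m * infdist x (- A)))"

lemma open_ramp_bounds: "0 \<le> open_ramp A m x" "open_ramp A m x \<le> 1"
  by (auto simp: open_ramp_def infdist_nonneg)

lemma continuous_open_ramp: "continuous_on UNIV (open_ramp A m)"
  unfolding open_ramp_def by (cases "A = UNIV") (auto intro!: continuous_intros)

lemma open_ramp_tendsto:
  assumes "open A"
  shows "(\<lambda>m. open_ramp A m x) \<longlonglongrightarrow> indicator A x"
proof (cases "A = UNIV \<or> x \<notin> A")
  case True
  then have "open_ramp A m x = indicator A x" for m by (auto simp: open_ramp_def)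
  then show ?thesis by simp
next
  case False
  then have "infdist x (- A) \<noteq> 0" using assms in_closed_iff_infdist_zero[of "- A" x] by auto
  then have pos: "infdist x (- A) > 0" using infdist_nonneg[of x "- A"] by linarith
  have "\<forall>\<^sub>F m in sequentially. open_ramp A m x = indicator A x"
    using eventually_ge_at_top[of "nat \<lceil>1 / infdist x (- A)\<rceil>"]
  proof eventually_elim
    case (elim m)
    then have "1 / infdist x (- A) \<le> real m" by linarith
    then have "1 \<le> real m * infdist x (- A)" using pos by (simp add: field_simps)
    then show ?case using False by (simp add: open_ramp_def)
  qed
  then show ?thesis by (rule tendsto_eventually)
qed

text \<open>
  Products of bounded continuous functions have factorising expectations, and this passes to the
  limit by dominated convergence. Open sets generate the Borel sets, and their indicators are again
  limits of continuous functions.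
\<close>

lemma (in prob_space) indep_vars_AE_limit:
  fixes X :: "nat \<Rightarrow> 'i \<Rightarrow> 'a \<Rightarrow> real"
  assumes "finite I" and ind: "\<And>n. indep_vars (\<lambda>_. borel) (X n) I"
    and Y: "\<And>i. i \<in> I \<Longrightarrow> Y i \<in> borel_measurable M"
    and lim: "\<And>i. i \<in> I \<Longrightarrow> AE \<omega> in M. (\<lambda>n. X n i \<omega>) \<longlonglongrightarrow> Y i \<omega>"
  shows "indep_vars (\<lambda>_. borel) Y I"
proof (cases "I = {}")
  case True then show ?thesis by (simp add: indep_vars_def2 indep_sets_def)
next
  case False
  have rv: "X n i \<in> borel_measurable M" if "i \<in> I" for n i
    using ind[of n] that by (auto simp: indep_vars_def2)
  have limI: "AE \<omega> in M. \<forall>i\<in>I. (\<lambda>n. X n i \<omega>) \<longlonglongrightarrow> Y i \<omega>"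
    using lim \<open>finite I\<close> by (intro AE_finite_allI) auto
  have cont_case: "expectation (\<lambda>\<omega>. \<Prod>i\<in>I. f i (Y i \<omega>)) = (\<Prod>i\<in>I. expectation (\<lambda>\<omega>. f i (Y i \<omega>)))"
    if f: "\<And>i. continuous_on UNIV (f i)" "\<And>i x. 0 \<le> f i x" "\<And>i x. f i x \<le> 1" for f :: "'i \<Rightarrow> real \<Rightarrow> real"
  proof (rule LIMSEQ_unique)
    have fm [measurable]: "f i \<in> borel_measurable borel" for i
      using f(1) by (rule borel_measurable_continuous_onI)
    have mX: "(\<lambda>\<omega>. f i (X n i \<omega>)) \<in> borel_measurable M" if "i \<in> I" for i n
      using rv[OF that] by measurable
    have mY: "(\<lambda>\<omega>. f i (Y i \<omega>)) \<in> borel_measurable M" if "i \<in> I" for i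
      using Y[OF that] by measurable
    have fc: "(\<lambda>n. f i (x n)) \<longlonglongrightarrow> f i y" if "x \<longlonglongrightarrow> y" for i x y
      using continuous_on_tendsto_compose[OF f(1) that] by auto
    show "(\<lambda>n. expectation (\<lambda>\<omega>. \<Prod>i\<in>I. f i (X n i \<omega>))) \<longlonglongrightarrow> expectation (\<lambda>\<omega>. \<Prod>i\<in>I. f i (Y i \<omega>))"
    proof (rule integral_dominated_convergence[where w="\<lambda>_. 1"])
      show "AE \<omega> in M. (\<lambda>n. \<Prod>i\<in>I. f i (X n i \<omega>)) \<longlonglongrightarrow> (\<Prod>i\<in>I. f i (Y i \<omega>))"
        using limI by eventually_elim (auto intro!: tendsto_prod fc)
      show "AE \<omega> in M. norm (\<Prod>i\<in>I. f i (X n i \<omega>)) \<le> 1" for n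
        using f by (auto intro!: AE_I2 prod_le_1 simp: prod_nonneg abs_prod)
    qed (use mX mY in \<open>auto intro!: borel_measurable_prod\<close>)
    have "expectation (\<lambda>\<omega>. \<Prod>i\<in>I. f i (X n i \<omega>)) = (\<Prod>i\<in>I. expectation (\<lambda>\<omega>. f i (X n i \<omega>)))" for n
    proof (rule indep_vars_lebesgue_integral)
      show "indep_vars (\<lambda>_. borel) (\<lambda>i \<omega>. f i (X n i \<omega>)) I"
        by (rule indep_vars_compose2[OF ind]) measurable
      show "integrable M (\<lambda>\<omega>. f i (X n i \<omega>))" if "i \<in> I" for i
        by (rule integrable_const_bound[of _ 1]) (use f mX[OF that] in auto)
    qed fact
    moreover have "(\<lambda>n. \<Prod>i\<in>I. expectation (\<lambda>\<omega>. f i (X n i \<omega>))) \<longlonglongrightarrow> (\<Prod>i\<in>I. expectation (\<lambda>\<omega>. f i (Y i \<omega>)))"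
    proof (rule tendsto_prod)
      fix i assume i: "i \<in> I"
      show "(\<lambda>n. expectation (\<lambda>\<omega>. f i (X n i \<omega>))) \<longlonglongrightarrow> expectation (\<lambda>\<omega>. f i (Y i \<omega>))"
      proof (rule integral_dominated_convergence[where w="\<lambda>_. 1"])
        show "AE \<omega> in M. (\<lambda>n. f i (X n i \<omega>)) \<longlonglongrightarrow> f i (Y i \<omega>)"
          using limI by eventually_elim (auto intro!: fc i)
      qed (use f mX[OF i] mY[OF i] in auto)
    qed
    ultimately show "(\<lambda>n. expectation (\<lambda>\<omega>. \<Prod>i\<in>I. f i (X n i \<omega>))) \<longlonglongrightarrow> (\<Prod>i\<in>I. expectation (\<lambda>\<omega>. f i (Y i \<omega>)))"
      by simp
  qed
  show ?thesis
  proof (subst indep_vars_finite[where E="\<lambda>_. {S. open S}"])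
    show "\<forall>A\<in>(\<Pi> i\<in>I. {S. open S}). prob (\<Inter>j\<in>I. Y j -` A j \<inter> space M) = (\<Prod>j\<in>I. prob (Y j -` A j \<inter> space M))"
    proof
      fix A assume "A \<in> (\<Pi> i\<in>I. {S::real set. open S})"
      then have A: "\<And>i. i \<in> I \<Longrightarrow> open (A i)" by auto
      define B where "B i = (if i \<in> I then A i else UNIV)" for i
      have B: "open (B i)" for i using A by (simp add: B_def)
      have mY: "(\<lambda>\<omega>. open_ramp (B i) m (Y i \<omega>)) \<in> borel_measurable M" if "i \<in> I" for i m
        using borel_measurable_continuous_onI[OF continuous_open_ramp] Y[OF that] by (rule measurable_compose[rotated])
      have ev: "Y i -` A i \<inter> space M \<in> events" if "i \<in> I" for i
        using measurable_sets[OF Y[OF that]] A[OF that] by auto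
      have "expectation (\<lambda>\<omega>. \<Prod>i\<in>I. indicat_real (B i) (Y i \<omega>)) = (\<Prod>i\<in>I. expectation (\<lambda>\<omega>. indicat_real (B i) (Y i \<omega>)))"
      proof (rule LIMSEQ_unique)
        show "(\<lambda>m. expectation (\<lambda>\<omega>. \<Prod>i\<in>I. open_ramp (B i) m (Y i \<omega>))) \<longlonglongrightarrow> expectation (\<lambda>\<omega>. \<Prod>i\<in>I. indicat_real (B i) (Y i \<omega>))"
        proof (rule integral_dominated_convergence[where w="\<lambda>_. 1"])
          show "AE \<omega> in M. (\<lambda>m. \<Prod>i\<in>I. open_ramp (B i) m (Y i \<omega>)) \<longlonglongrightarrow> (\<Prod>i\<in>I. indicat_real (B i) (Y i \<omega>))"
            by (intro AE_I2 tendsto_prod open_ramp_tendsto B)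
          show "AE \<omega> in M. norm (\<Prod>i\<in>I. open_ramp (B i) m (Y i \<omega>)) \<le> 1" for m
            by (auto intro!: AE_I2 prod_le_1 simp: prod_nonneg abs_prod open_ramp_bounds)
          show "(\<lambda>\<omega>. \<Prod>i\<in>I. indicat_real (B i) (Y i \<omega>) :: real) \<in> borel_measurable M"
            using Y B by (intro borel_measurable_prod) (auto intro!: measurable_compose[of "Y _" M borel "indicat_real _"])
        qed (use mY in \<open>auto intro!: borel_measurable_prod\<close>)
        have "(\<lambda>m. \<Prod>i\<in>I. expectation (\<lambda>\<omega>. open_ramp (B i) m (Y i \<omega>))) \<longlonglongrightarrow> (\<Prod>i\<in>I. expectation (\<lambda>\<omega>. indicat_real (B i) (Y i \<omega>)))"
        proof (rule tendsto_prod)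
          fix i assume i: "i \<in> I"
          show "(\<lambda>m. expectation (\<lambda>\<omega>. open_ramp (B i) m (Y i \<omega>))) \<longlonglongrightarrow> expectation (\<lambda>\<omega>. indicat_real (B i) (Y i \<omega>))"
          proof (rule integral_dominated_convergence[where w="\<lambda>_. 1"])
            show "AE \<omega> in M. (\<lambda>m. open_ramp (B i) m (Y i \<omega>)) \<longlonglongrightarrow> indicat_real (B i) (Y i \<omega>)"
              by (intro AE_I2 open_ramp_tendsto B)
            show "(\<lambda>\<omega>. indicat_real (B i) (Y i \<omega>) :: real) \<in> borel_measurable M"
              using Y[OF i] B by (auto intro!: measurable_compose[of "Y _" M borel "indicat_real _"])
          qed (use mY[OF i] in \<open>auto simp: open_ramp_bounds\<close>)
        qed
        then show "(\<lambda>m. expectation (\<lambda>\<omega>. \<Prod>i\<in>I. open_ramp (B i) m (Y i \<omega>))) \<longlonglongrightarrow> (\<Prod>i\<in>I. expectation (\<lambda>\<omega>. indicat_real (B i) (Y i \<omega>)))"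
          by (subst cont_case) (auto intro: continuous_open_ramp open_ramp_bounds)
      qed
      moreover have "expectation (\<lambda>\<omega>. \<Prod>i\<in>I. indicat_real (B i) (Y i \<omega>)) = prob (\<Inter>j\<in>I. Y j -` A j \<inter> space M)"
      proof -
        have "expectation (\<lambda>\<omega>. \<Prod>i\<in>I. indicat_real (B i) (Y i \<omega>)) = expectation (indicat_real (\<Inter>j\<in>I. Y j -` A j \<inter> space M))"
        proof (intro Bochner_Integration.integral_cong refl)
          fix \<omega> assume "\<omega> \<in> space M"
          then show "(\<Prod>i\<in>I. indicat_real (B i) (Y i \<omega>)) = (indicat_real (\<Inter>j\<in>I. Y j -` A j \<inter> space M) \<omega> :: real)"
            using \<open>finite I\<close> False by (cases "\<forall>i\<in>I. Y i \<omega> \<in> A i") (auto simp: B_def indicator_def)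
        qed
        then show ?thesis using ev False \<open>finite I\<close> by (simp add: sets.finite_INT)
      qed
      moreover have "expectation (\<lambda>\<omega>. indicat_real (B i) (Y i \<omega>)) = prob (Y i -` A i \<inter> space M)" if "i \<in> I" for i
      proof -
        have "expectation (\<lambda>\<omega>. indicat_real (B i) (Y i \<omega>)) = expectation (indicat_real (Y i -` A i \<inter> space M))"
          using that by (intro Bochner_Integration.integral_cong) (auto simp: B_def indicator_def)
        then show ?thesis using ev[OF that] by simp
      qed
      ultimately show "prob (\<Inter>j\<in>I. Y j -` A j \<inter> space M) = (\<Prod>j\<in>I. prob (Y j -` A j \<inter> space M))" by simp
    qed
    show "sets borel = sigma_sets (space borel) {S::real set. open S}" by (simp add: sets_borel)
  qed (use False \<open>finite I\<close> Y in \<open>auto simp: Int_stable_def\<close>)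
qed

section \<open>The stable subordinator\<close>

definition dyadic_index :: "nat \<Rightarrow> real \<Rightarrow> nat" where
  "dyadic_index n t = nat \<lfloor>2^n * t\<rfloor>"

text \<open>
  The first point of the \<open>n\<close>-th dyadic grid strictly above \<open>t\<close>. Strictness matters: the limits taken
  along these points are right limits, so that the regularised path is right-continuous.
\<close>

definition dyadic_above :: "nat \<Rightarrow> real \<Rightarrow> real" where
  "dyadic_above n t = real (Suc (dyadic_index n t)) / 2^n"

lemma dyadic_index_mono: "s \<le> t \<Longrightarrow> dyadic_index n s \<le> dyadic_index n t"
  unfolding dyadic_index_def by (intro nat_mono floor_mono mult_left_mono) auto

lemma dyadic_above_mono: "s \<le> t \<Longrightarrow> dyadic_above n s \<le> dyadic_above n t"
  unfolding dyadic_above_def using dyadic_index_mono[of s t n] by (intro divide_right_mono) auto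

lemma dyadic_index_bounds:
  assumes "0 \<le> t"
  shows "real (dyadic_index n t) / 2^n \<le> t" "t < dyadic_above n t"
proof -
  have "real (dyadic_index n t) = real_of_int \<lfloor>2^n * t\<rfloor>" using assms by (simp add: dyadic_index_def)
  then have "real (dyadic_index n t) \<le> 2^n * t" "2^n * t < real (Suc (dyadic_index n t))" by linarith+
  then show "real (dyadic_index n t) / 2^n \<le> t" "t < dyadic_above n t"
    unfolding dyadic_above_def by (simp_all add: divide_le_eq less_divide_eq mult.commute del: of_nat_Suc)
qed

lemma dyadic_above_eq: "dyadic_above n t = real (dyadic_index n t) / 2^n + 1 / 2^n"
  by (simp add: dyadic_above_def add_divide_distrib)

lemma dyadic_above_tendsto:
  assumes "0 \<le> t"
  shows "(\<lambda>n. real (dyadic_index n t) / 2^n) \<longlonglongrightarrow> t" "(\<lambda>n. dyadic_above n t) \<longlonglongrightarrow> t"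
proof -
  have z: "(\<lambda>n. 1 / 2^n :: real) \<longlonglongrightarrow> 0"
    using LIMSEQ_divide_realpow_zero[of 2 1] by simp
  have le: "t - 1 / 2^n \<le> real (dyadic_index n t) / 2^n" for n
    using dyadic_index_bounds(2)[OF assms, of n] dyadic_above_eq[of n t] by linarith
  show 1: "(\<lambda>n. real (dyadic_index n t) / 2^n) \<longlonglongrightarrow> t"
  proof (rule tendsto_sandwich)
    show "\<forall>\<^sub>F n in sequentially. t - 1 / 2^n \<le> real (dyadic_index n t) / 2^n" using le by simp
    show "\<forall>\<^sub>F n in sequentially. real (dyadic_index n t) / 2^n \<le> t" using dyadic_index_bounds(1)[OF assms] by simp
    show "(\<lambda>n. t - 1 / 2^n) \<longlonglongrightarrow> t" using tendsto_diff[OF tendsto_const z, of t] by simp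
  qed simp
  show "(\<lambda>n. dyadic_above n t) \<longlonglongrightarrow> t"
    using tendsto_add[OF 1 z] by (simp add: dyadic_above_eq)
qed

lemma dyadic_above_decseq:
  assumes "0 \<le> t"
  shows "decseq (\<lambda>n. dyadic_above n t)"
proof (rule decseq_SucI)
  fix n
  have "\<lfloor>2 * (2^n * t)\<rfloor> \<le> 2 * \<lfloor>2^n * t\<rfloor> + 1" by linarith
  then have "dyadic_index (Suc n) t \<le> 2 * dyadic_index n t + 1"
    unfolding dyadic_index_def by (simp add: mult.assoc nat_le_iff)
  then have "real (Suc (dyadic_index (Suc n) t)) \<le> 2 * real (Suc (dyadic_index n t))" by simp
  then show "dyadic_above (Suc n) t \<le> dyadic_above n t"
    unfolding dyadic_above_def by (simp add: field_simps del: of_nat_Suc)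
qed

locale dyadic_process = positive_stable_law + prob_space N for N :: "(real \<Rightarrow> real) measure" +
  assumes sets_N: "sets N = sets (PiM dyadics (\<lambda>_. borel))"
    and fdd: "\<And>n J. finite J \<Longrightarrow> J \<subseteq> dyadics_at n \<Longrightarrow> distr N (PiM J (\<lambda>_. borel)) (\<lambda>\<omega>. restrict \<omega> J) = grid_fdd n J"
begin

definition incr :: "nat \<Rightarrow> nat \<Rightarrow> (real \<Rightarrow> real) \<Rightarrow> real" where
  "incr n i \<omega> = \<omega> (real (Suc i) / 2^n) - \<omega> (real i / 2^n)"

lemma incr_indep: "indep_vars (\<lambda>_. borel) (incr n) {..<K}"
  using dyadic_process_increments(1)[OF prob_space_axioms sets_N fdd] unfolding incr_def by blast

lemma incr_law: "distr N borel (incr n i) = law (1 / 2^n)"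
  using dyadic_process_increments(2)[OF prob_space_axioms sets_N fdd, of i "Suc i" n] unfolding incr_def by simp

lemma AE_start: "AE \<omega> in N. \<omega> 0 = 0"
  using dyadic_process_increments(3)[OF prob_space_axioms sets_N fdd] .

lemma dyadic_mem: "real i / 2^n \<in> dyadics"
  unfolding dyadics_def dyadics_at_def by blast

lemma dyadic_above_mem: "dyadic_above n t \<in> dyadics"
  unfolding dyadic_above_def by (rule dyadic_mem)

lemma coord_measurable: "t \<in> dyadics \<Longrightarrow> (\<lambda>\<omega>. \<omega> t) \<in> borel_measurable N"
  using measurable_component_singleton[of t dyadics "\<lambda>_. borel"] sets_N by (simp cong: measurable_cong_sets)

lemma incr_measurable [measurable]: "incr n i \<in> borel_measurable N"
  unfolding incr_def by (intro borel_measurable_diff coord_measurable dyadic_mem)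

text \<open>
  Almost every dyadic path is good. On the other paths the process is set to \<open>0\<close>, so that all paths
  are cadlag.
\<close>

definition good_path :: "(real \<Rightarrow> real) \<Rightarrow> bool" where
  "good_path \<omega> \<longleftrightarrow> \<omega> 0 = 0 \<and> (\<forall>n i. 0 \<le> incr n i \<omega>)"

lemma good_path_measurable [measurable]: "Measurable.pred N good_path"
proof -
  have [measurable]: "(\<lambda>\<omega>. \<omega> 0) \<in> borel_measurable N" using coord_measurable[OF dyadic_mem[of 0 0]] by simp
  show ?thesis unfolding good_path_def by measurable
qed

lemma AE_good_path: "AE \<omega> in N. good_path \<omega>"
proof -
  have "AE \<omega> in N. 0 \<le> incr n i \<omega>" for n i
  proof -
    have "AE x in distr N borel (incr n i). 0 \<le> x" unfolding incr_law by (rule law_nonneg)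
    then show ?thesis by (subst (asm) AE_distr_iff) auto
  qed
  then show ?thesis unfolding good_path_def using AE_start by (auto simp: AE_all_countable)
qed

lemma good_path_mono:
  assumes g: "good_path \<omega>" and st: "s \<in> dyadics" "t \<in> dyadics" "s \<le> t"
  shows "\<omega> s \<le> \<omega> t"
proof -
  obtain n where "{s,t} \<subseteq> dyadics_at n" using finite_dyadics_level[of "{s,t}"] st by auto
  then obtain i j :: nat where ij: "s = real i / 2^n" "t = real j / 2^n" by (auto simp: dyadics_at_def)
  have "incseq (\<lambda>i::nat. \<omega> (real i / 2^n))"
    using g by (intro incseq_SucI) (auto simp: good_path_def incr_def simp del: of_nat_Suc)
  moreover have "i \<le> j" using st(3) unfolding ij by (simp add: divide_le_cancel)
  ultimately show ?thesis unfolding ij by (rule incseqD)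
qed

definition G :: "real \<Rightarrow> (real \<Rightarrow> real) \<Rightarrow> real" where
  "G t \<omega> = (if good_path \<omega> then lim (\<lambda>n. \<omega> (dyadic_above n t)) else 0)"

lemma G_measurable [measurable]: "G t \<in> borel_measurable N"
proof -
  have [measurable]: "(\<lambda>\<omega>. \<omega> (dyadic_above n t)) \<in> borel_measurable N" for n
    by (rule coord_measurable[OF dyadic_above_mem])
  show ?thesis unfolding G_def by measurable
qed

lemma G_limit:
  assumes g: "good_path \<omega>" and t: "0 \<le> t"
  shows "(\<lambda>n. \<omega> (dyadic_above n t)) \<longlonglongrightarrow> G t \<omega>"
    and "\<And>r. r \<in> dyadics \<Longrightarrow> t < r \<Longrightarrow> G t \<omega> \<le> \<omega> r"
    and "\<And>q. q \<in> dyadics \<Longrightarrow> q \<le> t \<Longrightarrow> \<omega> q \<le> G t \<omega>"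
proof -
  have dec: "decseq (\<lambda>n. \<omega> (dyadic_above n t))"
    using dyadic_above_decseq[OF t] good_path_mono[OF g dyadic_above_mem dyadic_above_mem]
    unfolding decseq_def by blast
  have low: "\<omega> q \<le> \<omega> (dyadic_above n t)" if "q \<in> dyadics" "q \<le> t" for q n
    using that dyadic_index_bounds(2)[OF t, of n] by (intro good_path_mono[OF g] dyadic_above_mem) auto
  have zero: "0 \<in> dyadics" using dyadic_mem[of 0 0] by simp
  have "bdd_below (range (\<lambda>n. \<omega> (dyadic_above n t)))"
    using low[OF zero t] by (intro bdd_belowI[of _ "\<omega> 0"]) auto
  from LIMSEQ_decseq_INF[OF this dec] have "convergent (\<lambda>n. \<omega> (dyadic_above n t))"
    unfolding convergent_def by blast
  then show lim: "(\<lambda>n. \<omega> (dyadic_above n t)) \<longlonglongrightarrow> G t \<omega>"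
    using g by (simp add: G_def convergent_LIMSEQ_iff)
  show "G t \<omega> \<le> \<omega> r" if r: "r \<in> dyadics" "t < r" for r
  proof (rule LIMSEQ_le_const2[OF lim])
    have "\<forall>\<^sub>F n in sequentially. dyadic_above n t < r"
      using order_tendstoD(2)[OF dyadic_above_tendsto(2)[OF t] r(2)] .
    then have "\<forall>\<^sub>F n in sequentially. \<omega> (dyadic_above n t) \<le> \<omega> r"
      by eventually_elim (use r in \<open>auto intro!: good_path_mono[OF g] dyadic_above_mem\<close>)
    then show "\<exists>N. \<forall>n\<ge>N. \<omega> (dyadic_above n t) \<le> \<omega> r" by (simp add: eventually_sequentially)
  qed
  show "\<omega> q \<le> G t \<omega>" if "q \<in> dyadics" "q \<le> t" for q
    by (rule LIMSEQ_le_const[OF lim]) (use low[OF that] in blast)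
qed

lemma G_mono:
  assumes "0 \<le> s" "s \<le> t"
  shows "G s \<omega> \<le> G t \<omega>"
proof (cases "good_path \<omega>")
  case True
  show ?thesis
  proof (rule LIMSEQ_le[OF G_limit(1)[OF True] G_limit(1)[OF True]])
    show "\<exists>N. \<forall>n\<ge>N. \<omega> (dyadic_above n s) \<le> \<omega> (dyadic_above n t)"
      using assms by (auto intro!: good_path_mono[OF True] dyadic_above_mem dyadic_above_mono)
  qed (use assms in auto)
qed (simp add: G_def)

lemma G_right_limit:
  assumes "0 \<le> s" "e > 0"
  shows "\<exists>r>s. G r \<omega> < G s \<omega> + e"
proof (cases "good_path \<omega>")
  case True
  have "\<forall>\<^sub>F n in sequentially. \<omega> (dyadic_above n s) < G s \<omega> + e"
    using G_limit(1)[OF True assms(1)] assms(2) by (intro order_tendstoD(2)) auto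
  then obtain n where n: "\<omega> (dyadic_above n s) < G s \<omega> + e" by (auto simp: eventually_sequentially)
  define r where "r = (s + dyadic_above n s) / 2"
  have r: "s < r" "r < dyadic_above n s" using dyadic_index_bounds(2)[OF assms(1), of n] by (auto simp: r_def)
  have "G r \<omega> \<le> \<omega> (dyadic_above n s)" using r assms by (intro G_limit(2)[OF True] dyadic_above_mem) auto
  then show ?thesis using n r by auto
next
  case False
  then show ?thesis using assms by (intro exI[of _ "s + 1"]) (simp add: G_def)
qed

lemma G_cadlag: "sample_path G \<omega> \<in> cadlag_space"
  unfolding sample_path_def by (rule monotone_path_cadlag) (use G_mono G_right_limit in auto)

text \<open>
  Characteristic functions identify the law of the limit, since they depend continuously on the
  length of the interval.
\<close>

lemma AE_limit_law:
  fixes Z :: "nat \<Rightarrow> (real \<Rightarrow> real) \<Rightarrow> real"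
  assumes Z: "\<And>n. Z n \<in> borel_measurable N" "Y \<in> borel_measurable N"
    and lim: "AE \<omega> in N. (\<lambda>n. Z n \<omega>) \<longlonglongrightarrow> Y \<omega>"
    and law: "\<And>n. distr N borel (Z n) = law (c n)" "\<And>n. 0 \<le> c n" "c \<longlonglongrightarrow> c'"
  shows "distr N borel Y = law c'"
proof (rule law_eqI)
  show "real_distribution (distr N borel Y)" using Z by (intro real_distribution_distr)
  show "0 \<le> c'" using LIMSEQ_le_const[OF law(3)] law(2) by blast
  fix \<theta>
  note [measurable] = Z
  show "char (distr N borel Y) \<theta> = exp (of_real c' * stable_exponent \<alpha> \<theta>)"
  proof (rule LIMSEQ_unique)
    show "(\<lambda>n. char (distr N borel (Z n)) \<theta>) \<longlonglongrightarrow> char (distr N borel Y) \<theta>"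
      unfolding char_def
    proof (subst (1 2) integral_distr)
      show "(\<lambda>n. CLINT x|N. iexp (\<theta> * Z n x)) \<longlonglongrightarrow> (CLINT x|N. iexp (\<theta> * Y x))"
      proof (rule integral_dominated_convergence[where w="\<lambda>_. 1"])
        show "AE x in N. (\<lambda>n. iexp (\<theta> * Z n x)) \<longlonglongrightarrow> iexp (\<theta> * Y x)"
          using lim by eventually_elim (intro tendsto_intros)
      qed (auto simp del: of_real_mult)
    qed (use Z in auto)
    show "(\<lambda>n. char (distr N borel (Z n)) \<theta>) \<longlonglongrightarrow> exp (of_real c' * stable_exponent \<alpha> \<theta>)"
      unfolding law(1) char_law[OF law(2)] by (intro tendsto_intros law(3))
  qed
qed

lemma block_increment:
  assumes "a \<le> b"
  shows "\<omega> (real b / 2^n) - \<omega> (real a / 2^n) = (\<Sum>j\<in>{a..<b}. incr n j \<omega>)"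
  using sum_Suc_diff'[OF assms, of "\<lambda>i. \<omega> (real i / 2^n)"] by (simp add: incr_def)

lemma block_law:
  assumes "a \<le> b"
  shows "distr N borel (\<lambda>\<omega>. \<omega> (real b / 2^n) - \<omega> (real a / 2^n)) = law (real (b - a) / 2^n)"
proof -
  have "distr N borel (\<lambda>\<omega>. \<Sum>j\<in>{a..<b}. incr n j \<omega>) = law (\<Sum>j\<in>{a..<b}. 1 / 2^n)"
    by (rule sum_law[OF prob_space_axioms indep_vars_subset[OF incr_indep[of n b]]]) (auto simp: incr_law)
  then show ?thesis unfolding block_increment[OF assms] by simp
qed

lemma G_law:
  assumes "0 \<le> t"
  shows "distr N borel (G t) = law t"
proof (rule AE_limit_law)
  let ?Z = "\<lambda>n \<omega>. \<omega> (dyadic_above n t) - \<omega> (real 0 / 2^n)"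
  show "?Z n \<in> borel_measurable N" for n
    by (intro borel_measurable_diff coord_measurable dyadic_above_mem dyadic_mem)
  show "AE \<omega> in N. (\<lambda>n. ?Z n \<omega>) \<longlonglongrightarrow> G t \<omega>"
    using AE_good_path
  proof eventually_elim
    case (elim \<omega>)
    then have "\<omega> 0 = 0" by (simp add: good_path_def)
    then show ?case using G_limit(1)[OF elim assms] by simp
  qed
  show "distr N borel (?Z n) = law (real (Suc (dyadic_index n t) - 0) / 2^n)" for n
    unfolding dyadic_above_def by (rule block_law) simp
  show "(\<lambda>n. real (Suc (dyadic_index n t) - 0) / 2^n) \<longlonglongrightarrow> t"
    using dyadic_above_tendsto(2)[OF assms] by (simp add: dyadic_above_def)
qed auto

lemma G_increment_law:
  assumes "0 \<le> s" "0 \<le> t"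
  shows "distr N borel (\<lambda>\<omega>. G (s + t) \<omega> - G s \<omega>) = law t"
proof (rule AE_limit_law)
  let ?Z = "\<lambda>n \<omega>. \<omega> (dyadic_above n (s + t)) - \<omega> (dyadic_above n s)"
  have le: "dyadic_index n s \<le> dyadic_index n (s + t)" for n using assms by (intro dyadic_index_mono) auto
  show "?Z n \<in> borel_measurable N" for n
    by (intro borel_measurable_diff coord_measurable dyadic_above_mem)
  show "AE \<omega> in N. (\<lambda>n. ?Z n \<omega>) \<longlonglongrightarrow> G (s + t) \<omega> - G s \<omega>"
    using AE_good_path by eventually_elim (use assms in \<open>auto intro!: tendsto_diff G_limit\<close>)
  show "distr N borel (?Z n) = law (real (Suc (dyadic_index n (s + t)) - Suc (dyadic_index n s)) / 2^n)" for n
    unfolding dyadic_above_def using le by (intro block_law) simp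
  have "real (Suc (dyadic_index n (s + t)) - Suc (dyadic_index n s)) / 2^n = dyadic_above n (s + t) - dyadic_above n s" for n
    unfolding dyadic_above_eq using le[of n] by (simp add: of_nat_diff diff_divide_distrib)
  moreover have "(\<lambda>n. dyadic_above n (s + t) - dyadic_above n s) \<longlonglongrightarrow> (s + t) - s"
    using assms by (intro tendsto_diff dyadic_above_tendsto) auto
  ultimately show "(\<lambda>n. real (Suc (dyadic_index n (s + t)) - Suc (dyadic_index n s)) / 2^n) \<longlonglongrightarrow> t" by simp
qed auto

text \<open>
  At level \<open>n\<close> the increments are sums over disjoint blocks of independent grid increments.
\<close>

lemma G_indep:
  fixes t :: "nat \<Rightarrow> real"
  assumes t: "0 \<le> t 0" "mono t"
  shows "indep_vars (\<lambda>_. borel) (\<lambda>i \<omega>. G (t (Suc i)) \<omega> - G (t i) \<omega>) {..<m}"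
proof (rule indep_vars_AE_limit)
  let ?k = "\<lambda>n i. Suc (dyadic_index n (t i))"
  have t0: "0 \<le> t i" for i using t monoD[OF t(2), of 0 i] by simp
  have kmono: "?k n i \<le> ?k n j" if "i \<le> j" for n i j
    using dyadic_index_mono[of "t i" "t j" n] monoD[OF t(2) that] by simp
  show "indep_vars (\<lambda>_. borel) (\<lambda>i \<omega>. \<omega> (dyadic_above n (t (Suc i))) - \<omega> (dyadic_above n (t i))) {..<m}" for n
  proof -
    have "indep_vars (\<lambda>i. PiM {?k n i..<?k n (Suc i)} (\<lambda>_. borel))
      (\<lambda>i \<omega>. restrict (\<lambda>j. incr n j \<omega>) {?k n i..<?k n (Suc i)}) {..<m}"
    proof (rule indep_vars_restrict[OF incr_indep[of n "?k n m"]])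
      show "{?k n i..<?k n (Suc i)} \<subseteq> {..<?k n m}" if "i \<in> {..<m}" for i
        using that kmono[of "Suc i" m n] by auto
      show "disjoint_family_on (\<lambda>i. {?k n i..<?k n (Suc i)}) {..<m}"
        unfolding disjoint_family_on_def
      proof (intro ballI impI)
        fix i j :: nat assume "i \<noteq> j"
        then consider "Suc i \<le> j" | "Suc j \<le> i" by linarith
        then show "{?k n i..<?k n (Suc i)} \<inter> {?k n j..<?k n (Suc j)} = {}"
          by cases (use kmono[of "Suc i" j n] kmono[of "Suc j" i n] in auto)
      qed
    qed
    then have "indep_vars (\<lambda>_. borel) (\<lambda>i \<omega>. (\<lambda>y. \<Sum>j\<in>{?k n i..<?k n (Suc i)}. y j)
       (restrict (\<lambda>j. incr n j \<omega>) {?k n i..<?k n (Suc i)})) {..<m}"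
      by (rule indep_vars_compose2) (intro borel_measurable_sum measurable_component_singleton)
    also have "(\<lambda>i \<omega>. (\<lambda>y. \<Sum>j\<in>{?k n i..<?k n (Suc i)}. y j) (restrict (\<lambda>j. incr n j \<omega>) {?k n i..<?k n (Suc i)})) =
      (\<lambda>i \<omega>. \<omega> (dyadic_above n (t (Suc i))) - \<omega> (dyadic_above n (t i)))"
      unfolding dyadic_above_def by (subst block_increment) (use kmono in auto)
    finally show ?thesis .
  qed
  show "AE \<omega> in N. (\<lambda>n. \<omega> (dyadic_above n (t (Suc i))) - \<omega> (dyadic_above n (t i))) \<longlonglongrightarrow> G (t (Suc i)) \<omega> - G (t i) \<omega>" for i
    using AE_good_path by eventually_elim (use t0 in \<open>auto intro!: tendsto_diff G_limit\<close>)
qed auto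

lemma G_stable_subordinator: "stable_subordinator N \<alpha> G"
  unfolding stable_subordinator_def stable_levy_process_def levy_process_def
proof (intro conjI allI impI ballI)
  show "AE \<omega> in N. G 0 \<omega> = 0"
  proof -
    have "AE x in law 0. x = 0" unfolding law_def by (subst AE_distr_iff) auto
    then have "AE x in distr N borel (G 0). x = 0" unfolding G_law[OF order_refl] .
    then show ?thesis by (subst (asm) AE_distr_iff) auto
  qed
  show "distr N borel (G k) = distr N borel (\<lambda>\<omega>. k powr (1/\<alpha>) * G 1 \<omega>)" if "0 < k" for k
  proof -
    have "distr N borel (\<lambda>\<omega>. k powr (1/\<alpha>) * G 1 \<omega>) = distr (distr N borel (G 1)) borel (\<lambda>x. k powr (1/\<alpha>) * x)"
      by (subst distr_distr) (auto simp: comp_def)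
    then show ?thesis using that by (simp add: G_law law_1) (simp add: law_def)
  qed
  show "AE \<omega> in N. mono_on {0..} (\<lambda>s. G s \<omega>)" using G_mono by (auto intro!: AE_I2 mono_onI)
  show "\<nexists>c. AE \<omega> in N. G 1 \<omega> = c"
  proof
    assume "\<exists>c. AE \<omega> in N. G 1 \<omega> = c"
    then obtain c where "AE \<omega> in N. G 1 \<omega> = c" by blast
    then have "AE x in distr N borel (G 1). x = c" by (subst AE_distr_iff) auto
    then have "AE x in \<mu>. x = c" unfolding G_law[OF zero_le_one] law_1 .
    then have "measure \<mu> {c} = 1" by (intro law1.prob_eq_1[THEN iffD2]) auto
    then show False using no_atoms[of c] by simp
  qed
qed (auto intro: prob_space_axioms G_cadlag G_indep simp: G_law G_increment_law)

end

theorem stable_subordinator_exists: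
  assumes "positive_stable_law \<alpha> \<mu>"
  shows "\<exists>(N :: (real \<Rightarrow> real) measure) G. stable_subordinator N \<alpha> G \<and> distr N borel (G 1) = \<mu>"
proof -
  interpret positive_stable_law \<alpha> \<mu> by fact
  obtain N :: "(real \<Rightarrow> real) measure" where N: "prob_space N" "sets N = sets (PiM dyadics (\<lambda>_. borel))"
    "\<And>n J. finite J \<Longrightarrow> J \<subseteq> dyadics_at n \<Longrightarrow> distr N (PiM J (\<lambda>_. borel)) (\<lambda>\<omega>. restrict \<omega> J) = grid_fdd n J"
    using dyadic_process_exists by blast
  interpret N: prob_space N by (rule N)
  interpret dyadic_process \<alpha> \<mu> N by unfold_locales (use N in auto)
  show ?thesis using G_stable_subordinator G_law[of 1] by (auto simp: law_1)
qed

lemma positive_stable_law_exists: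
  assumes "0 < \<alpha>" "\<alpha> < 1"
  shows "\<exists>\<mu>. positive_stable_law \<alpha> \<mu>"
  using stable_law_exists[OF assms] assms unfolding positive_stable_law_def by blast

section \<open>Monotone coupling of regularly varying laws\<close>

text \<open>
  For monotone functions, closeness at the points of a grid of mesh \<open>\<delta>/2\<close> implies closeness in
  between.
\<close>

lemma monotone_convergence_to_identity_uniform:
  fixes f :: "nat \<Rightarrow> real \<Rightarrow> real"
  assumes mono: "\<And>n x y. a \<le> x \<Longrightarrow> x \<le> y \<Longrightarrow> f n x \<le> f n y"
    and lim: "\<And>x. a \<le> x \<Longrightarrow> (\<lambda>n. f n x) \<longlonglongrightarrow> x" and "\<delta> > 0"
  shows "\<forall>\<^sub>F n in sequentially. \<forall>x\<in>{a..T}. \<bar>f n x - x\<bar> < \<delta>"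
proof -
  define x where "x j = a + real j * (\<delta>/2)" for j :: nat
  define J where "J = nat \<lceil>(T - a) / (\<delta>/2)\<rceil>"
  have xa: "a \<le> x j" for j using \<open>\<delta> > 0\<close> by (simp add: x_def)
  have "\<forall>\<^sub>F n in sequentially. \<forall>j\<in>{..Suc J}. \<bar>f n (x j) - x j\<bar> < \<delta>/2"
  proof (rule eventually_ball_finite)
    show "\<forall>j\<in>{..Suc J}. \<forall>\<^sub>F n in sequentially. \<bar>f n (x j) - x j\<bar> < \<delta>/2"
      using tendstoD[OF lim[OF xa], of "\<delta>/2"] \<open>\<delta> > 0\<close> by (simp add: dist_real_def)
  qed simp
  then show ?thesis
  proof eventually_elim
    case (elim n)
    show ?case
    proof
      fix y assume y: "y \<in> {a..T}"
      define j where "j = nat \<lfloor>(y - a) / (\<delta>/2)\<rfloor>"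
      have nn: "(y - a) / (\<delta>/2) \<ge> 0" using y \<open>\<delta> > 0\<close> by simp
      then have "real j \<le> (y - a) / (\<delta>/2)" "(y - a) / (\<delta>/2) \<le> real (Suc j)" unfolding j_def by linarith+
      then have b: "x j \<le> y" "y \<le> x (Suc j)" unfolding x_def using \<open>\<delta> > 0\<close> by (simp_all add: field_simps)
      have xs: "x (Suc j) = x j + \<delta>/2" unfolding x_def by (simp add: algebra_simps)
      have "(y - a) / (\<delta>/2) \<le> (T - a) / (\<delta>/2)" using y \<open>\<delta> > 0\<close> by (intro divide_right_mono) auto
      then have "j \<le> J" unfolding j_def J_def by linarith
      then have "\<bar>f n (x j) - x j\<bar> < \<delta>/2" "\<bar>f n (x (Suc j)) - x (Suc j)\<bar> < \<delta>/2" using elim by auto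
      moreover have "f n (x j) \<le> f n y" "f n y \<le> f n (x (Suc j))" using mono b xa y by auto
      ultimately show "\<bar>f n y - y\<bar> < \<delta>" using b xs by linarith
    qed
  qed
qed

context positive_stable_law
begin

definition upper_tail :: "real \<Rightarrow> real" where "upper_tail x = measure \<mu> {x<..}"

lemma upper_tail_antimono: "x \<le> y \<Longrightarrow> upper_tail y \<le> upper_tail x"
  unfolding upper_tail_def by (intro law1.finite_measure_mono) auto

lemma upper_tail_cdf: "upper_tail x = 1 - cdf \<mu> x"
proof -
  have "{x<..} = space \<mu> - {..x}" by auto
  then show ?thesis unfolding upper_tail_def using law1.prob_compl[of "{..x}"] by (simp add: cdf_def)
qed

lemma upper_tail_pos: "0 < upper_tail x"
proof -
  have "\<forall>\<^sub>F x in at_top. 0 < x powr \<alpha> * upper_tail x" using order_tendstoD(1)[OF tail, of 0] by (simp add: upper_tail_def)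
  then obtain b where b: "\<And>y. y \<ge> b \<Longrightarrow> 0 < y powr \<alpha> * upper_tail y" by (auto simp: eventually_at_top_linorder)
  have "0 < upper_tail (max b x)" using b[of "max b x"] by (simp add: zero_less_mult_iff)
  then show ?thesis using upper_tail_antimono[of x "max b x"] by simp
qed

definition norming :: "nat \<Rightarrow> real" where "norming n = real n powr (1/\<alpha>)"

lemma norming_at_top: "filterlim norming at_top sequentially"
  unfolding norming_def using \<alpha> by (intro filterlim_compose[OF filterlim_powr_at_top filterlim_real_sequentially]) auto

lemma norming_tail:
  assumes "0 < y"
  shows "(\<lambda>n. real n * upper_tail (norming n * y)) \<longlonglongrightarrow> y powr (-\<alpha>)"
proof -
  have "filterlim (\<lambda>n. norming n * y) at_top sequentially"
    using assms by (intro filterlim_at_top_mult_tendsto_pos[OF tendsto_const] norming_at_top) auto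
  from filterlim_compose[OF tail this]
  have "(\<lambda>n. y powr (-\<alpha>) * ((norming n * y) powr \<alpha> * upper_tail (norming n * y))) \<longlonglongrightarrow> y powr (-\<alpha>) * 1"
    unfolding upper_tail_def by (intro tendsto_mult tendsto_const)
  moreover have "y powr (-\<alpha>) * ((norming n * y) powr \<alpha> * upper_tail (norming n * y)) = real n * upper_tail (norming n * y)" for n
  proof -
    have "(norming n * y) powr \<alpha> = real n * y powr \<alpha>"
      unfolding norming_def using \<alpha> by (simp add: powr_mult powr_powr)
    then show ?thesis using assms by (simp add: powr_minus)
  qed
  ultimately show ?thesis by simp
qed

lemma trunc_bound: "\<exists>C>0. \<exists>z0>0. \<forall>z\<ge>z0. (\<integral>x. min x z \<partial>\<mu>) \<le> C * (z * upper_tail z)"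
  unfolding upper_tail_def
proof (rule truncated_mean_bound[OF real_distribution nonneg \<alpha>])
  have "filterlim (\<lambda>z::real. 2 * z) at_top at_top"
    by (intro filterlim_tendsto_pos_mult_at_top[OF tendsto_const] filterlim_ident) auto
  from filterlim_compose[OF tail this]
  have "((\<lambda>z. 2 powr (-\<alpha>) * (((2 * z) powr \<alpha> * upper_tail (2 * z)) / (z powr \<alpha> * upper_tail z))) \<longlongrightarrow> 2 powr (-\<alpha>) * (1 / 1)) at_top"
    using tail unfolding upper_tail_def by (intro tendsto_mult tendsto_const tendsto_divide) auto
  moreover have "\<forall>\<^sub>F z in at_top. 2 powr (-\<alpha>) * (((2 * z) powr \<alpha> * upper_tail (2 * z)) / (z powr \<alpha> * upper_tail z)) =
      measure \<mu> {2 * z<..} / measure \<mu> {z<..}"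
    using eventually_gt_at_top[of 0]
    by eventually_elim (simp add: powr_mult upper_tail_def powr_minus)
  ultimately show "((\<lambda>z. measure \<mu> {2 * z<..} / measure \<mu> {z<..}) \<longlongrightarrow> 2 powr (-\<alpha>)) at_top"
    by (auto intro: Lim_transform_eventually)
qed

text \<open>
  The continuous distribution function of a random variable, evaluated at that variable, is uniform.
\<close>

lemma cdf_sublevel:
  assumes p: "0 \<le> p" "p \<le> 1"
  shows "measure \<mu> {x. cdf \<mu> x \<le> p} = p"
proof -
  let ?A = "{x. cdf \<mu> x \<le> p}"
  have cont: "isCont (cdf \<mu>) x" for x using no_atoms by (simp add: law1.isCont_cdf)
  consider "p = 1" | "p < 1" "?A = {}" | "p < 1" "?A \<noteq> {}" using p by linarith
  then show ?thesis
  proof cases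
    case 1 then show ?thesis using law1.cdf_bounded_prob law1.prob_space by simp
  next
    case 2
    have "p = 0"
    proof (rule ccontr)
      assume "p \<noteq> 0"
      then have "\<forall>\<^sub>F x in at_bot. cdf \<mu> x < p" using p by (intro order_tendstoD(2)[OF law1.cdf_lim_at_bot]) auto
      then obtain x where "cdf \<mu> x < p" by (auto simp: eventually_at_bot_linorder)
      then have "x \<in> ?A" by simp
      then show False using 2(2) by blast
    qed
    then show ?thesis using 2 by simp
  next
    case 3
    have "\<forall>\<^sub>F x in at_top. p < cdf \<mu> x" using 3 by (intro order_tendstoD(1)[OF law1.cdf_lim_at_top_prob]) auto
    then obtain b where b: "p < cdf \<mu> b" by (auto simp: eventually_at_top_linorder)
    have bdd: "bdd_above ?A"
    proof (rule bdd_aboveI[of _ b])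
      fix x assume "x \<in> ?A"
      then show "x \<le> b" using b law1.cdf_nondecreasing[of b x] by (cases "x \<le> b") auto
    qed
    define s where "s = Sup ?A"
    have closed: "closed ?A" using cont by (intro closed_Collect_le continuous_at_imp_continuous_on) auto
    have s: "s \<in> ?A" unfolding s_def using closed_contains_Sup[OF 3(2) bdd closed] .
    have A: "?A = {..s}"
    proof
      show "?A \<subseteq> {..s}" unfolding s_def using bdd by (auto intro: cSup_upper)
      show "{..s} \<subseteq> ?A" using s law1.cdf_nondecreasing by (auto intro: order_trans)
    qed
    have "p \<le> cdf \<mu> s"
    proof (rule tendsto_lowerbound)
      show "(cdf \<mu> \<longlongrightarrow> cdf \<mu> s) (at_right s)"
        using law1.cdf_is_right_cont[of s] by (simp add: continuous_within)
      have "p \<le> cdf \<mu> x" if "x > s" for x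
      proof -
        have "x \<notin> ?A" using A that by auto
        then show ?thesis by simp
      qed
      then show "\<forall>\<^sub>F x in at_right s. p \<le> cdf \<mu> x" by (auto simp: eventually_at_right_less eventually_at_filter)
    qed simp
    then have "cdf \<mu> s = p" using s by auto
    then show ?thesis unfolding A by (simp add: cdf_def)
  qed
qed

end

text \<open>
  \<open>Q\<close> is the law of a reward and \<open>a\<close> its norming sequence. Regular variation enters only through the
  vague convergence \<open>Q_tail\<close> of the rescaled tails and the bound \<open>Q_trunc\<close> on truncated means.
\<close>

locale tail_coupling = positive_stable_law +
  fixes Q :: "real measure" and a :: "nat \<Rightarrow> real"
  assumes Q: "real_distribution Q" and Q_nonneg: "AE x in Q. 0 \<le> x"
    and Q_tail: "\<And>y. 0 < y \<Longrightarrow> (\<lambda>n. real n * measure Q {a n * y<..}) \<longlonglongrightarrow> y powr (-\<alpha>)"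
    and a_top: "filterlim a at_top sequentially"
    and Q_trunc: "\<exists>C>0. \<exists>z0>0. \<forall>z\<ge>z0. (\<integral>x. min x z \<partial>Q) \<le> C * (z * measure Q {z<..})"
begin

sublocale Q: real_distribution Q by (rule Q)

definition Q_upper_tail :: "real \<Rightarrow> real" where "Q_upper_tail x = measure Q {x<..}"

lemma Q_upper_tail_cdf: "Q_upper_tail x = 1 - cdf Q x"
proof -
  have "{x<..} = space Q - {..x}" by auto
  then show ?thesis unfolding Q_upper_tail_def using Q.prob_compl[of "{..x}"] by (simp add: cdf_def)
qed

text \<open>
  The nondecreasing rearrangement of \<open>\<mu>\<close> into \<open>Q\<close>: the quantile function of \<open>Q\<close> composed with the
  distribution function of \<open>\<mu>\<close>, written with upper tails.
\<close>

definition match :: "real \<Rightarrow> real" where "match x = Inf {y. 0 \<le> y \<and> Q_upper_tail y \<le> upper_tail x}"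

lemma match_le_iff:
  assumes "0 \<le> y"
  shows "match x \<le> y \<longleftrightarrow> Q_upper_tail y \<le> upper_tail x"
proof -
  let ?A = "{y. 0 \<le> y \<and> Q_upper_tail y \<le> upper_tail x}"
  have bdd: "bdd_below ?A" by (rule bdd_belowI[of _ 0]) auto
  have "(Q_upper_tail \<longlongrightarrow> 1 - 1) at_top" unfolding Q_upper_tail_cdf using Q.cdf_lim_at_top_prob by (intro tendsto_diff tendsto_const)
  then have "\<forall>\<^sub>F y in at_top. Q_upper_tail y < upper_tail x" using upper_tail_pos[of x] by (intro order_tendstoD(2)) auto
  then have "\<forall>\<^sub>F y in at_top. Q_upper_tail y < upper_tail x \<and> 0 \<le> y" using eventually_ge_at_top by (rule eventually_conj)
  then have ne: "?A \<noteq> {}" by (auto simp: eventually_at_top_linorder intro: less_imp_le)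
  show ?thesis
  proof
    assume "Q_upper_tail y \<le> upper_tail x"
    then show "match x \<le> y" unfolding match_def using bdd assms by (intro cInf_lower) auto
  next
    assume le: "match x \<le> y"
    have up: "Q_upper_tail z \<le> upper_tail x" if "y < z" for z
    proof -
      have "Inf ?A < z" using le that by (simp add: match_def)
      then obtain w where w: "w \<in> ?A" "w < z" using cInf_less_iff[OF ne bdd] by blast
      have "Q_upper_tail z \<le> Q_upper_tail w" unfolding Q_upper_tail_def using w by (intro Q.finite_measure_mono) auto
      then show ?thesis using w by simp
    qed
    show "Q_upper_tail y \<le> upper_tail x"
    proof (rule tendsto_upperbound)
      show "(Q_upper_tail \<longlongrightarrow> Q_upper_tail y) (at_right y)"
        unfolding Q_upper_tail_cdf using Q.cdf_is_right_cont[of y] by (intro tendsto_diff tendsto_const) (simp add: continuous_within)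
      show "\<forall>\<^sub>F z in at_right y. Q_upper_tail z \<le> upper_tail x" using up by (auto simp: eventually_at_filter)
    qed simp
  qed
qed

lemma match_nonneg: "0 \<le> match x"
proof (rule ccontr)
  assume "\<not> 0 \<le> match x"
  then have "match x \<le> 0" by simp
  then have "Q_upper_tail 0 \<le> upper_tail x" using match_le_iff[of 0 x] by simp
  then have "{y. 0 \<le> y \<and> Q_upper_tail y \<le> upper_tail x} \<noteq> {}" by auto
  then have "0 \<le> match x" unfolding match_def by (intro cInf_greatest) auto
  then show False using \<open>\<not> 0 \<le> match x\<close> by simp
qed

lemma match_mono: "x \<le> y \<Longrightarrow> match x \<le> match y"
  using match_le_iff[of "match y" x] match_le_iff[of "match y" y] match_nonneg[of y] upper_tail_antimono[of x y]
  by simp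

lemma match_measurable [measurable]: "match \<in> borel_measurable borel"
  by (rule borel_measurable_mono) (auto simp: mono_def match_mono)

lemma match_law: "distr \<mu> borel match = Q"
proof (rule cdf_unique)
  show "real_distribution (distr \<mu> borel match)" by (intro law1.real_distribution_distr) auto
  show "cdf (distr \<mu> borel match) = cdf Q"
  proof
    fix y
    have "cdf (distr \<mu> borel match) y = measure \<mu> {x. match x \<le> y}"
      unfolding cdf_def by (subst measure_distr) (auto simp: vimage_def)
    also have "\<dots> = cdf Q y"
    proof (cases "0 \<le> y")
      case True
      have "{x. match x \<le> y} = {x. cdf \<mu> x \<le> cdf Q y}"
        using match_le_iff[OF True] by (auto simp: Q_upper_tail_cdf upper_tail_cdf)
      then show ?thesis using cdf_sublevel[of "cdf Q y"] Q.cdf_nonneg[of y] Q.cdf_bounded_prob[of y] by simp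
    next
      case False
      then have "{x. match x \<le> y} = {}" using match_nonneg by (auto intro: order_trans simp: not_le) (meson le_less_trans not_le)
      moreover have "AE x in Q. x \<notin> {..y}" using Q_nonneg by eventually_elim (use False in auto)
      then have "cdf Q y = 0" by (subst (asm) AE_iff_measurable[of "{..y}"]) (auto simp: measure_def cdf_def)
      ultimately show ?thesis by simp
    qed
    finally show "cdf (distr \<mu> borel match) y = cdf Q y" .
  qed
qed (rule Q)

text \<open>
  By definition of \<open>match\<close>, comparing \<open>match (n\<^sup>1\<^sup>/\<^sup>\<alpha> x) / a n\<close> with \<open>y\<close> means comparing the tail of \<open>\<mu>\<close> at
  \<open>n\<^sup>1\<^sup>/\<^sup>\<alpha> x\<close> with that of \<open>Q\<close> at \<open>a n y\<close>. Multiplied by \<open>n\<close> these tend to \<open>x\<^sup>-\<^sup>\<alpha>\<close> and \<open>y\<^sup>-\<^sup>\<alpha>\<close>.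
\<close>

lemma match_scaling:
  assumes x: "0 < x"
  shows "(\<lambda>n. match (norming n * x) / a n) \<longlonglongrightarrow> x"
proof (rule order_tendstoI)
  have a_pos: "\<forall>\<^sub>F n in sequentially. 0 < a n" using a_top by (simp add: filterlim_at_top_dense)
  fix y assume "y < x"
  \<comment> \<open>A positive level: \<open>match_le_iff\<close> and \<open>Q_tail\<close> say nothing about negative ones.\<close>
  define y' where "y' = max y (x/2)"
  have y': "0 < y'" "y' < x" "y \<le> y'" using x \<open>y < x\<close> by (auto simp: y'_def)
  have "(\<lambda>n. real n * Q_upper_tail (a n * y') - real n * upper_tail (norming n * x)) \<longlonglongrightarrow> y' powr (-\<alpha>) - x powr (-\<alpha>)"
    using y' x by (intro tendsto_diff norming_tail) (auto simp: Q_upper_tail_def Q_tail)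
  moreover have "y' powr (-\<alpha>) > x powr (-\<alpha>)" using y' x \<alpha> by (intro powr_less_mono2_neg) auto
  ultimately have "\<forall>\<^sub>F n in sequentially. 0 < real n * Q_upper_tail (a n * y') - real n * upper_tail (norming n * x)"
    by (intro order_tendstoD(1)) auto
  then show "\<forall>\<^sub>F n in sequentially. y < match (norming n * x) / a n"
    using a_pos
  proof eventually_elim
    case (elim n)
    then have "n > 0" by (cases n) auto
    then have "upper_tail (norming n * x) < Q_upper_tail (a n * y')" using elim by (simp add: right_diff_distrib[symmetric] zero_less_mult_iff)
    then have "\<not> match (norming n * x) \<le> a n * y'" using match_le_iff[of "a n * y'"] elim y' by simp
    then have "y' < match (norming n * x) / a n" using elim by (simp add: field_simps)
    then show ?case using y' by simp
  qed
next
  have a_pos: "\<forall>\<^sub>F n in sequentially. 0 < a n" using a_top by (simp add: filterlim_at_top_dense)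
  fix y assume "x < y"
  define y' where "y' = (x + y) / 2"
  have y': "x < y'" "y' < y" using \<open>x < y\<close> by (auto simp: y'_def)
  have "(\<lambda>n. real n * upper_tail (norming n * x) - real n * Q_upper_tail (a n * y')) \<longlonglongrightarrow> x powr (-\<alpha>) - y' powr (-\<alpha>)"
    using y' x by (intro tendsto_diff norming_tail) (auto simp: Q_upper_tail_def intro!: Q_tail)
  moreover have "x powr (-\<alpha>) > y' powr (-\<alpha>)" using y' x \<alpha> by (intro powr_less_mono2_neg) auto
  ultimately have "\<forall>\<^sub>F n in sequentially. 0 < real n * upper_tail (norming n * x) - real n * Q_upper_tail (a n * y')"
    by (intro order_tendstoD(1)) auto
  then show "\<forall>\<^sub>F n in sequentially. match (norming n * x) / a n < y"
    using a_pos
  proof eventually_elim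
    case (elim n)
    then have "n > 0" by (cases n) auto
    then have "Q_upper_tail (a n * y') < upper_tail (norming n * x)" using elim by (simp add: right_diff_distrib[symmetric] zero_less_mult_iff)
    then have "match (norming n * x) \<le> a n * y'" using match_le_iff[of "a n * y'"] elim y' x by simp
    then have "match (norming n * x) / a n \<le> y'" using elim by (simp add: field_simps)
    then show ?case using y' by simp
  qed
qed

text \<open>
  Let \<open>\<xi>\<close> have law \<open>\<mu>\<close>. Where \<open>\<xi> / n\<^sup>1\<^sup>/\<^sup>\<alpha>\<close> is at most \<open>\<epsilon>\<close>, both terms are small in mean by the bounds on
  truncated means, of order \<open>\<epsilon>\<^sup>1\<^sup>-\<^sup>\<alpha> / n\<close>. Between \<open>\<epsilon>\<close> and \<open>K\<close> the difference is uniformly small, on an event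
  of probability of order \<open>\<epsilon>\<^sup>-\<^sup>\<alpha> / n\<close>. Values above \<open>K\<close> have probability of order \<open>K\<^sup>-\<^sup>\<alpha> / n\<close>.
\<close>

lemma coupling_error:
  "(\<lambda>n. real n * (\<integral>x. min 1 \<bar>match x / a n - x / norming n\<bar> \<partial>\<mu>)) \<longlonglongrightarrow> 0"
proof (rule tendstoI)
  fix \<eta> :: real assume \<eta>: "0 < \<eta>"
  obtain C z0 where C: "C > 0" "\<And>z. z \<ge> z0 \<Longrightarrow> (\<integral>x. min x z \<partial>Q) \<le> C * (z * Q_upper_tail z)"
    using Q_trunc unfolding Q_upper_tail_def by blast
  obtain C' z1 where C': "C' > 0" "\<And>z. z \<ge> z1 \<Longrightarrow> (\<integral>x. min x z \<partial>\<mu>) \<le> C' * (z * upper_tail z)"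
    using trunc_bound by blast
  have "((\<lambda>e::real. C * (2 powr (1-\<alpha>) * e powr (1-\<alpha>)) + C' * e powr (1-\<alpha>)) \<longlongrightarrow> C * (2 powr (1-\<alpha>) * 0 powr (1-\<alpha>)) + C' * 0 powr (1-\<alpha>)) (at_right 0)"
    using \<alpha> by (intro tendsto_intros tendsto_powr'[OF tendsto_ident_at]) (auto simp: eventually_at_filter)
  then have "\<forall>\<^sub>F e in at_right 0. C * (2 powr (1-\<alpha>) * e powr (1-\<alpha>)) + C' * e powr (1-\<alpha>) < \<eta>/2"
    using \<eta> by (intro order_tendstoD(2)) auto
  then have "\<forall>\<^sub>F e in at_right 0. C * (2 powr (1-\<alpha>) * e powr (1-\<alpha>)) + C' * e powr (1-\<alpha>) < \<eta>/2 \<and> 0 < e"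
    using eventually_at_right_less by (rule eventually_conj)
  then obtain \<epsilon> :: real where \<epsilon>: "0 < \<epsilon>" "C * (2 powr (1-\<alpha>) * \<epsilon> powr (1-\<alpha>)) + C' * \<epsilon> powr (1-\<alpha>) < \<eta>/2"
    using eventually_happens[of _ "at_right (0::real)"] by force
  have "((\<lambda>x::real. x powr (-\<alpha>)) \<longlongrightarrow> 0) at_top" using \<alpha> by (intro tendsto_neg_powr filterlim_ident) auto
  then have "\<forall>\<^sub>F K in at_top. K powr (-\<alpha>) < \<eta>/4" using \<eta> by (intro order_tendstoD(2)) auto
  then have "\<forall>\<^sub>F K in at_top. K powr (-\<alpha>) < \<eta>/4 \<and> 0 < K" using eventually_gt_at_top by (rule eventually_conj)
  then obtain K :: real where K: "0 < K" "K powr (-\<alpha>) < \<eta>/4" by (auto simp: eventually_at_top_linorder)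
  \<comment> \<open>Offsets the factor \<open>\<epsilon>\<^sup>-\<^sup>\<alpha>\<close> from the expected number of increments above \<open>\<epsilon>\<close>.\<close>
  define \<delta> where "\<delta> = \<eta> / 4 * \<epsilon> powr \<alpha>"
  have \<delta>: "0 < \<delta>" "\<delta> * \<epsilon> powr (-\<alpha>) = \<eta>/4" using \<eta> \<epsilon> by (auto simp: \<delta>_def powr_minus)
  define B where "B n = C * (2 * \<epsilon> * (real n * Q_upper_tail (a n * (2 * \<epsilon>)))) + C' * (\<epsilon> * (real n * upper_tail (norming n * \<epsilon>)))
     + \<delta> * (real n * upper_tail (norming n * \<epsilon>)) + real n * upper_tail (norming n * K)" for n
  have Blim: "B \<longlonglongrightarrow> C * (2 * \<epsilon> * (2 * \<epsilon>) powr (-\<alpha>)) + C' * (\<epsilon> * \<epsilon> powr (-\<alpha>)) + \<delta> * \<epsilon> powr (-\<alpha>) + K powr (-\<alpha>)"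
    unfolding B_def using \<epsilon> K by (intro tendsto_intros norming_tail) (auto simp: Q_upper_tail_def intro!: Q_tail)
  have p1: "e * e powr (-\<alpha>) = e powr (1-\<alpha>)" if "e > 0" for e :: real
    using that powr_add[of e 1 "-\<alpha>"] by simp
  have "C * (2 * \<epsilon> * (2 * \<epsilon>) powr (-\<alpha>)) + C' * (\<epsilon> * \<epsilon> powr (-\<alpha>)) + \<delta> * \<epsilon> powr (-\<alpha>) + K powr (-\<alpha>) < \<eta>"
    using p1[of "2 * \<epsilon>"] p1[of \<epsilon>] \<epsilon> K \<delta> by (simp add: powr_mult)
  then have evB: "\<forall>\<^sub>F n in sequentially. B n < \<eta>" by (intro order_tendstoD(2)[OF Blim])
  have a_pos: "\<forall>\<^sub>F n in sequentially. max 1 (z0 / (2 * \<epsilon>)) \<le> a n" using a_top unfolding filterlim_at_top by blast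
  have norming_pos: "\<forall>\<^sub>F n in sequentially. max 1 (z1 / \<epsilon>) \<le> norming n" using norming_at_top unfolding filterlim_at_top by blast
  have m2: "\<forall>\<^sub>F n in sequentially. match (norming n * \<epsilon>) / a n < 2 * \<epsilon>"
    using match_scaling[OF \<epsilon>(1)] \<epsilon> by (intro order_tendstoD(2)) auto
  have unif: "\<forall>\<^sub>F n in sequentially. \<forall>x\<in>{\<epsilon>..K}. \<bar>match (norming n * x) / max 1 (a n) - x\<bar> < \<delta>"
  proof (rule monotone_convergence_to_identity_uniform)
    show "match (norming n * x) / max 1 (a n) \<le> match (norming n * y) / max 1 (a n)" if "\<epsilon> \<le> x" "x \<le> y" for n x y
      using that by (intro divide_right_mono match_mono mult_left_mono) (auto simp: norming_def)
    show "(\<lambda>n. match (norming n * x) / max 1 (a n)) \<longlonglongrightarrow> x" if "\<epsilon> \<le> x" for x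
    proof (rule Lim_transform_eventually[OF match_scaling])
      show "0 < x" using that \<epsilon> by simp
      show "\<forall>\<^sub>F n in sequentially. match (norming n * x) / a n = match (norming n * x) / max 1 (a n)"
        using a_pos by eventually_elim auto
    qed
  qed (rule \<delta>)
  have "\<forall>\<^sub>F n in sequentially. real n * (\<integral>x. min 1 \<bar>match x / a n - x / norming n\<bar> \<partial>\<mu>) \<le> B n"
    using a_pos norming_pos m2 unif
  proof eventually_elim
    case (elim n)
    then have an: "a n > 0" "a n \<ge> 1" and sn: "norming n > 0" by auto
    have i1: "integrable \<mu> (\<lambda>x. min (match x) (a n * (2 * \<epsilon>)))"
      by (rule law1.integrable_const_bound[of _ "a n * (2 * \<epsilon>)"]) (use an \<epsilon> match_nonneg in auto)
    have i2: "integrable \<mu> (\<lambda>x. min x (norming n * \<epsilon>))"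
      by (rule law1.integrable_const_bound[of _ "norming n * \<epsilon>"]) (use nonneg sn \<epsilon> in \<open>auto elim!: eventually_mono\<close>)
    have "(\<integral>x. min 1 \<bar>match x / a n - x / norming n\<bar> \<partial>\<mu>) \<le>
      (\<integral>x. min (match x) (a n * (2 * \<epsilon>)) / a n + min x (norming n * \<epsilon>) / norming n + \<delta> * indicator {norming n * \<epsilon><..} x
        + indicator {norming n * K<..} x \<partial>\<mu>)"
    proof (rule integral_mono_AE)
      show "integrable \<mu> (\<lambda>x. min 1 \<bar>match x / a n - x / norming n\<bar>)"
        by (rule law1.integrable_const_bound[of _ 1]) auto
      show "integrable \<mu> (\<lambda>x. min (match x) (a n * (2 * \<epsilon>)) / a n + min x (norming n * \<epsilon>) / norming n + \<delta> * indicator {norming n * \<epsilon><..} x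
        + indicator {norming n * K<..} x)"
        using i1 i2 by (intro Bochner_Integration.integrable_add integrable_divide_zero integrable_mult_right integrable_real_indicator)
          (auto simp: law1.emeasure_eq_measure)
      show "AE x in \<mu>. min 1 \<bar>match x / a n - x / norming n\<bar> \<le>
        min (match x) (a n * (2 * \<epsilon>)) / a n + min x (norming n * \<epsilon>) / norming n + \<delta> * indicator {norming n * \<epsilon><..} x
        + indicator {norming n * K<..} x"
        using nonneg
      proof eventually_elim
        fix x :: real assume x: "0 \<le> x"
        have n1: "0 \<le> min (match x) (a n * (2 * \<epsilon>)) / a n" "0 \<le> min x (norming n * \<epsilon>) / norming n"
          using match_nonneg[of x] an sn \<epsilon> x by auto
        consider "x \<le> norming n * \<epsilon>" | "norming n * \<epsilon> < x" "x \<le> norming n * K" | "norming n * \<epsilon> < x" "norming n * K < x" by linarith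
        then show "min 1 \<bar>match x / a n - x / norming n\<bar> \<le>
          min (match x) (a n * (2 * \<epsilon>)) / a n + min x (norming n * \<epsilon>) / norming n + \<delta> * indicator {norming n * \<epsilon><..} x
          + indicator {norming n * K<..} x"
        proof cases
          case 1
          have "match x \<le> match (norming n * \<epsilon>)" using 1 by (rule match_mono)
          also have "\<dots> \<le> a n * (2 * \<epsilon>)" using elim an by (simp add: field_simps)
          finally have m: "min (match x) (a n * (2 * \<epsilon>)) = match x" by simp
          have "\<bar>match x / a n - x / norming n\<bar> \<le> match x / a n + x / norming n"
            using match_nonneg[of x] x an sn by (intro order.trans[OF abs_triangle_ineq4]) auto
          then have "min 1 \<bar>match x / a n - x / norming n\<bar> \<le> match x / a n + x / norming n" by simp
          moreover have "0 \<le> \<delta> * indicator {norming n * \<epsilon><..} x" "0 \<le> (indicator {norming n * K<..} x :: real)" using \<delta> by auto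
          moreover have "min x (norming n * \<epsilon>) = x" using 1 by simp
          ultimately show ?thesis unfolding m by linarith
        next
          case 2
          have "x / norming n \<in> {\<epsilon>..K}" using 2 sn by (auto simp: field_simps)
          then have "\<bar>match (norming n * (x / norming n)) / max 1 (a n) - x / norming n\<bar> < \<delta>" using elim by blast
          then have "\<bar>match x / a n - x / norming n\<bar> < \<delta>" using sn an by (simp add: max_absorb2)
          moreover have "\<delta> * indicator {norming n * \<epsilon><..} x = \<delta>" using 2 by simp
          moreover have "0 \<le> (indicator {norming n * K<..} x :: real)" by simp
          ultimately show ?thesis using n1 by linarith
        next
          case 3
          have "(indicator {norming n * K<..} x :: real) = 1" "0 \<le> \<delta> * indicator {norming n * \<epsilon><..} x" using 3 \<delta> by auto
          then show ?thesis using n1 by linarith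
        qed
      qed
    qed
    also have "\<dots> = (\<integral>x. min (match x) (a n * (2 * \<epsilon>)) \<partial>\<mu>) / a n + (\<integral>x. min x (norming n * \<epsilon>) \<partial>\<mu>) / norming n
        + \<delta> * upper_tail (norming n * \<epsilon>) + upper_tail (norming n * K)"
    proof -
      have i3: "integrable \<mu> (indicat_real {c<..})" for c
        by (intro integrable_real_indicator) (auto simp: law1.emeasure_eq_measure)
      have j: "integrable \<mu> (\<lambda>x. min (match x) (a n * (2 * \<epsilon>)) / a n)" "integrable \<mu> (\<lambda>x. min x (norming n * \<epsilon>) / norming n)"
        "integrable \<mu> (\<lambda>x. \<delta> * indicat_real {norming n * \<epsilon><..} x)"
        by (intro integrable_divide_zero i1 i2 integrable_mult_right i3)+
      have "(\<integral>x. indicat_real {c<..} x \<partial>\<mu>) = upper_tail c" for c by (simp add: upper_tail_def)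
      then show ?thesis
        by (simp only: Bochner_Integration.integral_add Bochner_Integration.integrable_add i3 j
            integral_divide_zero integral_mult_right_zero)
    qed
    also have "(\<integral>x. min (match x) (a n * (2 * \<epsilon>)) \<partial>\<mu>) = (\<integral>x. min x (a n * (2 * \<epsilon>)) \<partial>Q)"
    proof -
      have "(\<integral>x. min x (a n * (2 * \<epsilon>)) \<partial>distr \<mu> borel match) = (\<integral>x. min (match x) (a n * (2 * \<epsilon>)) \<partial>\<mu>)"
        by (subst integral_distr) auto
      then show ?thesis unfolding match_law ..
    qed
    also have "(\<integral>x. min x (a n * (2 * \<epsilon>)) \<partial>Q) / a n \<le> C * (a n * (2 * \<epsilon>) * Q_upper_tail (a n * (2 * \<epsilon>))) / a n"
      using elim \<epsilon> an by (intro divide_right_mono C(2)) (auto simp: field_simps)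
    also have "\<dots> = C * (2 * \<epsilon> * Q_upper_tail (a n * (2 * \<epsilon>)))" using an by simp
    also have "(\<integral>x. min x (norming n * \<epsilon>) \<partial>\<mu>) / norming n \<le> C' * (norming n * \<epsilon> * upper_tail (norming n * \<epsilon>)) / norming n"
      using elim \<epsilon> sn by (intro divide_right_mono C'(2)) (auto simp: field_simps)
    also have "\<dots> = C' * (\<epsilon> * upper_tail (norming n * \<epsilon>))" using sn by simp
    finally have "(\<integral>x. min 1 \<bar>match x / a n - x / norming n\<bar> \<partial>\<mu>) \<le>
      C * (2 * \<epsilon> * Q_upper_tail (a n * (2 * \<epsilon>))) + C' * (\<epsilon> * upper_tail (norming n * \<epsilon>)) + \<delta> * upper_tail (norming n * \<epsilon>) + upper_tail (norming n * K)" by simp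
    from mult_left_mono[OF this, of "real n"] show ?case unfolding B_def by (simp add: algebra_simps)
  qed
  then show "\<forall>\<^sub>F n in sequentially. dist (real n * (\<integral>x. min 1 \<bar>match x / a n - x / norming n\<bar> \<partial>\<mu>)) 0 < \<eta>"
    using evB
  proof eventually_elim
    case (elim n)
    have "0 \<le> real n * (\<integral>x. min 1 \<bar>match x / a n - x / norming n\<bar> \<partial>\<mu>)" by (intro mult_nonneg_nonneg integral_nonneg) auto
    then show ?case using elim by (simp add: dist_real_def)
  qed
qed

end

section \<open>Law of large numbers and renewal counting\<close>

lemma (in prob_space) centered_sum_second_moment:
  fixes Z :: "'i \<Rightarrow> 'a \<Rightarrow> real"
  assumes "finite I" and ind: "indep_vars (\<lambda>_. borel) Z I"
    and bound: "\<And>i. i \<in> I \<Longrightarrow> AE \<omega> in M. \<bar>Z i \<omega>\<bar> \<le> B" and mean: "\<And>i. i \<in> I \<Longrightarrow> expectation (Z i) = 0"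
  shows "integrable M (\<lambda>\<omega>. (\<Sum>i\<in>I. Z i \<omega>)\<^sup>2)" "expectation (\<lambda>\<omega>. (\<Sum>i\<in>I. Z i \<omega>)\<^sup>2) \<le> real (card I) * B\<^sup>2"
proof -
  have rv [measurable]: "Z i \<in> borel_measurable M" if "i \<in> I" for i
    using ind that by (auto simp: indep_vars_def2)
  have intZ: "integrable M (Z i)" if "i \<in> I" for i
    using bound[OF that] rv[OF that] by (intro integrable_const_bound[of _ B]) auto
  have int2: "integrable M (\<lambda>\<omega>. Z i \<omega> * Z j \<omega>)" if "i \<in> I" "j \<in> I" for i j
  proof (rule integrable_const_bound[of _ "B * B"])
    show "AE \<omega> in M. norm (Z i \<omega> * Z j \<omega>) \<le> B * B"
      using bound[OF that(1)] bound[OF that(2)]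
      by eventually_elim (auto simp: abs_mult intro!: mult_mono)
  qed (use rv that in auto)
  have sq: "(\<Sum>i\<in>I. Z i \<omega>)\<^sup>2 = (\<Sum>i\<in>I. \<Sum>j\<in>I. Z i \<omega> * Z j \<omega>)" for \<omega>
    by (simp add: power2_eq_square sum_product)
  show "integrable M (\<lambda>\<omega>. (\<Sum>i\<in>I. Z i \<omega>)\<^sup>2)"
    unfolding sq by (intro Bochner_Integration.integrable_sum int2)
  have "expectation (\<lambda>\<omega>. (\<Sum>i\<in>I. Z i \<omega>)\<^sup>2) = (\<Sum>i\<in>I. \<Sum>j\<in>I. expectation (\<lambda>\<omega>. Z i \<omega> * Z j \<omega>))"
    unfolding sq by (subst Bochner_Integration.integral_sum, intro Bochner_Integration.integrable_sum int2, assumption+,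
        intro sum.cong refl Bochner_Integration.integral_sum int2)
  also have "\<dots> \<le> (\<Sum>i\<in>I. \<Sum>j\<in>I. if j = i then B\<^sup>2 else 0)"
  proof (intro sum_mono)
    fix i j assume ij: "i \<in> I" "j \<in> I"
    show "expectation (\<lambda>\<omega>. Z i \<omega> * Z j \<omega>) \<le> (if j = i then B\<^sup>2 else 0)"
    proof (cases "j = i")
      case True
      have "expectation (\<lambda>\<omega>. Z i \<omega> * Z i \<omega>) \<le> expectation (\<lambda>\<omega>. B\<^sup>2)"
      proof (rule integral_mono_AE)
        show "AE \<omega> in M. Z i \<omega> * Z i \<omega> \<le> B\<^sup>2"
          using bound[OF ij(1)] by eventually_elim (auto simp: power2_eq_square[symmetric] intro: power2_le_iff_abs_le[THEN iffD2] dest: order_trans[OF abs_ge_zero])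
      qed (use int2 ij in auto)
      then show ?thesis using True prob_space by simp
    next
      case False
      have "indep_vars (\<lambda>_. borel) Z {i, j}" by (rule indep_vars_subset[OF ind]) (use ij in auto)
      then have "indep_var borel (Z i) borel (\<lambda>\<omega>. \<Sum>k\<in>{j}. Z k \<omega>)"
        using False by (intro indep_vars_sum) auto
      then have "indep_var borel (Z i) borel (Z j)" by simp
      then have "expectation (\<lambda>\<omega>. Z i \<omega> * Z j \<omega>) = expectation (Z i) * expectation (Z j)"
        by (intro indep_var_lebesgue_integral intZ ij)
      then show ?thesis using mean ij False by simp
    qed
  qed
  also have "\<dots> = real (card I) * B\<^sup>2" using \<open>finite I\<close> by simp
  finally show "expectation (\<lambda>\<omega>. (\<Sum>i\<in>I. Z i \<omega>)\<^sup>2) \<le> real (card I) * B\<^sup>2" .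
qed

text \<open>
  The variables are truncated at a level \<open>K\<close> that is good in mean; the average of the truncated
  variables has a variance of order \<open>1/n\<close>. The second moment is turned into a first moment by \<open>2u \<le> t + u\<^sup>2/t\<close>.
\<close>

lemma (in prob_space) L1_law_of_large_numbers:
  fixes X :: "nat \<Rightarrow> 'a \<Rightarrow> real"
  assumes ind: "indep_vars (\<lambda>_. borel) X {1..}" and law: "\<And>i. i \<ge> 1 \<Longrightarrow> distr M borel (X i) = R"
    and int: "integrable R (\<lambda>x. x)"
  shows "(\<lambda>n. expectation (\<lambda>\<omega>. \<bar>(\<Sum>i=1..n. X i \<omega>) / real n - (\<integral>x. x \<partial>R)\<bar>)) \<longlonglongrightarrow> 0"
proof (rule tendstoI)
  fix \<eta> :: real assume \<eta>: "\<eta> > 0"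
  define m where "m = (\<integral>x. x \<partial>R)"
  have rv [measurable]: "X i \<in> borel_measurable M" if "i \<ge> 1" for i
    using ind that by (auto simp: indep_vars_def2)
  have sets_R [measurable_cong, simp]: "sets R = sets borel" using law[of 1] by (metis order_refl sets_distr)
  interpret R: prob_space R using prob_space_distr[OF rv[of 1]] law[of 1] by simp
  define \<phi> where "\<phi> K x = max (- K) (min K x)" for K x :: real
  have \<phi>b: "\<bar>\<phi> K x\<bar> \<le> K" if "K \<ge> 0" for K x using that by (auto simp: \<phi>_def)
  have [measurable]: "\<phi> K \<in> borel_measurable borel" for K unfolding \<phi>_def by measurable
  have "(\<lambda>k. \<integral>x. \<bar>x - \<phi> (real k) x\<bar> \<partial>R) \<longlonglongrightarrow> (\<integral>x. 0 \<partial>R)"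
  proof (rule integral_dominated_convergence[where w="\<lambda>x. \<bar>x\<bar>"])
    show "AE x in R. (\<lambda>k. \<bar>x - \<phi> (real k) x\<bar>) \<longlonglongrightarrow> 0"
    proof (rule AE_I2, rule tendsto_eventually)
      fix x :: real
      show "\<forall>\<^sub>F k in sequentially. \<bar>x - \<phi> (real k) x\<bar> = 0"
        using eventually_ge_at_top[of "nat \<lceil>\<bar>x\<bar>\<rceil>"]
      proof eventually_elim
        case (elim k)
        then have "\<bar>x\<bar> \<le> real k" by linarith
        then show ?case by (auto simp: \<phi>_def)
      qed
    qed
    show "AE x in R. norm \<bar>x - \<phi> (real k) x\<bar> \<le> \<bar>x\<bar>" for k by (auto simp: \<phi>_def)
    show "integrable R (\<lambda>x. \<bar>x\<bar>)" using int by (rule integrable_abs)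
    show "(\<lambda>x. \<bar>x - \<phi> (real k) x\<bar>) \<in> borel_measurable R" for k by measurable
  qed simp
  then have "\<forall>\<^sub>F k in sequentially. (\<integral>x. \<bar>x - \<phi> (real k) x\<bar> \<partial>R) < \<eta>/4" using \<eta> by (intro order_tendstoD(2)) auto
  then obtain k where k: "(\<integral>x. \<bar>x - \<phi> (real k) x\<bar> \<partial>R) < \<eta>/4" by (auto simp: eventually_sequentially)
  define K where "K = real k"
  define mK where "mK = (\<integral>x. \<phi> K x \<partial>R)"
  have K0: "K \<ge> 0" by (simp add: K_def)
  have int\<phi>: "integrable R (\<phi> K)" by (rule R.integrable_const_bound[of _ K]) (use \<phi>b[OF K0] in auto)
  define e where "e = (\<integral>x. \<bar>x - \<phi> K x\<bar> \<partial>R)"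
  have e: "e < \<eta>/4" using k by (simp add: e_def K_def)
  have mdiff: "\<bar>m - mK\<bar> \<le> e"
  proof -
    have "m - mK = (\<integral>x. x - \<phi> K x \<partial>R)" unfolding m_def mK_def using int int\<phi> by simp
    then show ?thesis unfolding e_def using integral_abs_bound[of R "\<lambda>x. x - \<phi> K x"] by simp
  qed
  have mKb: "\<bar>mK\<bar> \<le> K"
  proof -
    have "\<bar>mK\<bar> \<le> (\<integral>x. \<bar>\<phi> K x\<bar> \<partial>R)" unfolding mK_def by (rule integral_abs_bound)
    also have "\<dots> \<le> (\<integral>x. K \<partial>R)" using int\<phi> \<phi>b[OF K0] by (intro integral_mono) auto
    finally show ?thesis using R.prob_space by simp
  qed
  define Z where "Z i \<omega> = \<phi> K (X i \<omega>) - mK" for i \<omega>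
  have Zm [measurable]: "Z i \<in> borel_measurable M" if "i \<ge> 1" for i unfolding Z_def using rv[OF that] by measurable
  define B where "B = 2 * K"
  have second: "integrable M (\<lambda>\<omega>. (\<Sum>i=1..n. Z i \<omega>)\<^sup>2)" "expectation (\<lambda>\<omega>. (\<Sum>i=1..n. Z i \<omega>)\<^sup>2) \<le> real n * B\<^sup>2" for n
  proof -
    have iz: "indep_vars (\<lambda>_. borel) Z {1..n}"
      unfolding Z_def by (rule indep_vars_compose2[OF indep_vars_subset[OF ind]]) auto
    have mz: "expectation (Z i) = 0" if "i \<in> {1..n}" for i
    proof -
      have "expectation (Z i) = (\<integral>x. \<phi> K x - mK \<partial>R)"
        using law[of i] that unfolding Z_def by (subst integral_distr[symmetric, of "X i" M borel]) auto
      also have "\<dots> = 0" using int\<phi> R.prob_space by (simp add: mK_def)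
      finally show ?thesis .
    qed
    have bz: "AE \<omega> in M. \<bar>Z i \<omega>\<bar> \<le> B" for i
    proof (rule AE_I2)
      fix \<omega>
      show "\<bar>Z i \<omega>\<bar> \<le> B" using \<phi>b[OF K0, of "X i \<omega>"] mKb unfolding Z_def B_def by linarith
    qed
    show "integrable M (\<lambda>\<omega>. (\<Sum>i=1..n. Z i \<omega>)\<^sup>2)" "expectation (\<lambda>\<omega>. (\<Sum>i=1..n. Z i \<omega>)\<^sup>2) \<le> real n * B\<^sup>2"
      using centered_sum_second_moment[OF _ iz bz mz] by auto
  qed
  have intX: "integrable M (\<lambda>\<omega>. \<bar>X i \<omega> - \<phi> K (X i \<omega>)\<bar>)" "expectation (\<lambda>\<omega>. \<bar>X i \<omega> - \<phi> K (X i \<omega>)\<bar>) = e" if "i \<ge> 1" for i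
  proof -
    have "integrable (distr M borel (X i)) (\<lambda>x. \<bar>x - \<phi> K x\<bar>)" using law[OF that] int int\<phi> by simp
    then show "integrable M (\<lambda>\<omega>. \<bar>X i \<omega> - \<phi> K (X i \<omega>)\<bar>)" using rv[OF that] by (subst (asm) integrable_distr_eq) auto
    show "expectation (\<lambda>\<omega>. \<bar>X i \<omega> - \<phi> K (X i \<omega>)\<bar>) = e"
      unfolding e_def law[OF that, symmetric] using rv[OF that] by (subst integral_distr) auto
  qed
  have main: "expectation (\<lambda>\<omega>. \<bar>(\<Sum>i=1..n. X i \<omega>) / real n - m\<bar>) \<le> (\<eta>/4 + B\<^sup>2 / (real n * (\<eta>/4))) / 2 + 2 * e" if n: "n \<ge> 1" for n
  proof -
    let ?t = "\<eta>/4"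
    have t: "?t > 0" using \<eta> by simp
    let ?S = "\<lambda>\<omega>. \<Sum>i=1..n. Z i \<omega>" and ?D = "\<lambda>\<omega>. \<Sum>i=1..n. \<bar>X i \<omega> - \<phi> K (X i \<omega>)\<bar>"
    have pw: "\<bar>(\<Sum>i=1..n. X i \<omega>) / real n - m\<bar> \<le> (?t + (?S \<omega>)\<^sup>2 / ((real n)\<^sup>2 * ?t)) / 2 + ?D \<omega> / real n + e" for \<omega>
    proof -
      have "(\<Sum>i=1..n. X i \<omega>) = ?S \<omega> + (\<Sum>i=1..n. X i \<omega> - \<phi> K (X i \<omega>)) + real n * mK"
        unfolding Z_def by (simp add: sum_subtractf)
      then have "(\<Sum>i=1..n. X i \<omega>) / real n - m = ?S \<omega> / real n + (\<Sum>i=1..n. X i \<omega> - \<phi> K (X i \<omega>)) / real n + (mK - m)"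
        using n by (simp add: add_divide_distrib)
      moreover have "\<bar>(\<Sum>i=1..n. X i \<omega> - \<phi> K (X i \<omega>)) / real n\<bar> \<le> ?D \<omega> / real n"
        unfolding abs_divide by (auto intro!: divide_right_mono sum_abs)
      moreover have "\<bar>?S \<omega> / real n\<bar> \<le> (?t + (?S \<omega>)\<^sup>2 / ((real n)\<^sup>2 * ?t)) / 2"
      proof -
        define u where "u = \<bar>?S \<omega> / real n\<bar>"
        have "0 \<le> (?t - u)\<^sup>2" by simp
        then have "2 * u * ?t \<le> ?t\<^sup>2 + u\<^sup>2" by (simp add: power2_diff algebra_simps)
        then have "2 * u * ?t / ?t \<le> (?t\<^sup>2 + u\<^sup>2) / ?t" using t by (intro divide_right_mono) auto
        then have "2 * u \<le> ?t + u\<^sup>2 / ?t" using t by (simp add: add_divide_distrib power2_eq_square)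
        moreover have "u\<^sup>2 / ?t = (?S \<omega>)\<^sup>2 / ((real n)\<^sup>2 * ?t)" unfolding u_def by (simp add: power_divide)
        ultimately have le: "2 * u \<le> ?t + (?S \<omega>)\<^sup>2 / ((real n)\<^sup>2 * ?t)" by (simp only:)
        have half: "2 * c \<le> d \<Longrightarrow> c \<le> d / 2" for c d :: real by simp
        show ?thesis using half[OF le] by (simp only: u_def)
      qed
      ultimately show ?thesis using mdiff by linarith
    qed
    have iD: "integrable M ?D" by (intro Bochner_Integration.integrable_sum intX) auto
    have "expectation (\<lambda>\<omega>. \<bar>(\<Sum>i=1..n. X i \<omega>) / real n - m\<bar>) \<le>
      expectation (\<lambda>\<omega>. (?t + (?S \<omega>)\<^sup>2 / ((real n)\<^sup>2 * ?t)) / 2 + ?D \<omega> / real n + e)"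
    proof (rule integral_mono)
      show i: "integrable M (\<lambda>\<omega>. (?t + (?S \<omega>)\<^sup>2 / ((real n)\<^sup>2 * ?t)) / 2 + ?D \<omega> / real n + e)"
        by (intro Bochner_Integration.integrable_add integrable_divide_zero iD second integrable_const)
      show "integrable M (\<lambda>\<omega>. \<bar>(\<Sum>i=1..n. X i \<omega>) / real n - m\<bar>)"
      proof (rule Bochner_Integration.integrable_bound[OF i])
        have [measurable]: "(\<lambda>\<omega>. \<Sum>i=1..n. X i \<omega>) \<in> borel_measurable M" by (intro borel_measurable_sum rv) auto
        show "(\<lambda>\<omega>. \<bar>(\<Sum>i=1..n. X i \<omega>) / real n - m\<bar>) \<in> borel_measurable M" by measurable
      qed (use pw in \<open>auto intro!: AE_I2 order.trans[OF _ abs_ge_self]\<close>)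
    qed (rule pw)
    also have "\<dots> = (?t + expectation (\<lambda>\<omega>. (?S \<omega>)\<^sup>2) / ((real n)\<^sup>2 * ?t)) / 2 + expectation ?D / real n + e"
      using second(1) iD prob_space by (simp del: sum_divide_distrib)
    also have "expectation ?D = real n * e"
      by (subst Bochner_Integration.integral_sum) (auto simp: intX)
    also have "expectation (\<lambda>\<omega>. (?S \<omega>)\<^sup>2) / ((real n)\<^sup>2 * ?t) \<le> (real n * B\<^sup>2) / ((real n)\<^sup>2 * ?t)"
      using second(2)[of n] t by (intro divide_right_mono) auto
    also have "(real n * B\<^sup>2) / ((real n)\<^sup>2 * ?t) = B\<^sup>2 / (real n * ?t)" using n by (simp add: power2_eq_square)
    finally show ?thesis using n by simp
  qed
  have "(\<lambda>n. (\<eta>/4 + B\<^sup>2 / (\<eta>/4) * (1 / real n)) / 2 + 2 * e) \<longlonglongrightarrow> (\<eta>/4 + B\<^sup>2 / (\<eta>/4) * 0) / 2 + 2 * e"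
    by (intro tendsto_intros lim_1_over_n) simp
  moreover have "(\<eta>/4 + B\<^sup>2 / (\<eta>/4) * 0) / 2 + 2 * e < \<eta>" using e \<eta> by simp
  ultimately have "\<forall>\<^sub>F n in sequentially. (\<eta>/4 + B\<^sup>2 / (\<eta>/4) * (1 / real n)) / 2 + 2 * e < \<eta>"
    by (rule order_tendstoD(2))
  then show "\<forall>\<^sub>F n in sequentially. dist (expectation (\<lambda>\<omega>. \<bar>(\<Sum>i=1..n. X i \<omega>) / real n - (\<integral>x. x \<partial>R)\<bar>)) 0 < \<eta>"
    using eventually_ge_at_top[of 1]
  proof eventually_elim
    case (elim n)
    have "expectation (\<lambda>\<omega>. \<bar>(\<Sum>i=1..n. X i \<omega>) / real n - m\<bar>) < \<eta>"
      using main[OF elim(2)] elim(1) by (simp add: mult.commute)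
    moreover have "0 \<le> expectation (\<lambda>\<omega>. \<bar>(\<Sum>i=1..n. X i \<omega>) / real n - m\<bar>)" by (intro Bochner_Integration.integral_nonneg) auto
    ultimately show ?case unfolding m_def by (simp add: dist_real_def)
  qed
qed

definition seq_sum :: "(nat \<Rightarrow> real) \<Rightarrow> nat \<Rightarrow> real" where "seq_sum w k = (\<Sum>i=1..k. w i)"

definition seq_count :: "(nat \<Rightarrow> real) \<Rightarrow> real \<Rightarrow> nat" where
  "seq_count w u = Sup {k. 1 \<le> k \<and> seq_sum w k \<le> u}"

text \<open>
  Waiting times for which every renewal count is finite, so that no junk value of \<^const>\<open>Sup\<close> occurs.
\<close>

definition renewal_seq :: "(nat \<Rightarrow> real) \<Rightarrow> bool" where
  "renewal_seq w \<longleftrightarrow> (\<forall>i. 0 \<le> w (Suc i)) \<and> (\<forall>b::nat. \<exists>k. real b < seq_sum w k)"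

lemma seq_sum_Suc: "seq_sum w (Suc k) = seq_sum w k + w (Suc k)" by (simp add: seq_sum_def)

lemma renewal_seq_sum_mono:
  assumes "renewal_seq w" "i \<le> j"
  shows "seq_sum w i \<le> seq_sum w j"
proof -
  have "incseq (seq_sum w)"
    using assms(1) by (intro incseq_SucI) (simp add: seq_sum_Suc renewal_seq_def)
  then show ?thesis using assms(2) by (rule incseqD)
qed

lemma le_seq_count_iff:
  assumes w: "renewal_seq w" and k: "1 \<le> k"
  shows "k \<le> seq_count w u \<longleftrightarrow> seq_sum w k \<le> u"
proof -
  let ?A = "{k. 1 \<le> k \<and> seq_sum w k \<le> u}"
  obtain k0 where "real (nat \<lceil>u\<rceil>) < seq_sum w k0" using w unfolding renewal_seq_def by blast
  then have k0: "u < seq_sum w k0" by linarith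
  have "?A \<subseteq> {..<k0}"
  proof
    fix j assume "j \<in> ?A"
    then show "j \<in> {..<k0}" using k0 renewal_seq_sum_mono[OF w, of k0 j] by (cases "j < k0") auto
  qed
  then have fin: "finite ?A" by (rule finite_subset) simp
  show ?thesis
  proof
    assume "seq_sum w k \<le> u"
    then have "k \<in> ?A" using k by simp
    then show "k \<le> seq_count w u" unfolding seq_count_def Sup_nat_def using fin by auto
  next
    assume le: "k \<le> seq_count w u"
    have ne: "?A \<noteq> {}"
    proof
      assume "?A = {}"
      then have "seq_count w u = 0" unfolding seq_count_def by (simp add: Sup_nat_def)
      then show False using le k by simp
    qed
    then have "seq_count w u \<in> ?A" unfolding seq_count_def Sup_nat_def using Max_in[OF fin ne] by simp
    then show "seq_sum w k \<le> u" using renewal_seq_sum_mono[OF w le] by simp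
  qed
qed

lemma seq_count_mono: "renewal_seq w \<Longrightarrow> u \<le> v \<Longrightarrow> seq_count w u \<le> seq_count w v"
  using le_seq_count_iff[of w "seq_count w u" u] le_seq_count_iff[of w "seq_count w u" v]
  by (cases "seq_count w u = 0") auto

lemma renewal_path_cadlag:
  assumes w: "renewal_seq w" and t: "0 < t"
  shows "(\<lambda>s\<in>{0..}. f (seq_count w (t * s)) :: real) \<in> cadlag_space"
proof (rule step_path_cadlag)
  show "seq_count w (t * r) \<le> seq_count w (t * s)" if "0 \<le> r" "r \<le> s" for r s
    using that t by (intro seq_count_mono[OF w] mult_left_mono) auto
  fix s :: real assume s: "0 \<le> s"
  let ?k = "Suc (seq_count w (t * s))"
  have "\<not> ?k \<le> seq_count w (t * s)" by simp
  then have "t * s < seq_sum w ?k" using le_seq_count_iff[OF w, of ?k "t * s"] by simp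
  then have e: "s < seq_sum w ?k / t" using t by (simp add: field_simps)
  have "seq_count w (t * r) = seq_count w (t * s)" if r: "r \<in> {s..<seq_sum w ?k / t}" for r
  proof -
    have "t * r < seq_sum w ?k" using r t by (simp add: field_simps)
    then have "\<not> ?k \<le> seq_count w (t * r)" using le_seq_count_iff[OF w, of ?k "t * r"] by simp
    moreover have "seq_count w (t * s) \<le> seq_count w (t * r)"
      using r t by (intro seq_count_mono[OF w] mult_left_mono) auto
    ultimately show ?thesis by simp
  qed
  then show "\<exists>e>s. \<forall>r\<in>{s..<e}. seq_count w (t * r) = seq_count w (t * s)" using e by blast
qed

lemma renewal_galois:
  assumes w: "renewal_seq w" and t: "0 < t" and n: "0 < n" and u: "0 \<le> u"
  shows "\<exists>v\<ge>0. \<forall>s\<ge>0. u \<le> real (seq_count w (t * s)) / real n \<longleftrightarrow> v \<le> s"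
proof -
  define k where "k = nat \<lceil>u * real n\<rceil>"
  have iff: "u \<le> real j / real n \<longleftrightarrow> k \<le> j" for j
  proof -
    have "u \<le> real j / real n \<longleftrightarrow> u * real n \<le> real j" using n by (simp add: field_simps)
    also have "\<dots> \<longleftrightarrow> k \<le> j" unfolding k_def by linarith
    finally show ?thesis .
  qed
  show ?thesis
  proof (cases "k = 0")
    case True then show ?thesis unfolding iff by (intro exI[of _ 0]) auto
  next
    case False
    have "k \<le> seq_count w (t * s) \<longleftrightarrow> max 0 (seq_sum w k / t) \<le> s" if "0 \<le> s" for s
      using le_seq_count_iff[OF w, of k "t * s"] False t that by (auto simp: field_simps)
    then show ?thesis unfolding iff by (intro exI[of _ "max 0 (seq_sum w k / t)"]) auto
  qed
qed

text \<open>
  The renewal count inverts the partial sums, so linear growth of the sums with slope \<open>m\<close> gives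
  convergence of the rescaled count at each time. Rational multiples \<open>q\<close> suffice by monotonicity, and
  the convergence is then locally uniform. Countably many limits can be arranged simultaneously on
  an almost sure event.
\<close>

lemma renewal_count_uniform:
  fixes t :: "nat \<Rightarrow> real" and n :: "nat \<Rightarrow> nat"
  assumes w: "renewal_seq w" and t: "\<And>k. 0 < t k" and m: "0 < m"
    and n_top: "filterlim n at_top sequentially" and tn: "(\<lambda>k. t k / real (n k)) \<longlonglongrightarrow> m"
    and lln: "\<And>q. q \<in> \<rat> \<Longrightarrow> 0 \<le> q \<Longrightarrow> (\<lambda>k. seq_sum w (nat \<lfloor>real (n k) * q\<rfloor>) / real (n k)) \<longlonglongrightarrow> m * q"
    and \<delta>: "0 < \<delta>"
  shows "\<forall>\<^sub>F k in sequentially. \<forall>s\<in>{0..T}. \<bar>real (seq_count w (t k * s)) / real (n k) - s\<bar> < \<delta>"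
proof (rule monotone_convergence_to_identity_uniform[OF _ _ \<delta>])
  show "real (seq_count w (t k * r)) / real (n k) \<le> real (seq_count w (t k * s)) / real (n k)"
    if "0 \<le> r" "r \<le> s" for k r s
    using that t[of k] by (intro divide_right_mono of_nat_mono seq_count_mono[OF w] mult_left_mono) auto
  have n_pos: "\<forall>\<^sub>F k in sequentially. c < real (n k)" for c
    using filterlim_compose[OF filterlim_real_sequentially n_top] by (simp add: filterlim_at_top_dense)
  have tns: "(\<lambda>k. t k * s / real (n k)) \<longlonglongrightarrow> m * s" for s
    using tendsto_mult[OF tn tendsto_const[of s]] by simp
  fix s :: real assume s: "0 \<le> s"
  show "(\<lambda>k. real (seq_count w (t k * s)) / real (n k)) \<longlonglongrightarrow> s"
  proof (rule order_tendstoI)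
    fix y assume "s < y"
    then obtain q where q: "q \<in> \<rat>" "s < q" "q < y" using Rats_dense_in_real by blast
    have "(\<lambda>k. seq_sum w (nat \<lfloor>real (n k) * q\<rfloor>) / real (n k) - t k * s / real (n k)) \<longlonglongrightarrow> m * q - m * s"
      using q s by (intro tendsto_diff lln tns) auto
    moreover have "0 < m * q - m * s" using q m by simp
    ultimately have "\<forall>\<^sub>F k in sequentially. 0 < seq_sum w (nat \<lfloor>real (n k) * q\<rfloor>) / real (n k) - t k * s / real (n k)"
      by (rule order_tendstoD(1))
    then show "\<forall>\<^sub>F k in sequentially. real (seq_count w (t k * s)) / real (n k) < y"
      using n_pos[of "1 / q"]
    proof eventually_elim
      case (elim k)
      let ?j = "nat \<lfloor>real (n k) * q\<rfloor>"
      have q0: "q > 0" using q s by simp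
      then have np: "0 < real (n k)" using elim(2) by (smt (verit) divide_pos_pos)
      then have lt: "t k * s < seq_sum w ?j" using elim(1) by (simp add: diff_divide_distrib[symmetric] zero_less_divide_iff)
      have "1 \<le> real (n k) * q" using elim(2) q0 by (simp add: field_simps)
      then have "1 \<le> ?j" by linarith
      then have "seq_count w (t k * s) < ?j" using le_seq_count_iff[OF w, of ?j "t k * s"] lt by simp
      moreover have "real ?j \<le> real (n k) * q" using q0 np by simp
      ultimately have "real (seq_count w (t k * s)) \<le> real (n k) * q" by linarith
      then have "real (seq_count w (t k * s)) / real (n k) \<le> q" using np by (simp add: field_simps)
      then show ?case using q by simp
    qed
  next
    fix y assume y: "y < s"
    show "\<forall>\<^sub>F k in sequentially. y < real (seq_count w (t k * s)) / real (n k)"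
    proof (cases "y < 0")
      case True
      then show ?thesis by (intro always_eventually allI) (auto intro: less_le_trans)
    next
      case False
      then obtain q where q: "q \<in> \<rat>" "y < q" "q < s" using Rats_dense_in_real[OF y] by blast
      have q0: "0 \<le> q" using q False by simp
      have "(\<lambda>k. t k * s / real (n k) - seq_sum w (nat \<lfloor>real (n k) * q\<rfloor>) / real (n k)) \<longlonglongrightarrow> m * s - m * q"
        using q q0 by (intro tendsto_diff lln tns) auto
      moreover have "0 < m * s - m * q" using q m by simp
      ultimately have "\<forall>\<^sub>F k in sequentially. 0 < t k * s / real (n k) - seq_sum w (nat \<lfloor>real (n k) * q\<rfloor>) / real (n k)"
        by (rule order_tendstoD(1))
      then show ?thesis using n_pos[of "1 / (q - y)"] n_pos[of 0]
      proof eventually_elim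
        case (elim k)
        let ?j = "nat \<lfloor>real (n k) * q\<rfloor>"
        have le: "seq_sum w ?j \<le> t k * s" using elim by (simp add: diff_divide_distrib[symmetric] zero_less_divide_iff)
        have "?j \<le> seq_count w (t k * s)"
          using le_seq_count_iff[OF w, of ?j "t k * s"] le by (cases "?j = 0") auto
        moreover have "real (n k) * q - 1 < real ?j" by linarith
        ultimately have "real (n k) * q - 1 < real (seq_count w (t k * s))" by linarith
        moreover have "1 < real (n k) * (q - y)" using elim(2) q by (simp add: field_simps)
        ultimately have "real (n k) * y < real (seq_count w (t k * s))" by (simp add: algebra_simps)
        then show ?case using elim(3) by (simp add: field_simps)
      qed
    qed
  qed
qed

section \<open>The coupled sequences\<close>

text \<open>
  A diagonal argument in one step: the sum of the variables with geometric weights tends to \<open>0\<close> in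
  mean by Tannery's theorem, hence almost surely along a subsequence.
\<close>

lemma (in prob_space) AE_subsequence_countable:
  fixes V :: "nat \<Rightarrow> nat \<Rightarrow> 'a \<Rightarrow> real"
  assumes meas [measurable]: "\<And>j k. V j k \<in> borel_measurable M"
    and bounds: "\<And>j k \<omega>. 0 \<le> V j k \<omega>" "\<And>j k \<omega>. V j k \<omega> \<le> 2"
    and lim: "\<And>j. (\<lambda>k. expectation (V j k)) \<longlonglongrightarrow> 0"
  shows "\<exists>r. strict_mono r \<and> (AE \<omega> in M. \<forall>j. (\<lambda>k. V j (r k) \<omega>) \<longlonglongrightarrow> 0)"
proof -
  define c where "c j = (1/2 :: real)^j" for j :: nat
  have c: "summable c" "0 < c j" for j unfolding c_def by (auto intro: summable_geometric)
  have c2: "summable (\<lambda>j. 2 * c j)" using c by (intro summable_mult) auto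
  have cV: "0 \<le> c j * V j k \<omega>" "c j * V j k \<omega> \<le> 2 * c j" for j k \<omega>
    using bounds(1)[of j k \<omega>] bounds(2)[of j k \<omega>] c(2)[of j] by (auto simp: mult.commute[of 2] intro: mult_left_mono)
  have sm: "summable (\<lambda>j. c j * V j k \<omega>)" for k \<omega>
    by (rule summable_comparison_test'[OF c2, of 0]) (use cV in auto)
  define U where "U k \<omega> = (\<Sum>j. c j * V j k \<omega>)" for k \<omega>
  have Um [measurable]: "U k \<in> borel_measurable M" for k unfolding U_def by measurable
  have U0: "0 \<le> U k \<omega>" for k \<omega> unfolding U_def using cV by (intro suminf_nonneg sm) auto
  have Ub: "U k \<omega> \<le> (\<Sum>j. 2 * c j)" for k \<omega> unfolding U_def using cV by (intro suminf_le sm c2) auto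
  have intU: "integrable M (U k)" for k
    by (rule integrable_const_bound[of _ "\<Sum>j. 2 * c j"]) (use U0 Ub in auto)
  have intV: "integrable M (V j k)" for j k
    by (rule integrable_const_bound[of _ 2]) (use bounds in auto)
  have eV: "0 \<le> expectation (V j k)" "expectation (V j k) \<le> 2" for j k
  proof -
    show "0 \<le> expectation (V j k)" using bounds by (intro Bochner_Integration.integral_nonneg) auto
    have "expectation (V j k) \<le> expectation (\<lambda>_. 2)" using bounds intV by (intro integral_mono) auto
    then show "expectation (V j k) \<le> 2" using prob_space by simp
  qed
  have cE: "0 \<le> c j * expectation (V j k)" "c j * expectation (V j k) \<le> 2 * c j" for j k
    using eV[of j k] c(2)[of j] by (auto simp: mult.commute[of 2] intro: mult_left_mono)
  have eU: "expectation (U k) = (\<Sum>j. c j * expectation (V j k))" for k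
  proof -
    have "expectation (\<lambda>\<omega>. \<Sum>j. c j * V j k \<omega>) = (\<Sum>j. expectation (\<lambda>\<omega>. c j * V j k \<omega>))"
    proof (rule integral_suminf)
      show "integrable M (\<lambda>\<omega>. c j * V j k \<omega>)" for j using intV by simp
      show "AE \<omega> in M. summable (\<lambda>j. norm (c j * V j k \<omega>))" using sm cV by simp
      have "(\<lambda>j. expectation (\<lambda>\<omega>. norm (c j * V j k \<omega>))) = (\<lambda>j. c j * expectation (V j k))"
        using cV by simp
      then show "summable (\<lambda>j. expectation (\<lambda>\<omega>. norm (c j * V j k \<omega>)))"
        by (simp only:) (rule summable_comparison_test'[OF c2, of 0], use cE in auto)
    qed
    then show ?thesis unfolding U_def by simp
  qed
  have "(\<lambda>k. \<Sum>j. c j * expectation (V j k)) \<longlonglongrightarrow> (\<Sum>j::nat. 0)"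
  proof (rule tannerys_theorem[THEN conjunct2, THEN conjunct2])
    show "(\<lambda>k. c j * expectation (V j k)) \<longlonglongrightarrow> 0" for j
      using tendsto_mult[OF tendsto_const lim, of "c j" j] by simp
    show "\<forall>\<^sub>F (j, k) in sequentially \<times>\<^sub>F sequentially. norm (c j * expectation (V j k)) \<le> 2 * c j"
      unfolding case_prod_beta
    proof (intro always_eventually allI)
      fix p show "norm (c (fst p) * expectation (V (fst p) (snd p))) \<le> 2 * c (fst p)"
        using cE[of "fst p" "snd p"] by (simp only: real_norm_def abs_of_nonneg)
    qed
  qed (use c2 in auto)
  then have "(\<lambda>k. expectation (\<lambda>\<omega>. norm (U k \<omega>))) \<longlonglongrightarrow> 0" using U0 by (simp add: eU)
  from tendsto_L1_AE_subseq[OF intU this]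
  obtain r where r: "strict_mono r" "AE \<omega> in M. (\<lambda>k. U (r k) \<omega>) \<longlonglongrightarrow> 0" by blast
  have "AE \<omega> in M. \<forall>j. (\<lambda>k. V j (r k) \<omega>) \<longlonglongrightarrow> 0"
    using r(2)
  proof eventually_elim
    case (elim \<omega>)
    show ?case
    proof
      fix j
      have le: "V j (r k) \<omega> \<le> (1 / c j) * U (r k) \<omega>" for k
      proof -
        have "(\<Sum>i\<in>{j}. c i * V i (r k) \<omega>) \<le> U (r k) \<omega>"
          unfolding U_def using cV by (intro sum_le_suminf sm) auto
        then show ?thesis using c(2)[of j] by (simp add: field_simps)
      qed
      show "(\<lambda>k. V j (r k) \<omega>) \<longlonglongrightarrow> 0"
      proof (rule tendsto_sandwich)
        show "\<forall>\<^sub>F k in sequentially. 0 \<le> V j (r k) \<omega>" using bounds by simp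
        show "\<forall>\<^sub>F k in sequentially. V j (r k) \<omega> \<le> (1 / c j) * U (r k) \<omega>" using le by simp
        show "(\<lambda>k. (1 / c j) * U (r k) \<omega>) \<longlonglongrightarrow> 0" using tendsto_mult[OF tendsto_const elim, of "1 / c j"] by simp
      qed simp
    qed
  qed
  then show ?thesis using r(1) by blast
qed

lemma (in prob_space) indep_vars_UNIV_nat:
  assumes "\<And>K. indep_vars M' X {..<K::nat}"
  shows "indep_vars M' X UNIV"
  unfolding indep_vars_def2
proof
  show "\<forall>i\<in>UNIV. random_variable (M' i) (X i)"
  proof
    fix i show "random_variable (M' i) (X i)" using assms[of "Suc i"] by (auto simp: indep_vars_def2)
  qed
  show "indep_sets (\<lambda>i. {X i -` A \<inter> space M |A. A \<in> sets (M' i)}) UNIV"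
  proof (subst indep_sets_finite_index_sets, intro allI impI)
    fix J :: "nat set" assume J: "finite J" "J \<noteq> {}"
    have "J \<subseteq> {..<Suc (Max J)}" using J by (auto simp: less_Suc_eq_le)
    then show "indep_sets (\<lambda>i. {X i -` A \<inter> space M |A. A \<in> sets (M' i)}) J"
      using assms[of "Suc (Max J)"] unfolding indep_vars_def2 by (auto intro: indep_sets_mono_index)
  qed
qed

lemma min_1_sum_le:
  assumes "finite I" "\<And>i. i \<in> I \<Longrightarrow> 0 \<le> f i"
  shows "min 1 (\<Sum>i\<in>I. f i) \<le> (\<Sum>i\<in>I. min 1 (f i :: real))"
  using assms
proof (induction I rule: finite_induct)
  case (insert x I)
  have "0 \<le> (\<Sum>i\<in>I. f i)" "0 \<le> f x" using insert by (auto intro: sum_nonneg)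
  then have "min 1 (f x + (\<Sum>i\<in>I. f i)) \<le> min 1 (f x) + min 1 (\<Sum>i\<in>I. f i)" by auto
  then show ?case using insert by simp
qed simp

text \<open>
  \<open>R\<close> is the law of a waiting time and \<open>m\<close> its mean.
\<close>

locale renewal_coupling = tail_coupling \<alpha> \<mu> Q a
  for \<alpha> :: real and \<mu> Q :: "real measure" and a :: "nat \<Rightarrow> real" +
  fixes N :: "(real \<Rightarrow> real) measure" and G :: "real \<Rightarrow> (real \<Rightarrow> real) \<Rightarrow> real" and R :: "real measure" and m :: real
  assumes G: "stable_subordinator N \<alpha> G" and G1: "distr N borel (G 1) = \<mu>"
    and R: "real_distribution R" and R_nonneg: "AE x in R. 0 \<le> x" and R_int: "integrable R (\<lambda>x. x)"
    and R_mean: "m = (\<integral>x. x \<partial>R)" and m_pos: "0 < m"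
begin

sublocale R: real_distribution R by (rule R)
sublocale N: prob_space N
  using G by (simp add: stable_subordinator_def stable_levy_process_def levy_process_def)

lemma levy: "levy_process N G"
  using G by (simp add: stable_subordinator_def stable_levy_process_def)

lemma G_meas: "0 \<le> t \<Longrightarrow> G t \<in> borel_measurable N"
  using levy by (simp add: levy_process_def)

definition Ys :: "(nat \<Rightarrow> real) measure" where "Ys = PiM {1..} (\<lambda>_. Q)"
definition Ws :: "(nat \<Rightarrow> real) measure" where "Ws = PiM {1..} (\<lambda>_. R)"

lemma sets_Ys [measurable_cong]: "sets Ys = sets (PiM {1..} (\<lambda>_. borel))"
  unfolding Ys_def by (intro sets_PiM_cong) auto

lemma sets_Ws [measurable_cong]: "sets Ws = sets (PiM {1..} (\<lambda>_. borel))"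
  unfolding Ws_def by (intro sets_PiM_cong) auto

sublocale Ys: prob_space Ys unfolding Ys_def by (intro prob_space_PiM Q.prob_space_axioms)
sublocale Ws: prob_space Ws unfolding Ws_def by (intro prob_space_PiM R.prob_space_axioms)

text \<open>
  The increments of \<open>G\<close> over the grid of mesh \<open>1/n\<close>, numbered from \<open>1\<close> like the rewards.
\<close>

definition delta :: "nat \<Rightarrow> nat \<Rightarrow> (real \<Rightarrow> real) \<Rightarrow> real" where
  "delta n i \<omega> = G (real i / real n) \<omega> - G (real (i - 1) / real n) \<omega>"

definition coupled_Y :: "nat \<Rightarrow> (real \<Rightarrow> real) \<Rightarrow> nat \<Rightarrow> real" where
  "coupled_Y n \<omega> = (\<lambda>i\<in>{1..}. match (norming n * delta n i \<omega>))"

lemma delta_meas [measurable]: "delta n i \<in> borel_measurable N"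
  unfolding delta_def by (intro borel_measurable_diff G_meas) auto

lemma norming_delta_law:
  assumes "1 \<le> i" "1 \<le> n"
  shows "distr N borel (\<lambda>\<omega>. norming n * delta n i \<omega>) = \<mu>"
proof -
  have st: "distr N borel (\<lambda>\<omega>. G (s + t) \<omega> - G s \<omega>) = distr N borel (G t)" if "0 \<le> s" "0 \<le> t" for s t
    using levy that by (simp add: levy_process_def)
  have sl: "distr N borel (G k) = distr N borel (\<lambda>\<omega>. k powr (1/\<alpha>) * G 1 \<omega>)" if "0 < k" for k
    using G that by (simp add: stable_subordinator_def stable_levy_process_def)
  have g1 [measurable]: "G 1 \<in> borel_measurable N" by (rule G_meas) simp
  have eq: "real (i - 1) / real n + 1 / real n = real i / real n"
    using assms by (simp add: of_nat_diff add_divide_distrib[symmetric])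
  have "distr N borel (\<lambda>\<omega>. G (real (i - 1) / real n + 1 / real n) \<omega> - G (real (i - 1) / real n) \<omega>) = distr N borel (G (1 / real n))"
    by (rule st) auto
  then have 1: "distr N borel (delta n i) = distr N borel (G (1 / real n))"
    unfolding eq delta_def[abs_def] .
  have "distr N borel (\<lambda>\<omega>. norming n * delta n i \<omega>) = distr (distr N borel (delta n i)) borel (\<lambda>x. norming n * x)"
    by (subst distr_distr) (auto simp: comp_def)
  also have "\<dots> = distr (distr N borel (\<lambda>\<omega>. (1 / real n) powr (1/\<alpha>) * G 1 \<omega>)) borel (\<lambda>x. norming n * x)"
    unfolding 1 using sl[of "1 / real n"] assms by simp
  also have "\<dots> = distr N borel (\<lambda>\<omega>. norming n * ((1 / real n) powr (1/\<alpha>) * G 1 \<omega>))"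
    by (subst distr_distr) (auto simp: comp_def)
  also have "(\<lambda>\<omega>. norming n * ((1 / real n) powr (1/\<alpha>) * G 1 \<omega>)) = G 1"
    unfolding norming_def using assms by (auto simp: powr_divide)
  finally show ?thesis using G1 by simp
qed

lemma delta_indep: "N.indep_vars (\<lambda>_. borel) (delta n) {1..}"
proof -
  have gen: "N.indep_vars (\<lambda>_. borel) (\<lambda>i \<omega>. G (t (Suc i)) \<omega> - G (t i) \<omega>) {..<K}"
    if "0 \<le> t 0" "mono t" for t :: "nat \<Rightarrow> real" and K
    using levy that by (simp add: levy_process_def)
  have "N.indep_vars (\<lambda>_. borel) (delta n) {..<K}" for K
  proof -
    \<comment> \<open>At \<open>i = 0\<close> the truncated difference repeats the grid point \<open>0\<close>, which adds a zero increment.\<close>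
    have "mono (\<lambda>i. real (i - 1) / real n)" unfolding mono_def
    proof (intro allI impI divide_right_mono)
      fix i j :: nat assume "i \<le> j"
      then show "real (i - 1) \<le> real (j - 1)" by simp
    qed simp
    then have "N.indep_vars (\<lambda>_. borel) (\<lambda>i \<omega>. G (real (Suc i - 1) / real n) \<omega> - G (real (i - 1) / real n) \<omega>) {..<K}"
      by (intro gen[of "\<lambda>i. real (i - 1) / real n"]) simp_all
    then show ?thesis unfolding delta_def[abs_def] diff_Suc_1 .
  qed
  then have "N.indep_vars (\<lambda>_. borel) (delta n) UNIV" by (rule N.indep_vars_UNIV_nat)
  then show ?thesis by (rule N.indep_vars_subset) simp
qed

lemma coupled_Y_meas [measurable]: "coupled_Y n \<in> measurable N (PiM {1..} (\<lambda>_. borel))"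
  unfolding coupled_Y_def by (intro measurable_restrict) measurable

lemma coupled_Y_law:
  assumes "1 \<le> n"
  shows "distr N (PiM {1..} (\<lambda>_. borel)) (coupled_Y n) = Ys"
proof -
  have law: "distr N borel (\<lambda>\<omega>. match (norming n * delta n i \<omega>)) = Q" if "i \<in> {1..}" for i
  proof -
    have "distr N borel (\<lambda>\<omega>. match (norming n * delta n i \<omega>)) = distr (distr N borel (\<lambda>\<omega>. norming n * delta n i \<omega>)) borel match"
      by (subst distr_distr) (auto simp: comp_def)
    then show ?thesis using norming_delta_law[of i n] that assms match_law by simp
  qed
  have "N.indep_vars (\<lambda>_. borel) (\<lambda>i \<omega>. match (norming n * delta n i \<omega>)) {1..}"
    by (rule N.indep_vars_compose2[OF delta_indep]) measurable
  then have "distr N (PiM {1..} (\<lambda>_. borel)) (\<lambda>\<omega>. \<lambda>i\<in>{1..}. match (norming n * delta n i \<omega>)) =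
     PiM {1..} (\<lambda>i. distr N borel (\<lambda>\<omega>. match (norming n * delta n i \<omega>)))"
    by (subst (asm) N.indep_vars_iff_distr_eq_PiM') auto
  also have "\<dots> = Ys" unfolding Ys_def by (intro PiM_cong refl law)
  finally show ?thesis unfolding coupled_Y_def[abs_def] .
qed

lemma Ws_coord: "i \<in> {1..} \<Longrightarrow> (\<lambda>w. w i) \<in> borel_measurable (PiM {1..} (\<lambda>_::nat. borel :: real measure))"
  by (rule measurable_component_singleton)

lemma seq_sum_meas [measurable]: "(\<lambda>w. seq_sum w k) \<in> borel_measurable (PiM {1..} (\<lambda>_::nat. borel :: real measure))"
  unfolding seq_sum_def by (intro borel_measurable_sum Ws_coord) auto

lemma renewal_seq_meas [measurable]: "Measurable.pred (PiM {1..} (\<lambda>_::nat. borel :: real measure)) renewal_seq"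
proof -
  have [measurable]: "(\<lambda>w. w (Suc i)) \<in> borel_measurable (PiM {1..} (\<lambda>_::nat. borel :: real measure))" for i
    by (rule Ws_coord) simp
  show ?thesis unfolding renewal_seq_def by measurable
qed

lemma Ws_iid:
  "Ws.indep_vars (\<lambda>_. borel) (\<lambda>i w. w i) {1..}" "1 \<le> i \<Longrightarrow> distr Ws borel (\<lambda>w. w i) = R"
proof -
  show "Ws.indep_vars (\<lambda>_. borel) (\<lambda>i w. w i) {1..}"
    unfolding Ws_def by (rule indep_vars_PiM_coordinates(1)) (simp_all add: R.prob_space_axioms)
  show "distr Ws borel (\<lambda>w. w i) = R" if "1 \<le> i"
    unfolding Ws_def by (rule indep_vars_PiM_coordinates(2)) (use that in \<open>simp_all add: R.prob_space_axioms\<close>)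
qed

lemma Ws_lln: "(\<lambda>n. \<integral>w. \<bar>seq_sum w n / real n - m\<bar> \<partial>Ws) \<longlonglongrightarrow> 0"
  unfolding seq_sum_def R_mean by (rule Ws.L1_law_of_large_numbers[OF Ws_iid R_int])

lemma Ws_mean_integrable: "integrable Ws (\<lambda>w. \<bar>seq_sum w n / real n - m\<bar>)"
proof -
  have "integrable Ws (\<lambda>w. w i)" if "i \<in> {1..n}" for i
  proof -
    have "integrable (distr Ws borel (\<lambda>w. w i)) (\<lambda>x. x)" using Ws_iid(2)[of i] R_int that by simp
    then show ?thesis using that by (subst (asm) integrable_distr_eq) (auto intro: measurable_component_singleton simp: sets_Ws cong: measurable_cong_sets)
  qed
  then show ?thesis unfolding seq_sum_def
    by (intro integrable_abs Bochner_Integration.integrable_diff integrable_divide_zero Bochner_Integration.integrable_sum) auto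
qed

lemma AE_renewal_seq: "AE w in Ws. renewal_seq w"
proof -
  have "AE w in Ws. 0 \<le> w (Suc i)" for i
    unfolding Ws_def using R_nonneg by (intro AE_PiM_component) (auto simp: R.prob_space_axioms)
  then have nn: "AE w in Ws. \<forall>i. 0 \<le> w (Suc i)" by (simp add: AE_all_countable)
  have "integrable Ws (\<lambda>w. \<bar>seq_sum w n / real n - m\<bar>)" for n by (rule Ws_mean_integrable)
  moreover have "(\<lambda>n. \<integral>w. norm \<bar>seq_sum w n / real n - m\<bar> \<partial>Ws) \<longlonglongrightarrow> 0" using Ws_lln by simp
  ultimately obtain r where r: "strict_mono r" "AE w in Ws. (\<lambda>n. \<bar>seq_sum w (r n) / real (r n) - m\<bar>) \<longlonglongrightarrow> 0"
    using tendsto_L1_AE_subseq[of Ws "\<lambda>n w. \<bar>seq_sum w n / real n - m\<bar>"] by blast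
  have r_top: "filterlim (\<lambda>n. real (r n)) at_top sequentially"
    using filterlim_compose[OF filterlim_real_sequentially filterlim_subseq[OF r(1)]] .
  show ?thesis using nn r(2)
  proof eventually_elim
    case (elim w)
    have "(\<lambda>n. seq_sum w (r n) / real (r n) - m) \<longlonglongrightarrow> 0" using elim(2) by (rule tendsto_rabs_zero_cancel)
    then have "(\<lambda>n. seq_sum w (r n) / real (r n)) \<longlonglongrightarrow> m" by (simp add: LIM_zero_iff)
    from filterlim_tendsto_pos_mult_at_top[OF this m_pos r_top]
    have top: "filterlim (\<lambda>n. seq_sum w (r n) / real (r n) * real (r n)) at_top sequentially" .
    have "\<exists>k. real b < seq_sum w k" for b :: nat
    proof -
      have "\<forall>\<^sub>F n in sequentially. real b < seq_sum w (r n) / real (r n) * real (r n)"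
        using top by (simp add: filterlim_at_top_dense)
      then obtain n where n: "real b < seq_sum w (r n) / real (r n) * real (r n)" by (auto simp: eventually_sequentially)
      then show ?thesis by (cases "r n = 0") auto
    qed
    then show ?case using elim(1) by (simp add: renewal_seq_def)
  qed
qed

text \<open>
  The truncation at \<open>1\<close> makes expectations finite: the increments of \<open>G\<close> have infinite mean.
\<close>

definition jump_error :: "nat \<Rightarrow> nat \<Rightarrow> (real \<Rightarrow> real) \<Rightarrow> real" where
  "jump_error n J \<omega> = min 1 (\<Sum>i=1..n * J. \<bar>coupled_Y n \<omega> i / a n - delta n i \<omega>\<bar>)"

lemma jump_error_meas [measurable]: "jump_error n J \<in> borel_measurable N"
proof -
  have "(\<lambda>\<omega>. coupled_Y n \<omega> i) \<in> borel_measurable N" if "i \<in> {1..n * J}" for i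
    using that unfolding coupled_Y_def by simp
  then show ?thesis unfolding jump_error_def
    by (intro borel_measurable_min borel_measurable_const borel_measurable_sum borel_measurable_abs borel_measurable_diff borel_measurable_divide) auto
qed

lemma jump_error_bounds: "0 \<le> jump_error n J \<omega>" "jump_error n J \<omega> \<le> 1"
  by (auto simp: jump_error_def sum_nonneg)

lemma jump_error_expectation: "(\<lambda>n. N.expectation (jump_error n J)) \<longlonglongrightarrow> 0"
proof (rule tendsto_sandwich)
  let ?E = "\<lambda>n. \<integral>x. min 1 \<bar>match x / a n - x / norming n\<bar> \<partial>\<mu>"
  show "\<forall>\<^sub>F n in sequentially. 0 \<le> N.expectation (jump_error n J)"
    using jump_error_bounds by (intro always_eventually allI Bochner_Integration.integral_nonneg) auto
  show "\<forall>\<^sub>F n in sequentially. N.expectation (jump_error n J) \<le> real J * (real n * ?E n)"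
    using eventually_ge_at_top[of 1]
  proof eventually_elim
    case (elim n)
    have norming: "norming n \<noteq> 0" using elim by (simp add: norming_def)
    have eq: "min 1 \<bar>coupled_Y n \<omega> i / a n - delta n i \<omega>\<bar> = (\<lambda>x. min 1 \<bar>match x / a n - x / norming n\<bar>) (norming n * delta n i \<omega>)"
      if "i \<in> {1..n * J}" for i \<omega> using that norming by (simp add: coupled_Y_def)
    have int: "integrable N (\<lambda>\<omega>. (\<lambda>x. min 1 \<bar>match x / a n - x / norming n\<bar>) (norming n * delta n i \<omega>))" for i
      by (rule N.integrable_const_bound[of _ 1]) auto
    have "N.expectation (jump_error n J) \<le> N.expectation (\<lambda>\<omega>. \<Sum>i=1..n * J. (\<lambda>x. min 1 \<bar>match x / a n - x / norming n\<bar>) (norming n * delta n i \<omega>))"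
    proof (rule integral_mono)
      show "integrable N (jump_error n J)" by (rule N.integrable_const_bound[of _ 1]) (use jump_error_bounds in auto)
      show "integrable N (\<lambda>\<omega>. \<Sum>i=1..n * J. (\<lambda>x. min 1 \<bar>match x / a n - x / norming n\<bar>) (norming n * delta n i \<omega>))"
        by (intro Bochner_Integration.integrable_sum int)
      fix \<omega>
      have "jump_error n J \<omega> \<le> (\<Sum>i=1..n * J. min 1 \<bar>coupled_Y n \<omega> i / a n - delta n i \<omega>\<bar>)"
        unfolding jump_error_def by (rule min_1_sum_le) auto
      then show "jump_error n J \<omega> \<le> (\<Sum>i=1..n * J. (\<lambda>x. min 1 \<bar>match x / a n - x / norming n\<bar>) (norming n * delta n i \<omega>))"
        using eq by simp
    qed
    also have "\<dots> = (\<Sum>i=1..n * J. N.expectation (\<lambda>\<omega>. (\<lambda>x. min 1 \<bar>match x / a n - x / norming n\<bar>) (norming n * delta n i \<omega>)))"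
      by (intro Bochner_Integration.integral_sum int)
    also have "\<dots> = (\<Sum>i=1..n * J. ?E n)"
    proof (rule sum.cong[OF refl])
      fix i assume i: "i \<in> {1..n * J}"
      have "(\<integral>x. min 1 \<bar>match x / a n - x / norming n\<bar> \<partial>distr N borel (\<lambda>\<omega>. norming n * delta n i \<omega>)) =
        N.expectation (\<lambda>\<omega>. (\<lambda>x. min 1 \<bar>match x / a n - x / norming n\<bar>) (norming n * delta n i \<omega>))"
        by (subst integral_distr) auto
      then show "N.expectation (\<lambda>\<omega>. (\<lambda>x. min 1 \<bar>match x / a n - x / norming n\<bar>) (norming n * delta n i \<omega>)) = ?E n"
        using norming_delta_law[of i n] i elim by simp
    qed
    finally show ?case by (simp add: mult_ac)
  qed
  show "(\<lambda>n. real J * (real n * ?E n)) \<longlonglongrightarrow> 0" using tendsto_mult[OF tendsto_const coupling_error, of "real J"] by simp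
qed simp

definition clock_error :: "nat \<Rightarrow> real \<Rightarrow> (nat \<Rightarrow> real) \<Rightarrow> real" where
  "clock_error n q w = min 1 \<bar>seq_sum w (nat \<lfloor>real n * q\<rfloor>) / real n - m * q\<bar>"

lemma clock_error_meas [measurable]: "clock_error n q \<in> borel_measurable Ws"
  unfolding clock_error_def by measurable

lemma clock_error_bounds: "0 \<le> clock_error n q w" "clock_error n q w \<le> 1"
  by (auto simp: clock_error_def)

lemma clock_error_expectation:
  assumes q: "0 \<le> q"
  shows "(\<lambda>n. Ws.expectation (clock_error n q)) \<longlonglongrightarrow> 0"
proof (cases "q = 0")
  case True
  have "clock_error n 0 = (\<lambda>w. 0)" for n by (simp add: clock_error_def seq_sum_def fun_eq_iff)
  then show ?thesis using True by simp
next
  case False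
  then have q0: "0 < q" using q by simp
  let ?k = "\<lambda>n. nat \<lfloor>real n * q\<rfloor>"
  let ?E = "\<lambda>k. \<integral>w. \<bar>seq_sum w k / real k - m\<bar> \<partial>Ws"
  have k_top: "filterlim ?k sequentially sequentially"
  proof -
    have "filterlim (\<lambda>n. real n * q) at_top sequentially"
      using q0 by (intro filterlim_at_top_mult_tendsto_pos[OF tendsto_const] filterlim_real_sequentially) auto
    then show ?thesis by (intro filterlim_compose[OF filterlim_nat_sequentially] filterlim_compose[OF filterlim_floor_sequentially])
  qed
  show ?thesis
  proof (rule tendsto_sandwich)
    show "\<forall>\<^sub>F n in sequentially. 0 \<le> Ws.expectation (clock_error n q)"
      using clock_error_bounds by (intro always_eventually allI Bochner_Integration.integral_nonneg) auto
    show "\<forall>\<^sub>F n in sequentially. Ws.expectation (clock_error n q) \<le> q * ?E (?k n) + m * (1 / real n)"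
      using eventually_ge_at_top[of 1]
    proof eventually_elim
      case (elim n)
      have n0: "0 < real n" using elim by simp
      have "real (?k n) = real_of_int \<lfloor>real n * q\<rfloor>" using q by simp
      then have k: "real (?k n) \<le> real n * q" "real n * q - 1 \<le> real (?k n)" by linarith+
      have kn: "0 \<le> real (?k n) / real n" "real (?k n) / real n \<le> q" "\<bar>real (?k n) / real n - q\<bar> \<le> 1 / real n"
      proof -
        show "0 \<le> real (?k n) / real n" by simp
        show 1: "real (?k n) / real n \<le> q" using k(1) n0 by (simp add: divide_le_eq mult.commute)
        have "(real n * q - 1) / real n \<le> real (?k n) / real n" using k(2) by (intro divide_right_mono) auto
        then have "q - 1 / real n \<le> real (?k n) / real n" using n0 by (simp add: diff_divide_distrib)
        then show "\<bar>real (?k n) / real n - q\<bar> \<le> 1 / real n" using 1 by linarith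
      qed
      have pw: "clock_error n q w \<le> q * \<bar>seq_sum w (?k n) / real (?k n) - m\<bar> + m * (1 / real n)" for w
      proof -
        have "seq_sum w (?k n) / real n = real (?k n) / real n * (seq_sum w (?k n) / real (?k n))"
          by (cases "?k n = 0") (auto simp: seq_sum_def)
        then have "seq_sum w (?k n) / real n - m * q = real (?k n) / real n * (seq_sum w (?k n) / real (?k n) - m) + m * (real (?k n) / real n - q)"
          by (simp add: algebra_simps)
        then have "\<bar>seq_sum w (?k n) / real n - m * q\<bar> \<le>
            \<bar>real (?k n) / real n * (seq_sum w (?k n) / real (?k n) - m)\<bar> + \<bar>m * (real (?k n) / real n - q)\<bar>"
          by (simp only: abs_triangle_ineq)
        also have "\<bar>real (?k n) / real n * (seq_sum w (?k n) / real (?k n) - m)\<bar> \<le> q * \<bar>seq_sum w (?k n) / real (?k n) - m\<bar>"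
          unfolding abs_mult using kn by (intro mult_right_mono) auto
        also have "\<bar>m * (real (?k n) / real n - q)\<bar> \<le> m * (1 / real n)"
          unfolding abs_mult using kn m_pos by (intro mult_mono) auto
        finally have "\<bar>seq_sum w (?k n) / real n - m * q\<bar> \<le> q * \<bar>seq_sum w (?k n) / real (?k n) - m\<bar> + m * (1 / real n)"
          by simp
        then show ?thesis unfolding clock_error_def by (rule order.trans[OF min.cobounded2])
      qed
      have "Ws.expectation (clock_error n q) \<le> Ws.expectation (\<lambda>w. q * \<bar>seq_sum w (?k n) / real (?k n) - m\<bar> + m * (1 / real n))"
      proof (rule integral_mono)
        show "integrable Ws (clock_error n q)" by (rule Ws.integrable_const_bound[of _ 1]) (use clock_error_bounds in auto)
        show "integrable Ws (\<lambda>w. q * \<bar>seq_sum w (?k n) / real (?k n) - m\<bar> + m * (1 / real n))"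
          by (intro Bochner_Integration.integrable_add integrable_mult_right Ws_mean_integrable Ws.integrable_const)
      qed (rule pw)
      also have "\<dots> = q * ?E (?k n) + m * (1 / real n)"
        using Ws_mean_integrable[of "?k n"] Ws.prob_space by simp
      finally show ?case .
    qed
    have "(\<lambda>n. q * ?E (?k n) + m * (1 / real n)) \<longlonglongrightarrow> q * 0 + m * 0"
      by (intro tendsto_intros filterlim_compose[OF Ws_lln k_top] lim_1_over_n)
    then show "(\<lambda>n. q * ?E (?k n) + m * (1 / real n)) \<longlonglongrightarrow> 0" by simp
  qed simp
qed

end

section \<open>The coupled renewal reward process\<close>

lemma continuous_map_borel_of:
  assumes "continuous_map T euclideanreal H"
  shows "H \<in> borel_measurable (borel_of T)"
proof (rule borel_measurableI)
  fix S :: "real set" assume "open S"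
  then have "openin T {x \<in> topspace T. H x \<in> S}" using assms by (simp add: continuous_map_def)
  moreover have sub: "{U. openin T U} \<subseteq> Pow (topspace T)" using openin_subset by blast
  ultimately have "{x \<in> topspace T. H x \<in> S} \<in> sets (borel_of T)"
    unfolding borel_of_def by (simp add: sets_measure_of sigma_sets.Basic)
  moreover have "H -` S \<inter> space (borel_of T) = {x \<in> topspace T. H x \<in> S}"
    unfolding borel_of_def using sub by (auto simp: space_measure_of)
  ultimately show "H -` S \<inter> space (borel_of T) \<in> sets (borel_of T)" by simp
qed

lemma (in prob_space) distr_pair_snd:
  assumes "prob_space L"
  shows "distr (M \<Otimes>\<^sub>M L) L snd = L"
proof (rule measure_eqI)
  interpret L: prob_space L by fact
  fix A assume "A \<in> sets (distr (M \<Otimes>\<^sub>M L) L snd)"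
  then have A: "A \<in> sets L" by simp
  have "emeasure (distr (M \<Otimes>\<^sub>M L) L snd) A = emeasure (M \<Otimes>\<^sub>M L) (space M \<times> A)"
    using A sets.sets_into_space[OF A]
    by (subst emeasure_distr) (auto simp: space_pair_measure intro!: arg_cong2[where f=emeasure])
  then show "emeasure (distr (M \<Otimes>\<^sub>M L) L snd) A = emeasure L A"
    using A by (simp add: L.emeasure_pair_measure_Times emeasure_space_1)
qed simp

context renewal_coupling
begin

abbreviation seq_algebra :: "(nat \<Rightarrow> real) measure" where "seq_algebra \<equiv> PiM {1..} (\<lambda>_. borel)"

text \<open>
  The path of the renewal reward process at scale \<open>t\<close>, normalised by \<open>a n\<close>. Without the guard it
  could leave the space of cadlag paths on a null event.
\<close>

definition reward_path :: "real \<Rightarrow> nat \<Rightarrow> (nat \<Rightarrow> real) \<times> (nat \<Rightarrow> real) \<Rightarrow> real \<Rightarrow> real" where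
  "reward_path t n p = (if renewal_seq (snd p) then (\<lambda>s\<in>{0..}. seq_sum (fst p) (seq_count (snd p) (t * s)) / a n)
     else (\<lambda>s\<in>{0..}. 0))"

lemma reward_path_cadlag:
  assumes "0 < t"
  shows "reward_path t n p \<in> cadlag_space"
proof (cases "renewal_seq (snd p)")
  case True
  then show ?thesis using renewal_path_cadlag[OF True assms, of "\<lambda>k. seq_sum (fst p) k / a n"] by (simp add: reward_path_def)
next
  case False
  have "(\<lambda>s\<in>{0..}. (\<lambda>_. 0) ((\<lambda>_. 0::nat) s) :: real) \<in> cadlag_space"
    by (rule step_path_cadlag) (auto intro: gt_ex)
  then show ?thesis using False by (simp add: reward_path_def)
qed

lemma reward_path_measurable:
  assumes t: "0 < t"
  shows "reward_path t n \<in> measurable (seq_algebra \<Otimes>\<^sub>M seq_algebra) (borel_of J1_topology)"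
proof (rule measurable_J1)
  fix s :: real assume s: "0 \<le> s"
  define cnt where "cnt p = (if renewal_seq (snd p) then seq_count (snd p) (t * s) else 0)"
    for p :: "(nat \<Rightarrow> real) \<times> (nat \<Rightarrow> real)"
  have ge: "{p \<in> space (seq_algebra \<Otimes>\<^sub>M seq_algebra). k \<le> cnt p} \<in> sets (seq_algebra \<Otimes>\<^sub>M seq_algebra)" for k
  proof (cases "k = 0")
    case False
    then have "k \<le> cnt p \<longleftrightarrow> renewal_seq (snd p) \<and> seq_sum (snd p) k \<le> t * s" for p
      using le_seq_count_iff[of "snd p" k "t * s"] by (simp add: cnt_def)
    then have "{p \<in> space (seq_algebra \<Otimes>\<^sub>M seq_algebra). k \<le> cnt p} =
      {p \<in> space (seq_algebra \<Otimes>\<^sub>M seq_algebra). renewal_seq (snd p) \<and> seq_sum (snd p) k \<le> t * s}" by (simp only:)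
    also have "\<dots> \<in> sets (seq_algebra \<Otimes>\<^sub>M seq_algebra)" by measurable
    finally show ?thesis .
  qed simp
  have cnt: "cnt \<in> measurable (seq_algebra \<Otimes>\<^sub>M seq_algebra) (count_space UNIV)"
  proof (subst measurable_count_space_eq2_countable, intro conjI ballI)
    fix k :: nat
    have "cnt -` {k} \<inter> space (seq_algebra \<Otimes>\<^sub>M seq_algebra) = {p \<in> space (seq_algebra \<Otimes>\<^sub>M seq_algebra). k \<le> cnt p} - {p \<in> space (seq_algebra \<Otimes>\<^sub>M seq_algebra). Suc k \<le> cnt p}"
      by auto
    then show "cnt -` {k} \<inter> space (seq_algebra \<Otimes>\<^sub>M seq_algebra) \<in> sets (seq_algebra \<Otimes>\<^sub>M seq_algebra)" using ge by auto
  qed auto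
  have "(\<lambda>p. seq_sum (fst p) (cnt p)) \<in> borel_measurable (seq_algebra \<Otimes>\<^sub>M seq_algebra)"
    by (rule measurable_compose_countable[OF _ cnt]) measurable
  then have "(\<lambda>p. if renewal_seq (snd p) then seq_sum (fst p) (cnt p) / a n else 0) \<in> borel_measurable (seq_algebra \<Otimes>\<^sub>M seq_algebra)"
    by measurable
  also have "(\<lambda>p. if renewal_seq (snd p) then seq_sum (fst p) (cnt p) / a n else 0) = (\<lambda>p. reward_path t n p s)"
    using s by (auto simp: reward_path_def cnt_def fun_eq_iff)
  finally show "(\<lambda>p. reward_path t n p s) \<in> borel_measurable (seq_algebra \<Otimes>\<^sub>M seq_algebra)" .
qed (rule reward_path_cadlag[OF t])

lemma sum_delta: "(\<Sum>i=1..c. delta n i \<omega>) = G (real c / real n) \<omega> - G 0 \<omega>"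
  by (induction c) (simp_all add: delta_def)

text \<open>
  If the clock reads \<open>c\<close>, the coupled path is the sum of the first \<open>c\<close> normalised rewards, while \<open>G\<close>
  at time \<open>c / n\<close> is the sum of the first \<open>c\<close> increments. These differ by at most the jump error, and
  \<open>c / n\<close> as a function of time is a deformation of the kind treated in
  \<open>J1_nbhd_of_time_deformation\<close>.
\<close>

lemma reward_path_limit:
  assumes x: "sample_path G \<omega> \<in> cadlag_space" and G0: "G 0 \<omega> = 0" and w: "renewal_seq w"
    and t: "\<And>k. 0 < t k" and n_top: "filterlim n at_top sequentially" and tn: "(\<lambda>k. t k / real (n k)) \<longlonglongrightarrow> m"
    and jump: "\<And>J. (\<lambda>k. jump_error (n k) J \<omega>) \<longlonglongrightarrow> 0"
    and clock: "\<And>q. q \<in> \<rat> \<Longrightarrow> 0 \<le> q \<Longrightarrow> (\<lambda>k. clock_error (n k) q w) \<longlonglongrightarrow> 0"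
  shows "limitin J1_topology (\<lambda>k. reward_path (t k) (n k) (coupled_Y (n k) \<omega>, w)) (sample_path G \<omega>) sequentially"
  unfolding limitin_J1_iff_nbhd
proof (intro conjI x allI impI)
  fix N' \<epsilon> :: real assume "\<epsilon> > 0"
  from J1_nbhd_of_time_deformation[OF x this, of N']
  obtain \<delta> T where \<delta>: "\<delta> > 0" and T: "\<And>\<tau> y. y \<in> cadlag_space \<Longrightarrow>
    (\<forall>u\<in>{0..T}. \<exists>v\<ge>0. \<forall>s\<ge>0. u \<le> \<tau> s \<longleftrightarrow> v \<le> s) \<Longrightarrow>
    (\<forall>s\<in>{0..T}. 0 \<le> \<tau> s \<and> \<bar>\<tau> s - s\<bar> < \<delta> \<and> \<bar>y s - sample_path G \<omega> (\<tau> s)\<bar> < \<delta>) \<Longrightarrow> y \<in> J1_nbhd N' \<epsilon> (sample_path G \<omega>)"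
    by metis
  define \<delta>' where "\<delta>' = min \<delta> 1"
  have \<delta>': "0 < \<delta>'" "\<delta>' \<le> \<delta>" "\<delta>' \<le> 1" using \<delta> by (auto simp: \<delta>'_def)
  define J where "J = nat \<lceil>\<bar>T\<bar> + 1\<rceil>"
  have J: "T + 1 \<le> real J" unfolding J_def by linarith
  have lln: "(\<lambda>k. seq_sum w (nat \<lfloor>real (n k) * q\<rfloor>) / real (n k)) \<longlonglongrightarrow> m * q" if "q \<in> \<rat>" "0 \<le> q" for q
  proof -
    let ?d = "\<lambda>k. \<bar>seq_sum w (nat \<lfloor>real (n k) * q\<rfloor>) / real (n k) - m * q\<bar>"
    have c: "(\<lambda>k. min 1 (?d k)) \<longlonglongrightarrow> 0" using clock[OF that] by (simp add: clock_error_def)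
    then have "\<forall>\<^sub>F k in sequentially. min 1 (?d k) < 1" by (intro order_tendstoD(2)) auto
    then have "\<forall>\<^sub>F k in sequentially. min 1 (?d k) = ?d k" by eventually_elim auto
    from Lim_transform_eventually[OF c this]
    have "(\<lambda>k. seq_sum w (nat \<lfloor>real (n k) * q\<rfloor>) / real (n k) - m * q) \<longlonglongrightarrow> 0" by (rule tendsto_rabs_zero_cancel)
    then show ?thesis by (simp add: LIM_zero_iff)
  qed
  have "\<forall>\<^sub>F k in sequentially. \<forall>s\<in>{0..T}. \<bar>real (seq_count w (t k * s)) / real (n k) - s\<bar> < \<delta>'"
    by (rule renewal_count_uniform[OF w t m_pos n_top tn lln \<delta>'(1)])
  moreover have "\<forall>\<^sub>F k in sequentially. jump_error (n k) J \<omega> < \<delta>'"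
    using jump \<delta>' by (intro order_tendstoD(2)) auto
  moreover have "\<forall>\<^sub>F k in sequentially. 1 \<le> n k" using n_top by (simp add: filterlim_at_top)
  ultimately show "\<forall>\<^sub>F k in sequentially. reward_path (t k) (n k) (coupled_Y (n k) \<omega>, w) \<in> J1_nbhd N' \<epsilon> (sample_path G \<omega>)"
  proof eventually_elim
    case (elim k)
    then have n0: "0 < n k" by simp
    let ?c = "\<lambda>s. seq_count w (t k * s)"
    show ?case
    proof (rule T[OF reward_path_cadlag[OF t], of "\<lambda>s. real (?c s) / real (n k)"])
      show "\<forall>u\<in>{0..T}. \<exists>v\<ge>0. \<forall>s\<ge>0. u \<le> real (?c s) / real (n k) \<longleftrightarrow> v \<le> s"
        using renewal_galois[OF w t n0] by auto
      show "\<forall>s\<in>{0..T}. 0 \<le> real (?c s) / real (n k) \<and> \<bar>real (?c s) / real (n k) - s\<bar> < \<delta> \<and>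
        \<bar>reward_path (t k) (n k) (coupled_Y (n k) \<omega>, w) s - sample_path G \<omega> (real (?c s) / real (n k))\<bar> < \<delta>"
      proof
        fix s assume s: "s \<in> {0..T}"
        have 1: "\<bar>real (?c s) / real (n k) - s\<bar> < \<delta>'" using elim s by blast
        then have "real (?c s) / real (n k) \<le> real J" using s J \<delta>' by auto
        then have "real (?c s) \<le> real (n k * J)" using n0 by (simp add: divide_le_eq mult.commute)
        then have c: "?c s \<le> n k * J" by linarith
        have eq: "reward_path (t k) (n k) (coupled_Y (n k) \<omega>, w) s - sample_path G \<omega> (real (?c s) / real (n k)) =
          (\<Sum>i=1..?c s. coupled_Y (n k) \<omega> i / a (n k) - delta (n k) i \<omega>)"
          using s w by (simp add: reward_path_def seq_sum_def sample_path_def sum_subtractf sum_delta[simplified] G0 sum_divide_distrib)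
        have "\<bar>\<Sum>i=1..?c s. coupled_Y (n k) \<omega> i / a (n k) - delta (n k) i \<omega>\<bar> \<le> (\<Sum>i=1..?c s. \<bar>coupled_Y (n k) \<omega> i / a (n k) - delta (n k) i \<omega>\<bar>)" by (rule sum_abs)
        also have "\<dots> \<le> (\<Sum>i=1..n k * J. \<bar>coupled_Y (n k) \<omega> i / a (n k) - delta (n k) i \<omega>\<bar>)"
          by (rule sum_mono2) (use c in \<open>simp_all add: atLeastatMost_subset_iff\<close>)
        also have "\<dots> < \<delta>'" using elim(2) \<delta>'(3) unfolding jump_error_def min_less_iff_disj by (meson not_less)
        finally have "\<bar>reward_path (t k) (n k) (coupled_Y (n k) \<omega>, w) s - sample_path G \<omega> (real (?c s) / real (n k))\<bar> < \<delta>'"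
          unfolding eq .
        then show "0 \<le> real (?c s) / real (n k) \<and> \<bar>real (?c s) / real (n k) - s\<bar> < \<delta> \<and>
          \<bar>reward_path (t k) (n k) (coupled_Y (n k) \<omega>, w) s - sample_path G \<omega> (real (?c s) / real (n k))\<bar> < \<delta>"
          using 1 \<delta>' by auto
      qed
    qed
  qed
qed

definition clock_index :: "real \<Rightarrow> nat" where "clock_index t = nat \<lfloor>t / m\<rfloor>"

lemma clock_index_at_top: "filterlim clock_index at_top at_top"
proof -
  have "filterlim (\<lambda>t. t / m) at_top at_top"
    unfolding divide_inverse using m_pos by (intro filterlim_at_top_mult_tendsto_pos[OF tendsto_const] filterlim_ident) auto
  then show ?thesis unfolding clock_index_def
    by (intro filterlim_compose[OF filterlim_nat_sequentially] filterlim_compose[OF filterlim_floor_sequentially])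
qed

lemma clock_index_ratio:
  assumes X: "filterlim X at_top sequentially"
  shows "(\<lambda>k. X k / real (clock_index (X k))) \<longlonglongrightarrow> m"
proof -
  have inv0: "(\<lambda>k. 1 / X k) \<longlonglongrightarrow> 0"
    using tendsto_inverse_0_at_top[OF X] by (simp add: inverse_eq_divide)
  have "(\<lambda>k. real (clock_index (X k)) / X k) \<longlonglongrightarrow> 1 / m"
  proof (rule tendsto_sandwich)
    have pos: "\<forall>\<^sub>F k in sequentially. 0 < X k" using X by (simp add: filterlim_at_top_dense)
    have b: "x / m - 1 \<le> real (clock_index x)" "real (clock_index x) \<le> x / m" if "0 < x" for x
    proof -
      have "0 \<le> \<lfloor>x / m\<rfloor>" using that m_pos by simp
      then have "real (clock_index x) = real_of_int \<lfloor>x / m\<rfloor>" by (simp add: clock_index_def)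
      then show "x / m - 1 \<le> real (clock_index x)" "real (clock_index x) \<le> x / m" by linarith+
    qed
    show "\<forall>\<^sub>F k in sequentially. 1 / m - 1 / X k \<le> real (clock_index (X k)) / X k"
      using pos
    proof eventually_elim
      case (elim k)
      have "(X k / m - 1) / X k \<le> real (clock_index (X k)) / X k" using b(1)[OF elim] elim by (intro divide_right_mono) auto
      then show ?case using elim by (simp add: diff_divide_distrib)
    qed
    show "\<forall>\<^sub>F k in sequentially. real (clock_index (X k)) / X k \<le> 1 / m"
      using pos
    proof eventually_elim
      case (elim k)
      have "real (clock_index (X k)) / X k \<le> (X k / m) / X k" using b(2)[OF elim] elim by (intro divide_right_mono) auto
      then show ?case using elim by simp
    qed
    show "(\<lambda>k. 1 / m - 1 / X k) \<longlonglongrightarrow> 1 / m" using tendsto_diff[OF tendsto_const inv0, of "1 / m"] by simp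
  qed simp
  from tendsto_inverse[OF this] show ?thesis using m_pos by (simp add: inverse_eq_divide)
qed

definition coupled :: "real \<Rightarrow> (real \<Rightarrow> real) \<times> (nat \<Rightarrow> real) \<Rightarrow> real \<Rightarrow> real" where
  "coupled t p = reward_path t (clock_index t) (coupled_Y (clock_index t) (fst p), snd p)"

sublocale NW: prob_space "N \<Otimes>\<^sub>M Ws"
  by (intro prob_space_pair N.prob_space_axioms Ws.prob_space_axioms)

lemma coupled_measurable: "0 < t \<Longrightarrow> coupled t \<in> measurable (N \<Otimes>\<^sub>M Ws) (borel_of J1_topology)"
proof -
  assume "0 < t"
  have [measurable]: "snd \<in> measurable (N \<Otimes>\<^sub>M Ws) seq_algebra"
    using measurable_snd[of N Ws] sets_Ws by (simp cong: measurable_cong_sets)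
  have "(\<lambda>p. (coupled_Y (clock_index t) (fst p), snd p)) \<in> measurable (N \<Otimes>\<^sub>M Ws) (seq_algebra \<Otimes>\<^sub>M seq_algebra)" by measurable
  from measurable_compose[OF this reward_path_measurable[OF \<open>0 < t\<close>, of "clock_index t"]]
  show ?thesis unfolding coupled_def[abs_def] .
qed

lemma paths_cadlag: "\<omega> \<in> space N \<Longrightarrow> sample_path G \<omega> \<in> cadlag_space"
  using levy by (simp add: levy_process_def)

lemma G_path_measurable: "sample_path G \<in> measurable N (borel_of J1_topology)"
  by (rule measurable_J1) (use paths_cadlag G_meas in \<open>auto simp: sample_path_def\<close>)

lemma coupled_AE_subsequence:
  assumes T: "\<And>k. 0 < T k" "filterlim T at_top sequentially"
  shows "\<exists>s. strict_mono s \<and> (AE p in N \<Otimes>\<^sub>M Ws. limitin J1_topology (\<lambda>k. coupled (T (s k)) p) (sample_path G (fst p)) sequentially)"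
proof -
  define n where "n k = clock_index (T k)" for k
  have n_top: "filterlim n at_top sequentially" unfolding n_def by (rule filterlim_compose[OF clock_index_at_top T(2)])
  define qq where "qq j = real_of_rat \<bar>from_nat j\<bar>" for j :: nat
  have qq0: "0 \<le> qq j" for j by (simp add: qq_def)
  have qq: "\<exists>j. q = qq j" if "q \<in> \<rat>" "0 \<le> q" for q
  proof -
    obtain x where x: "q = real_of_rat x" using \<open>q \<in> \<rat>\<close> by (rule Rats_cases)
    then have "q = qq (to_nat x)" using that unfolding qq_def by simp
    then show ?thesis ..
  qed
  \<comment> \<open>One family of variables controls both the horizons \<open>j\<close> and the clock at the times \<open>qq j\<close>.\<close>
  define V where "V j k p = jump_error (n k) j (fst p) + clock_error (n k) (qq j) (snd p)" for j k and p :: "(real \<Rightarrow> real) \<times> (nat \<Rightarrow> real)"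
  have dfst: "distr (N \<Otimes>\<^sub>M Ws) N fst = N" by (rule Ws.distr_pair_fst)
  have dsnd: "distr (N \<Otimes>\<^sub>M Ws) Ws snd = Ws" by (rule N.distr_pair_snd[OF Ws.prob_space_axioms])
  have "\<exists>r. strict_mono r \<and> (AE p in N \<Otimes>\<^sub>M Ws. \<forall>j. (\<lambda>k. V j (r k) p) \<longlonglongrightarrow> 0)"
  proof (rule NW.AE_subsequence_countable)
    show "V j k \<in> borel_measurable (N \<Otimes>\<^sub>M Ws)" for j k unfolding V_def by measurable
    show "0 \<le> V j k p" "V j k p \<le> 2" for j k p
      unfolding V_def using jump_error_bounds[of "n k" j "fst p"] clock_error_bounds[of "n k" "qq j" "snd p"] by linarith+
    fix j
    have "NW.expectation (V j k) = N.expectation (jump_error (n k) j) + Ws.expectation (clock_error (n k) (qq j))" for k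
    proof -
      have "NW.expectation (V j k) = NW.expectation (\<lambda>p. jump_error (n k) j (fst p)) + NW.expectation (\<lambda>p. clock_error (n k) (qq j) (snd p))"
        unfolding V_def
      proof (rule Bochner_Integration.integral_add)
        show "integrable (N \<Otimes>\<^sub>M Ws) (\<lambda>p. jump_error (n k) j (fst p))"
          by (rule NW.integrable_const_bound[of _ 1]) (use jump_error_bounds in auto)
        show "integrable (N \<Otimes>\<^sub>M Ws) (\<lambda>p. clock_error (n k) (qq j) (snd p))"
          by (rule NW.integrable_const_bound[of _ 1]) (use clock_error_bounds in auto)
      qed
      also have "NW.expectation (\<lambda>p. jump_error (n k) j (fst p)) = (\<integral>\<omega>. jump_error (n k) j \<omega> \<partial>distr (N \<Otimes>\<^sub>M Ws) N fst)"
        by (subst integral_distr) auto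
      also have "NW.expectation (\<lambda>p. clock_error (n k) (qq j) (snd p)) = (\<integral>w. clock_error (n k) (qq j) w \<partial>distr (N \<Otimes>\<^sub>M Ws) Ws snd)"
        by (subst integral_distr) auto
      finally show ?thesis unfolding dfst dsnd .
    qed
    moreover have "(\<lambda>k. N.expectation (jump_error (n k) j) + Ws.expectation (clock_error (n k) (qq j))) \<longlonglongrightarrow> 0 + 0"
      by (intro tendsto_add filterlim_compose[OF jump_error_expectation n_top]
          filterlim_compose[OF clock_error_expectation[OF qq0] n_top])
    ultimately show "(\<lambda>k. NW.expectation (V j k)) \<longlonglongrightarrow> 0" by simp
  qed
  then obtain s where s: "strict_mono s" and V: "AE p in N \<Otimes>\<^sub>M Ws. \<forall>j. (\<lambda>k. V j (s k) p) \<longlonglongrightarrow> 0" by blast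
  have g0: "AE \<omega> in N. G 0 \<omega> = 0" using levy by (simp only: levy_process_def)
  have "AE \<omega> in distr (N \<Otimes>\<^sub>M Ws) N fst. G 0 \<omega> = 0" unfolding dfst by (rule g0)
  then have "AE p in N \<Otimes>\<^sub>M Ws. G 0 (fst p) = 0" by (rule AE_distrD[rotated]) (rule measurable_fst)
  moreover have "AE w in distr (N \<Otimes>\<^sub>M Ws) Ws snd. renewal_seq w" unfolding dsnd by (rule AE_renewal_seq)
  then have "AE p in N \<Otimes>\<^sub>M Ws. renewal_seq (snd p)" by (rule AE_distrD[rotated]) (rule measurable_snd)
  ultimately have "AE p in N \<Otimes>\<^sub>M Ws. limitin J1_topology (\<lambda>k. coupled (T (s k)) p) (sample_path G (fst p)) sequentially"
    using V AE_space
  proof eventually_elim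
    case (elim p)
    have Ts: "filterlim (\<lambda>k. T (s k)) at_top sequentially" using filterlim_compose[OF T(2) filterlim_subseq[OF s]] .
    have j0: "(\<lambda>k. jump_error (n (s k)) j (fst p)) \<longlonglongrightarrow> 0" for j
    proof (rule tendsto_sandwich[where f="\<lambda>_. 0"])
      show "\<forall>\<^sub>F k in sequentially. jump_error (n (s k)) j (fst p) \<le> V j (s k) p"
        using clock_error_bounds by (simp add: V_def)
      show "(\<lambda>k. V j (s k) p) \<longlonglongrightarrow> 0" using elim by blast
    qed (use jump_error_bounds in auto)
    have c0: "(\<lambda>k. clock_error (n (s k)) (qq j) (snd p)) \<longlonglongrightarrow> 0" for j
    proof (rule tendsto_sandwich[where f="\<lambda>_. 0"])
      show "\<forall>\<^sub>F k in sequentially. clock_error (n (s k)) (qq j) (snd p) \<le> V j (s k) p"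
        using jump_error_bounds by (simp add: V_def)
      show "(\<lambda>k. V j (s k) p) \<longlonglongrightarrow> 0" using elim by blast
    qed (use clock_error_bounds in auto)
    have "limitin J1_topology (\<lambda>k. reward_path (T (s k)) (n (s k)) (coupled_Y (n (s k)) (fst p), snd p)) (sample_path G (fst p)) sequentially"
    proof (rule reward_path_limit)
      show "sample_path G (fst p) \<in> cadlag_space" using elim by (intro paths_cadlag) (auto simp: space_pair_measure)
      show "filterlim (\<lambda>k. n (s k)) at_top sequentially" using filterlim_compose[OF n_top filterlim_subseq[OF s]] .
      show "(\<lambda>k. T (s k) / real (n (s k))) \<longlonglongrightarrow> m" unfolding n_def by (rule clock_index_ratio[OF Ts])
      show "(\<lambda>k. clock_error (n (s k)) q (snd p)) \<longlonglongrightarrow> 0" if "q \<in> \<rat>" "0 \<le> q" for q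
        using qq[OF that] c0 by blast
    qed (use elim T j0 in auto)
    then show ?case unfolding coupled_def n_def .
  qed
  then show ?thesis using s by blast
qed

text \<open>
  The coupled processes converge in probability only; but a sequence of numbers converges as soon as
  each subsequence has a further subsequence that does, and that one may be chosen with almost sure
  convergence.
\<close>

theorem coupled_expectation_limit:
  assumes H: "continuous_map J1_topology euclideanreal H" and bdd: "bounded (H ` topspace J1_topology)"
  shows "((\<lambda>t. \<integral>p. H (coupled t p) \<partial>(N \<Otimes>\<^sub>M Ws)) \<longlongrightarrow> (\<integral>\<omega>. H (sample_path G \<omega>) \<partial>N)) at_top"
proof (rule tendsto_at_topI_sequentially)
  fix X :: "nat \<Rightarrow> real" assume X: "filterlim X at_top sequentially"
  \<comment> \<open>All scales become positive, and only finitely many terms change.\<close>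
  define T where "T k = max 1 (X k)" for k
  have T0: "0 < T k" for k by (simp add: T_def)
  have "\<forall>\<^sub>F k in sequentially. 1 \<le> X k" using X unfolding filterlim_at_top by blast
  then have TX: "\<forall>\<^sub>F k in sequentially. T k = X k" by eventually_elim (simp add: T_def)
  have T_top: "filterlim T at_top sequentially"
    using X by (rule filterlim_at_top_mono) (simp add: T_def)
  have Hm [measurable]: "H \<in> borel_measurable (borel_of J1_topology)" by (rule continuous_map_borel_of[OF H])
  obtain B where B: "\<And>x. x \<in> cadlag_space \<Longrightarrow> \<bar>H x\<bar> \<le> B" using bdd by (auto simp: bounded_iff)
  let ?L = "\<integral>\<omega>. H (sample_path G \<omega>) \<partial>N" and ?f = "\<lambda>t. \<integral>p. H (coupled t p) \<partial>(N \<Otimes>\<^sub>M Ws)"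
  have L: "?L = (\<integral>p. H (sample_path G (fst p)) \<partial>(N \<Otimes>\<^sub>M Ws))"
  proof -
    have [measurable]: "(\<lambda>\<omega>. H (sample_path G \<omega>)) \<in> borel_measurable N" using measurable_compose[OF G_path_measurable Hm] .
    have "(\<integral>\<omega>. H (sample_path G \<omega>) \<partial>distr (N \<Otimes>\<^sub>M Ws) N fst) = (\<integral>p. H (sample_path G (fst p)) \<partial>(N \<Otimes>\<^sub>M Ws))"
      by (subst integral_distr) auto
    then show ?thesis unfolding Ws.distr_pair_fst .
  qed
  have "(\<lambda>k. ?f (T k)) \<longlonglongrightarrow> ?L"
  proof (rule ccontr)
    assume "\<not> (\<lambda>k. ?f (T k)) \<longlonglongrightarrow> ?L"
    then obtain e where e: "e > 0" "\<not> (\<forall>\<^sub>F k in sequentially. dist (?f (T k)) ?L < e)" by (auto simp: tendsto_iff)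
    obtain r :: "nat \<Rightarrow> nat" where rr: "strict_mono r \<and> (\<forall>k. \<not> dist (?f (T (r k))) ?L < e)"
      using not_eventually_sequentiallyD[OF e(2)] ..
    then have r: "strict_mono r" "\<And>k. \<not> dist (?f (T (r k))) ?L < e" by auto
    have "filterlim (\<lambda>k. T (r k)) at_top sequentially" using filterlim_compose[OF T_top filterlim_subseq[OF r(1)]] .
    from coupled_AE_subsequence[of "\<lambda>k. T (r k)", OF T0 this]
    obtain s where s: "AE p in N \<Otimes>\<^sub>M Ws. limitin J1_topology (\<lambda>k. coupled (T (r (s k))) p) (sample_path G (fst p)) sequentially"
      by blast
    have "(\<lambda>k. ?f (T (r (s k)))) \<longlonglongrightarrow> (\<integral>p. H (sample_path G (fst p)) \<partial>(N \<Otimes>\<^sub>M Ws))"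
    proof (rule integral_dominated_convergence[where w="\<lambda>_. B"])
      show "(\<lambda>p. H (sample_path G (fst p))) \<in> borel_measurable (N \<Otimes>\<^sub>M Ws)"
        using measurable_compose[OF measurable_compose[OF measurable_fst G_path_measurable] Hm] .
      show "(\<lambda>p. H (coupled (T (r (s k))) p)) \<in> borel_measurable (N \<Otimes>\<^sub>M Ws)" for k
        using measurable_compose[OF coupled_measurable[OF T0] Hm] .
      show "AE p in N \<Otimes>\<^sub>M Ws. (\<lambda>k. H (coupled (T (r (s k))) p)) \<longlonglongrightarrow> H (sample_path G (fst p))"
        using s
      proof eventually_elim
        case (elim p)
        from continuous_map_limit[OF H elim] show ?case by (simp add: comp_def)
      qed
      show "AE p in N \<Otimes>\<^sub>M Ws. norm (H (coupled (T (r (s k))) p)) \<le> B" for k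
        using B reward_path_cadlag[OF T0] by (simp add: coupled_def)
    qed simp
    then have "\<forall>\<^sub>F k in sequentially. dist (?f (T (r (s k)))) ?L < e" using e(1) unfolding L by (rule tendstoD)
    then show False using r(2) by (auto simp: eventually_sequentially)
  qed
  moreover have "\<forall>\<^sub>F k in sequentially. ?f (T k) = ?f (X k)" using TX by eventually_elim simp
  ultimately show "(\<lambda>k. ?f (X k)) \<longlonglongrightarrow> ?L" by (rule Lim_transform_eventually)
qed

text \<open>
  The pair of coupled rewards and waiting times has the joint law of the original sequences, for
  every \<open>n\<close>.
\<close>

lemma reward_path_law:
  assumes n: "1 \<le> n"
  shows "distr (N \<Otimes>\<^sub>M Ws) (seq_algebra \<Otimes>\<^sub>M seq_algebra) (\<lambda>p. (coupled_Y n (fst p), snd p)) = Ys \<Otimes>\<^sub>M Ws"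
proof -
  have id: "distr Ws seq_algebra (\<lambda>w. w) = Ws" by (rule distr_id2) (simp add: sets_Ws)
  have m: "(\<lambda>w. w) \<in> measurable Ws seq_algebra" using sets_Ws by (simp cong: measurable_cong_sets)
  have "distr N seq_algebra (coupled_Y n) \<Otimes>\<^sub>M distr Ws seq_algebra (\<lambda>w. w) = distr (N \<Otimes>\<^sub>M Ws) (seq_algebra \<Otimes>\<^sub>M seq_algebra) (\<lambda>(x, y). (coupled_Y n x, y))"
    by (rule pair_measure_distr[OF coupled_Y_meas m]) (unfold id, rule Ws.sigma_finite_measure_axioms)
  then show ?thesis unfolding coupled_Y_law[OF n] id case_prod_beta' by (rule sym)
qed

end

section \<open>Convergence to the stable subordinator\<close>

lemma iid_sequence_law:
  assumes "prob_space M" "iid M X"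
  shows "distr M (PiM {1..} (\<lambda>_. borel)) (\<lambda>\<omega>. \<lambda>i\<in>{1..}. X i \<omega>) = PiM {1..} (\<lambda>_. distr M borel (X 1))"
proof -
  interpret prob_space M by fact
  have ind: "indep_vars (\<lambda>_. borel) X {1..}" and id: "\<And>i. 1 \<le> i \<Longrightarrow> distr M borel (X i) = distr M borel (X 1)"
    using assms(2) unfolding iid_def by blast+
  have "distr M (PiM {1..} (\<lambda>_. borel)) (\<lambda>\<omega>. \<lambda>i\<in>{1..}. X i \<omega>) = PiM {1..} (\<lambda>i. distr M borel (X i))"
  proof (rule indep_vars_iff_distr_eq_PiM'[THEN iffD1])
    show "X i \<in> borel_measurable M" if "i \<in> {1..}" for i using ind that unfolding indep_vars_def2 by blast
  qed (use ind in simp_all)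
  also have "\<dots> = PiM {1..} (\<lambda>_. distr M borel (X 1))" by (intro PiM_cong refl id) simp
  finally show ?thesis .
qed

lemma regularly_varying_tail_ratio:
  fixes M :: "'a measure" and Y :: "'a \<Rightarrow> real"
  assumes "prob_space M" "Y \<in> borel_measurable M" "regularly_varying_rv M Y \<alpha>"
  defines "Q \<equiv> distr M borel Y"
  shows "\<forall>\<^sub>F x in at_top. 0 < measure Q {x<..}"
    and "\<And>c. 0 < c \<Longrightarrow> ((\<lambda>x. measure Q {c * x<..} / measure Q {x<..}) \<longlongrightarrow> c powr (-\<alpha>)) at_top"
proof -
  obtain l where l: "slowly_varying l" "\<And>x. 0 < x \<Longrightarrow> measure M {\<omega> \<in> space M. Y \<omega> > x} = x powr (-\<alpha>) * l x"
    using assms(3) by (auto simp: regularly_varying_rv_def)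
  have T: "measure Q {x<..} = x powr (-\<alpha>) * l x" if "0 < x" for x
  proof -
    have "Y -` {x<..} \<inter> space M = {\<omega> \<in> space M. Y \<omega> > x}" by auto
    then show ?thesis unfolding Q_def using assms(2) l(2)[OF that] by (simp add: measure_distr)
  qed
  have pos: "\<forall>\<^sub>F x in at_top. 0 < l x" using l(1) by (simp add: slowly_varying_def)
  show "\<forall>\<^sub>F x in at_top. 0 < measure Q {x<..}"
    using pos eventually_gt_at_top[of 0] by eventually_elim (simp add: T)
  fix c :: real assume c: "0 < c"
  have "((\<lambda>x. c powr (-\<alpha>) * (l (c * x) / l x)) \<longlongrightarrow> c powr (-\<alpha>) * 1) at_top"
    using l(1) c by (intro tendsto_mult tendsto_const) (simp add: slowly_varying_def)
  moreover have "\<forall>\<^sub>F x in at_top. c powr (-\<alpha>) * (l (c * x) / l x) = measure Q {c * x<..} / measure Q {x<..}"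
    using eventually_gt_at_top[of 0] by eventually_elim (use c in \<open>simp add: T powr_mult\<close>)
  ultimately show "((\<lambda>x. measure Q {c * x<..} / measure Q {x<..}) \<longlongrightarrow> c powr (-\<alpha>)) at_top"
    by (auto intro: Lim_transform_eventually)
qed

text \<open>
  The hypothesis on \<open>a\<close> concerns the tail at \<open>a n\<close> itself; regular variation extends it to all
  multiples of \<open>a n\<close>.
\<close>

lemma tail_couplingI:
  fixes M :: "'a measure" and Y :: "'a \<Rightarrow> real"
  assumes \<mu>: "positive_stable_law \<alpha> \<mu>" and M: "prob_space M" and Y: "Y \<in> borel_measurable M"
    and Y_nonneg: "AE \<omega> in M. 0 \<le> Y \<omega>" and rv: "regularly_varying_rv M Y \<alpha>"
    and a: "filterlim a at_top sequentially" "(\<lambda>n. real n * measure M {\<omega> \<in> space M. Y \<omega> > a n}) \<longlonglongrightarrow> 1"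
  shows "tail_coupling \<alpha> \<mu> (distr M borel Y) a"
proof -
  interpret prob_space M by fact
  interpret positive_stable_law \<alpha> \<mu> by fact
  define Q where "Q = distr M borel Y"
  note rvt = regularly_varying_tail_ratio[OF M Y rv, folded Q_def]
  have QM: "measure Q {x<..} = measure M {\<omega> \<in> space M. Y \<omega> > x}" for x
  proof -
    have "Y -` {x<..} \<inter> space M = {\<omega> \<in> space M. Y \<omega> > x}" by auto
    then show ?thesis unfolding Q_def using Y by (simp add: measure_distr)
  qed
  have Qr: "real_distribution Q" unfolding Q_def using Y by (rule real_distribution_distr)
  have Qn: "AE x in Q. 0 \<le> x" unfolding Q_def using Y_nonneg Y by (subst AE_distr_iff) auto
  show ?thesis unfolding Q_def[symmetric] tail_coupling_def tail_coupling_axioms_def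
  proof (intro conjI allI impI)
    show "positive_stable_law \<alpha> \<mu>" by fact
    show "real_distribution Q" by fact
    show "AE x in Q. 0 \<le> x" by fact
    show "filterlim a at_top sequentially" by fact
    show "\<exists>C>0. \<exists>z0>0. \<forall>z\<ge>z0. (\<integral>x. min x z \<partial>Q) \<le> C * (z * measure Q {z<..})"
      by (rule truncated_mean_bound[OF Qr Qn \<alpha> rvt(2)]) simp
    fix y :: real assume y: "0 < y"
    have "(\<lambda>n. (real n * measure Q {a n<..}) * (measure Q {y * a n<..} / measure Q {a n<..})) \<longlonglongrightarrow> 1 * y powr (-\<alpha>)"
      using a(2) filterlim_compose[OF rvt(2)[OF y] a(1)] unfolding QM by (rule tendsto_mult)
    moreover have "\<forall>\<^sub>F n in sequentially. (real n * measure Q {a n<..}) * (measure Q {y * a n<..} / measure Q {a n<..}) = real n * measure Q {a n * y<..}"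
      using eventually_compose_filterlim[OF rvt(1) a(1)] by eventually_elim (simp add: mult.commute[of y])
    ultimately show "(\<lambda>n. real n * measure Q {a n * y<..}) \<longlonglongrightarrow> y powr (-\<alpha>)"
      by (auto intro: Lim_transform_eventually)
  qed
qed

theorem theorem4p1:
  fixes \<alpha> :: real
  assumes "0 < \<alpha>" and "\<alpha> < 1"
  shows "\<exists>(N :: (real \<Rightarrow> real) measure) (G :: real \<Rightarrow> (real \<Rightarrow> real) \<Rightarrow> real).
    stable_subordinator N \<alpha> G \<and>
    (\<forall>(M :: 'a measure) (Y :: nat \<Rightarrow> 'a \<Rightarrow> real) (W :: nat \<Rightarrow> 'a \<Rightarrow> real) (\<nu> :: real) (a :: nat \<Rightarrow> real).
      prob_space M \<and>
      iid M Y \<and> iid M W \<and> independent_sequences M Y W \<and>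
      (\<forall>i\<ge>1. AE \<omega> in M. 0 \<le> Y i \<omega>) \<and> (\<forall>i\<ge>1. AE \<omega> in M. 0 \<le> W i \<omega>) \<and>
      (\<forall>i\<ge>1. regularly_varying_rv M (Y i) \<alpha>) \<and>
      0 < 1 / \<nu> \<and> (\<forall>i\<ge>1. integrable M (W i) \<and> 1 / \<nu> = (\<integral>\<omega>. W i \<omega> \<partial>M)) \<and>
      filterlim a at_top sequentially \<and>
      (\<lambda>n. real n * measure M {\<omega> \<in> space M. Y 1 \<omega> > a n}) \<longlonglongrightarrow> 1 \<longrightarrow>
      converges_in_distribution J1_topology M
        (\<lambda>t. sample_path (\<lambda>s \<omega>. partial_sum Y (renewal_count W (t * s) \<omega>) \<omega> / a (nat \<lfloor>\<nu> * t\<rfloor>)))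
        N (sample_path G) at_top)"
proof -
  obtain \<mu> where \<mu>: "positive_stable_law \<alpha> \<mu>" using positive_stable_law_exists[OF assms] by blast
  obtain N :: "(real \<Rightarrow> real) measure" and G where G: "stable_subordinator N \<alpha> G" "distr N borel (G 1) = \<mu>"
    using stable_subordinator_exists[OF \<mu>] by blast
  show ?thesis
  proof (intro exI[of _ N] exI[of _ G] conjI allI impI G(1))
    fix M :: "'a measure" and Y W :: "nat \<Rightarrow> 'a \<Rightarrow> real" and \<nu> :: real and a :: "nat \<Rightarrow> real"
    assume hyp: "prob_space M \<and>
      iid M Y \<and> iid M W \<and> independent_sequences M Y W \<and>
      (\<forall>i\<ge>1. AE \<omega> in M. 0 \<le> Y i \<omega>) \<and> (\<forall>i\<ge>1. AE \<omega> in M. 0 \<le> W i \<omega>) \<and>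
      (\<forall>i\<ge>1. regularly_varying_rv M (Y i) \<alpha>) \<and>
      0 < 1 / \<nu> \<and> (\<forall>i\<ge>1. integrable M (W i) \<and> 1 / \<nu> = (\<integral>\<omega>. W i \<omega> \<partial>M)) \<and>
      filterlim a at_top sequentially \<and>
      (\<lambda>n. real n * measure M {\<omega> \<in> space M. Y 1 \<omega> > a n}) \<longlonglongrightarrow> 1"
    then interpret prob_space M by (rule conjunct1)
    have iY: "iid M Y" and iW: "iid M W" and indYW: "independent_sequences M Y W"
      and Y0: "AE \<omega> in M. 0 \<le> Y 1 \<omega>" and W0: "AE \<omega> in M. 0 \<le> W 1 \<omega>"
      and rv: "regularly_varying_rv M (Y 1) \<alpha>" and \<nu>: "0 < 1 / \<nu>"
      and Wint: "integrable M (W 1)" "1 / \<nu> = (\<integral>\<omega>. W 1 \<omega> \<partial>M)"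
      and a: "filterlim a at_top sequentially" "(\<lambda>n. real n * measure M {\<omega> \<in> space M. Y 1 \<omega> > a n}) \<longlonglongrightarrow> 1"
      using hyp order_refl[of "1::nat"] by blast+
    have Y1: "Y 1 \<in> borel_measurable M" using iY unfolding iid_def indep_vars_def2 by simp
    have W1: "W 1 \<in> borel_measurable M" using iW unfolding iid_def indep_vars_def2 by simp
    define Q where "Q = distr M borel (Y 1)"
    define R where "R = distr M borel (W 1)"
    have tc: "tail_coupling \<alpha> \<mu> Q a"
      unfolding Q_def by (rule tail_couplingI[OF \<mu> prob_space_axioms Y1 Y0 rv a])
    interpret renewal_coupling \<alpha> \<mu> Q a N G R "1 / \<nu>"
      unfolding renewal_coupling_def renewal_coupling_axioms_def
    proof (intro conjI)
      show "tail_coupling \<alpha> \<mu> Q a" by (rule tc)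
      show "real_distribution R" unfolding R_def using W1 by (rule real_distribution_distr)
      show "AE x in R. 0 \<le> x" unfolding R_def using W0 W1 by (subst AE_distr_iff) auto
      show "integrable R (\<lambda>x. x)" unfolding R_def using W1 Wint by (subst integrable_distr_eq) auto
      show "1 / \<nu> = (\<integral>x. x \<partial>R)" unfolding R_def using W1 Wint by (subst integral_distr) auto
    qed (fact G \<nu>)+
    define ys where "ys \<omega> = (\<lambda>i\<in>{1..}. Y i \<omega>)" for \<omega>
    define ws where "ws \<omega> = (\<lambda>i\<in>{1..}. W i \<omega>)" for \<omega>
    have ymeas: "ys \<in> measurable M seq_algebra" and wmeas: "ws \<in> measurable M seq_algebra"
      and joint: "distr M seq_algebra ys \<Otimes>\<^sub>M distr M seq_algebra ws = distr M (seq_algebra \<Otimes>\<^sub>M seq_algebra) (\<lambda>\<omega>. (ys \<omega>, ws \<omega>))"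
      using indYW unfolding independent_sequences_def indep_var_distribution_eq ys_def[abs_def] ws_def[abs_def] by blast+
    have ylaw: "distr M seq_algebra ys = Ys" unfolding ys_def[abs_def] Ys_def by (rule iid_sequence_law[OF prob_space_axioms iY, folded Q_def])
    have wlaw: "distr M seq_algebra ws = Ws" unfolding ws_def[abs_def] Ws_def by (rule iid_sequence_law[OF prob_space_axioms iW, folded R_def])
    have pmeas: "(\<lambda>\<omega>. (ys \<omega>, ws \<omega>)) \<in> measurable M (seq_algebra \<Otimes>\<^sub>M seq_algebra)" using ymeas wmeas by (rule measurable_Pair)
    have plaw: "distr M (seq_algebra \<Otimes>\<^sub>M seq_algebra) (\<lambda>\<omega>. (ys \<omega>, ws \<omega>)) = Ys \<Otimes>\<^sub>M Ws" using joint unfolding ylaw wlaw by (rule sym)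
    have clock_index: "clock_index t = nat \<lfloor>\<nu> * t\<rfloor>" for t unfolding clock_index_def by (simp add: mult.commute)
    define X' where "X' t \<omega> = reward_path t (clock_index t) (ys \<omega>, ws \<omega>)" for t \<omega>
    have X'_meas: "X' t \<in> measurable M (borel_of J1_topology)" if "0 < t" for t
      unfolding X'_def[abs_def] by (rule measurable_compose[OF pmeas reward_path_measurable[OF that]])
    have "AE w in distr M seq_algebra ws. renewal_seq w" unfolding wlaw by (rule AE_renewal_seq)
    then have good: "AE \<omega> in M. renewal_seq (ws \<omega>)" by (rule AE_distrD[OF wmeas])
    have X'_AE: "AE \<omega> in M. sample_path (\<lambda>s \<omega>. partial_sum Y (renewal_count W (t * s) \<omega>) \<omega> / a (nat \<lfloor>\<nu> * t\<rfloor>)) \<omega> = X' t \<omega>" for t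
      using good
    proof eventually_elim
      case (elim \<omega>)
      have Ysum: "partial_sum Y k \<omega> = seq_sum (ys \<omega>) k" for k
        unfolding partial_sum_def seq_sum_def ys_def by (intro sum.cong) auto
      have Wsum: "partial_sum W k \<omega> = seq_sum (ws \<omega>) k" for k
        unfolding partial_sum_def seq_sum_def ws_def by (intro sum.cong) auto
      have "renewal_count W u \<omega> = seq_count (ws \<omega>) u" for u
        unfolding renewal_count_def seq_count_def Wsum ..
      then show ?case using elim unfolding X'_def reward_path_def sample_path_def Ysum clock_index by simp
    qed
    have X'_law: "(\<integral>\<omega>. H (X' t \<omega>) \<partial>M) = (\<integral>p. H (coupled t p) \<partial>(N \<Otimes>\<^sub>M Ws))"
      if t: "0 < t" "1 \<le> clock_index t" and H: "continuous_map J1_topology euclideanreal H" for H t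
    proof -
      have Hm: "(\<lambda>q. H (reward_path t (clock_index t) q)) \<in> borel_measurable (seq_algebra \<Otimes>\<^sub>M seq_algebra)"
        by (rule measurable_compose[OF reward_path_measurable[OF t(1)] continuous_map_borel_of[OF H]])
      have cmeas: "(\<lambda>p. (coupled_Y (clock_index t) (fst p), snd p)) \<in> measurable (N \<Otimes>\<^sub>M Ws) (seq_algebra \<Otimes>\<^sub>M seq_algebra)"
      proof -
        have [measurable]: "snd \<in> measurable (N \<Otimes>\<^sub>M Ws) seq_algebra"
          using measurable_snd[of N Ws] sets_Ws by (simp cong: measurable_cong_sets)
        show ?thesis by measurable
      qed
      have "(\<integral>\<omega>. H (X' t \<omega>) \<partial>M) = (\<integral>q. H (reward_path t (clock_index t) q) \<partial>distr M (seq_algebra \<Otimes>\<^sub>M seq_algebra) (\<lambda>\<omega>. (ys \<omega>, ws \<omega>)))"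
        unfolding X'_def by (rule integral_distr[OF pmeas Hm, symmetric])
      also have "\<dots> = (\<integral>q. H (reward_path t (clock_index t) q) \<partial>distr (N \<Otimes>\<^sub>M Ws) (seq_algebra \<Otimes>\<^sub>M seq_algebra) (\<lambda>p. (coupled_Y (clock_index t) (fst p), snd p)))"
        unfolding plaw reward_path_law[OF t(2)] ..
      also have "\<dots> = (\<integral>p. H (coupled t p) \<partial>(N \<Otimes>\<^sub>M Ws))"
        unfolding coupled_def by (rule integral_distr[OF cmeas Hm])
      finally show ?thesis .
    qed
    show "converges_in_distribution J1_topology M
        (\<lambda>t. sample_path (\<lambda>s \<omega>. partial_sum Y (renewal_count W (t * s) \<omega>) \<omega> / a (nat \<lfloor>\<nu> * t\<rfloor>)))
        N (sample_path G) at_top"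
      unfolding converges_in_distribution_def
    proof (intro conjI G_path_measurable exI[of _ X'] allI impI)
      show "\<forall>\<^sub>F t in at_top. X' t \<in> measurable M (borel_of J1_topology) \<and>
        (AE \<omega> in M. sample_path (\<lambda>s \<omega>. partial_sum Y (renewal_count W (t * s) \<omega>) \<omega> / a (nat \<lfloor>\<nu> * t\<rfloor>)) \<omega> = X' t \<omega>)"
        using eventually_gt_at_top[of 0] by eventually_elim (intro conjI X'_meas X'_AE)
      fix H assume H: "continuous_map J1_topology euclideanreal H \<and> bounded (H ` topspace J1_topology)"
      have "\<forall>\<^sub>F t in at_top. 1 \<le> clock_index t" using clock_index_at_top unfolding filterlim_at_top by blast
      then have "\<forall>\<^sub>F t in at_top. (\<integral>p. H (coupled t p) \<partial>(N \<Otimes>\<^sub>M Ws)) = (\<integral>\<omega>. H (X' t \<omega>) \<partial>M)"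
        using eventually_gt_at_top[of 0] by eventually_elim (use X'_law H in simp)
      with coupled_expectation_limit[of H] H
      show "((\<lambda>t. \<integral>\<omega>. H (X' t \<omega>) \<partial>M) \<longlongrightarrow> (\<integral>\<omega>. H (sample_path G \<omega>) \<partial>N)) at_top"
        by (auto intro: Lim_transform_eventually)
    qed
  qed
qed

end
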